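(* Let $R \in \mathbb{N}$, $r \in \{1,2,\ldots,R\}$, and $h, k \in \mathbb{N}_0$ with $0\leq h<k$ and $\gcd (h,k) =1$. Let $h' \in \mathbb{Z}$ with $0 \leq h' < k$ and $hh' \equiv -1 \pmod{k}$. Then, for every $z \in \mathbb{C}$ with $\mathrm{Re}(z) > 0$, \[ F_{R,r} \!\left( \frac{h}{k} + \frac{iz}{k^2} \right) = - C_{R,r,k} \frac{\mathrm{Log} (z)}{z} + \frac{A_{R,r,h,k}}{z} + B_{R,r,h,k} + \frac{ik}{z} \sum_{\alpha_1,\alpha_2 =0}^{R-1} \psi_{R,r,h,k} (\boldsymbol{\alpha}) \left( f_{R,\boldsymbol{\alpha}} \!\left( \frac{h'}{k} + \frac{i}{z} \right) + \mathcal{I}_{R,\boldsymbol{\alpha},\frac{h'}{k}} \!\left( \frac{h'}{k} + \frac{i}{z} \right) \right). \]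
   Context: Let $\mathbb{H}$ be the upper half plane, $\tau\in\mathbb{H}$, $q:=e^{2\pi i\tau}$, $\zeta_N:=e^{2\pi i/N}$, and $\mathrm{Log}$ the principal branch of the logarithm. For $R\in\mathbb{N}$ and $r\in\{1,\dots,R\}$ let $F_{R,r}(\tau):=\sum_{m\ge1,\ m\equiv r \pmod R}\frac{q^m}{1-q^m}$. For $\boldsymbol{\alpha}=(\alpha_1,\alpha_2)\in\mathbb{Z}^2$ let $f_{R,\boldsymbol{\alpha}}(\tau):=\frac14\sum_{\boldsymbol{n}\in\mathbb{Z}^2+\frac{\boldsymbol{\alpha}}{R},\ n_1,n_2\neq0}(\mathrm{sgn}(n_1)+\mathrm{sgn}(n_2))q^{Rn_1n_2}$, and, for $\varrho\in\mathbb{Q}$, $\mathcal{I}_{R,\boldsymbol{\alpha},\varrho}(\tau):=\frac{1}{2\pi i}\sum_{\boldsymbol{n}\in\mathbb{Z}^2+\frac{\boldsymbol{\alpha}}{R},\ n_1,n_2\neq0}\frac{e^{2\pi i R\varrho n_1n_2}}{Rn_1n_2}\,\mathrm{PV}\!\int_0^\infty\frac{x\,e^{2\pi i(\tau-\varrho)x}}{x-Rn_1n_2}\,dx$, where PV denotes the Cauchy principal value. Let $(\!(x)\!):=x-\lfloor x\rfloor-\frac12$ for $x\notin\mathbb{Z}$ and $(\!(x)\!):=0$ for $x\in\mathbb{Z}$; let $\psi$ denote the digamma function $\Gamma'/\Gamma$; $\delta_S=1$ if statement $S$ holds and $0$ otherwise. Define $A_{R,r,h,k}:=-\frac{k}{2\pi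 R}\sum_{\ell=0}^{k-1}\Big(\pi i(\!(\tfrac{h(R\ell+r)}{k})\!)+\frac{\delta_{k\nmid(R\ell+r)}}{2}\log\big(4\sin^2(\tfrac{\pi h(R\ell+r)}{k})\big)+\delta_{k\mid(R\ell+r)}\big(\log(\tfrac{2\pi R}{k})+\psi(\tfrac{R\ell+r}{Rk})\big)\Big)$, $B_{R,r,h,k}:=\frac12\sum_{\ell=0}^{k-1}\Big(\frac{R\ell+r}{Rk}-\frac12\Big)\Big(1-i\,\delta_{k\nmid(R\ell+r)}\cot\big(\tfrac{\pi h(R\ell+r)}{k}\big)\Big)$, $C_{R,r,k}:=\frac{k^2\,\delta_{\gcd(R,k)\mid r}}{2\pi\,\mathrm{lcm}(R,k)}$, and the Weil multiplier $\psi_{R,r,h,k}(\boldsymbol{\alpha}):=\frac{\zeta_{Rk}^{-h'\alpha_1\alpha_2}}{Rk}\sum_{\nu_1,\nu_2=0}^{k-1}e^{\frac{2\pi i}{k}\left(Rh\nu_1(\nu_2+\frac rR)-\alpha_2\nu_1-\alpha_1(\nu_2+\frac rR)\right)}$. *)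

theory Defs
  imports "HOL-Analysis.Analysis" "HOL-Number_Theory.Cong"
begin

definition nome :: "complex \<Rightarrow> complex" where
  "nome \<tau> = exp (2 * pi * \<i> * \<tau>)"

definition root_of_unity :: "nat \<Rightarrow> complex" where
  "root_of_unity N = exp (2 * pi * \<i> / of_nat N)"

definition F_series :: "nat \<Rightarrow> nat \<Rightarrow> complex \<Rightarrow> complex" where
  "F_series R r \<tau> = (\<Sum>\<^sub>\<infinity>m\<in>{m. m \<ge> 1 \<and> [m = r] (mod R)}. nome \<tau> ^ m / (1 - nome \<tau> ^ m))"

text \<open>The points of \<open>\<int>\<^sup>2 + \<alpha>/R\<close> with both coordinates nonzero.\<close>

definition shifted_lattice :: "nat \<Rightarrow> int \<times> int \<Rightarrow> (real \<times> real) set" where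
  "shifted_lattice R \<alpha> =
     {(n1, n2). (\<exists>m1 m2 :: int. n1 = of_int m1 + of_int (fst \<alpha>) / of_nat R
                              \<and> n2 = of_int m2 + of_int (snd \<alpha>) / of_nat R)
                \<and> n1 \<noteq> 0 \<and> n2 \<noteq> 0}"

text \<open>The exponent \<open>R n\<^sub>1 n\<^sub>2\<close> is in general not an integer, so the power of
  \<open>q\<close> is \<open>exp (2 \<pi> i R n\<^sub>1 n\<^sub>2 \<tau>)\<close>.\<close>

definition f_series :: "nat \<Rightarrow> int \<times> int \<Rightarrow> complex \<Rightarrow> complex" where
  "f_series R \<alpha> \<tau> =
     1 / 4 * (\<Sum>\<^sub>\<infinity>(n1, n2)\<in>shifted_lattice R \<alpha>.
        of_real (sgn n1 + sgn n2) * exp (2 * pi * \<i> * \<tau> * of_real (of_nat R * n1 * n2)))"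

text \<open>Cauchy principal value of the integral of \<open>f\<close> over \<open>S\<close>, with the only
  possible singularity at \<open>a\<close>. If \<open>a\<close> lies outside the closure of \<open>S\<close>, this is the
  ordinary integral.\<close>

definition pv_integral :: "real set \<Rightarrow> real \<Rightarrow> (real \<Rightarrow> complex) \<Rightarrow> complex" where
  "pv_integral S a f =
     Lim (at_right 0) (\<lambda>\<epsilon>. set_lebesgue_integral lborel (S - {a - \<epsilon><..<a + \<epsilon>}) f)"

definition I_series :: "nat \<Rightarrow> int \<times> int \<Rightarrow> rat \<Rightarrow> complex \<Rightarrow> complex" where
  "I_series R \<alpha> \<rho> \<tau> =
     1 / (2 * pi * \<i>) * (\<Sum>\<^sub>\<infinity>(n1, n2)\<in>shifted_lattice R \<alpha>.
        exp (2 * pi * \<i> * of_nat R * of_rat \<rho> * of_real (n1 * n2)) / of_real (of_nat R * n1 * n2)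
        * pv_integral {0..} (of_nat R * n1 * n2)
            (\<lambda>x. of_real x * exp (2 * pi * \<i> * (\<tau> - of_rat \<rho>) * of_real x)
                  / of_real (x - of_nat R * n1 * n2)))"

definition sawtooth :: "real \<Rightarrow> real" where
  "sawtooth x = (if x \<in> \<int> then 0 else x - of_int \<lfloor>x\<rfloor> - 1 / 2)"

text \<open>When \<open>k\<close> divides \<open>R\<ell> + r\<close>, the terms \<open>ln 0\<close> and \<open>cot\<close> at a multiple of \<open>\<pi>\<close>
  below are multiplied by \<open>of_bool False = 0\<close>.\<close>

definition A_coeff :: "nat \<Rightarrow> nat \<Rightarrow> nat \<Rightarrow> nat \<Rightarrow> complex" where
  "A_coeff R r h k =
     - of_nat k / (2 * pi * of_nat R) * (\<Sum>l = 0..k - 1.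
          pi * \<i> * of_real (sawtooth (real (h * (R * l + r)) / real k))
        + of_bool (\<not> k dvd R * l + r) / 2
            * of_real (ln (4 * (sin (pi * real (h * (R * l + r)) / real k))\<^sup>2))
        + of_bool (k dvd R * l + r)
            * of_real (ln (2 * pi * real R / real k)
                       + Digamma (real (R * l + r) / real (R * k))))"

definition B_coeff :: "nat \<Rightarrow> nat \<Rightarrow> nat \<Rightarrow> nat \<Rightarrow> complex" where
  "B_coeff R r h k =
     1 / 2 * (\<Sum>l = 0..k - 1.
        of_real (real (R * l + r) / real (R * k) - 1 / 2)
        * (1 - \<i> * of_bool (\<not> k dvd R * l + r)
                * of_real (cot (pi * real (h * (R * l + r)) / real k))))"

definition C_coeff :: "nat \<Rightarrow> nat \<Rightarrow> nat \<Rightarrow> real" where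
  "C_coeff R r k = (real k)\<^sup>2 * of_bool (gcd R k dvd r) / (2 * pi * real (lcm R k))"

definition weil_multiplier ::
  "nat \<Rightarrow> nat \<Rightarrow> nat \<Rightarrow> int \<Rightarrow> nat \<Rightarrow> int \<times> int \<Rightarrow> complex" where
  "weil_multiplier R r h h' k \<alpha> =
     root_of_unity (R * k) powi (- h' * fst \<alpha> * snd \<alpha>) / of_nat (R * k)
     * (\<Sum>\<nu>1 = 0..k - 1. \<Sum>\<nu>2 = 0..k - 1.
          exp (2 * pi * \<i> / of_nat k
               * (of_nat R * of_nat h * of_nat \<nu>1 * (of_nat \<nu>2 + of_nat r / of_nat R)
                  - of_int (snd \<alpha>) * of_nat \<nu>1
                  - of_int (fst \<alpha>) * (of_nat \<nu>2 + of_nat r / of_nat R))))"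

end

theory Submission
  imports Defs "HOL-Real_Asymp.Real_Asymp"
begin

text \<open>
  Write \<open>M = R l + r\<close>, \<open>a = M / (R k)\<close> and \<open>Z = R z / k\<close>. Splitting the summation over \<open>m\<close> into
  classes modulo \<open>R k\<close> turns the Lambert series into sums \<open>\<Sum>j\<ge>0. g (a + j)\<close> with
  \<open>g x = 1 / (exp (2 \<pi> x Z - 2 \<pi> i h M / k) - 1)\<close>. The Euler-Maclaurin formula, with the periodic
  Bernoulli polynomial replaced by its Fourier series, produces the elementary terms and Fourier
  integrals of \<open>g'\<close>. The partial fractions of \<open>g\<close> (poles at \<open>x = i m / (k Z)\<close>, \<open>m \<equiv> h M\<close> modulo \<open>k\<close>)
  turn these into a double series of integrals of \<open>exp (2 \<pi> i n x) / (x - i m / (k Z))\<^sup>2\<close>. Writing the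
  square as a Laplace transform and exchanging integrals gives
  \<open>\<integral> x exp (- 2 \<pi> x / z) / (x - n m / R - i 0)\<close>, which the Sokhotski-Plemelj formula splits into the
  principal value occurring in \<open>I_series\<close> and the residue occurring in \<open>f_series\<close>. The Weil multiplier
  is the finite Fourier transform that collects the congruences \<open>m \<equiv> h M\<close> over all \<open>l\<close>.
\<close>

section \<open>Fourier series of the second Bernoulli polynomial\<close>

text \<open>The obstacle is conditional convergence. The partial fractions of \<open>g\<close> and
  the Fourier series of the sawtooth converge only conditionally, and the inner integral left by the
  exchange does not converge at all, while \<open>has_sum\<close> and the Lebesgue integral deal in
  absolute convergence. Each is replaced by an absolutely convergent variant: the partial fractions
  by terms 1/(x + s) - 1/s with the pole of index 0 split off, the sawtooth by its primitive, hence
  Euler-Maclaurin of order two in place of Poisson summation, and the integral by one damped with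
  exp(- delta a), delta -> 0. The double series over poles m and frequencies n is then dominated by
  a multiple of 1/(m^2 n^2), uniformly in the number N of summands, so N -> infinity passes through
  it. The two signs in \<open>f_series\<close> record where the pole n m / R of the last integral
  lies: it meets the half-line of integration only if n and m have equal signs, and there the
  residue arises. \<open>Ln z\<close> and the digamma value come from those l alone for which k
  divides M, since only then is x = 0 a pole of \<open>g\<close>.\<close>

lemma has_sum_integral_M_test:
  fixes f :: "'i \<Rightarrow> real \<Rightarrow> complex"
  assumes cont: "\<And>i. i \<in> A \<Longrightarrow> continuous_on {a..b} (f i)"
    and sum: "\<And>x. x \<in> {a..b} \<Longrightarrow> ((\<lambda>i. f i x) has_sum F x) A"
    and bound: "\<And>i x. i \<in> A \<Longrightarrow> x \<in> {a..b} \<Longrightarrow> norm (f i x) \<le> M i"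
    and summable: "M summable_on A"
  shows "continuous_on {a..b} F"
    and "((\<lambda>i. integral {a..b} (f i)) has_sum integral {a..b} F) A"
proof -
  \<comment> \<open>The filter yields X inside A only eventually, whereas
    \<open>uniform_limit_integral\<close> is applied with continuity for every X; terms with index
    outside A are therefore set to 0.\<close>
  define g where "g = (\<lambda>X x. \<Sum>i\<in>X. if i \<in> A then f i x else 0)"
  have ev: "\<forall>\<^sub>F X in finite_subsets_at_top A. finite X \<and> X \<subseteq> A"
    by (rule eventually_finite_subsets_at_top_weakI) auto
  have "uniform_limit {a..b} (\<lambda>X x. \<Sum>i\<in>X. f i x) F (finite_subsets_at_top A)"
    by (rule Weierstrass_m_test_general'[OF bound sum summable])
  moreover have "\<forall>\<^sub>F X in finite_subsets_at_top A. \<forall>x\<in>{a..b}. (\<Sum>i\<in>X. f i x) = g X x"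
    using ev by eventually_elim (auto simp: g_def intro!: sum.cong)
  ultimately have lim: "uniform_limit {a..b} g F (finite_subsets_at_top A)"
    using uniform_limit_cong by (smt (verit, best) eventually_mono)
  have "continuous_on {a..b} (\<lambda>x. if i \<in> A then f i x else 0)" for i
    by (cases "i \<in> A") (auto intro: cont)
  then have cg: "continuous_on {a..b} (g X)" for X
    unfolding g_def by (intro continuous_on_sum)
  show "continuous_on {a..b} F"
    by (rule uniform_limit_theorem[OF _ lim]) (auto intro: always_eventually cg)
  obtain I J where IJ: "\<And>X. (g X has_integral I X) {a..b}" "(F has_integral J) {a..b}"
      "(I \<longlongrightarrow> J) (finite_subsets_at_top A)"
    using uniform_limit_integral[OF lim cg] by (metis finite_subsets_at_top_neq_bot)
  have "\<forall>\<^sub>F X in finite_subsets_at_top A. I X = (\<Sum>i\<in>X. integral {a..b} (f i))"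
    using ev
  proof eventually_elim
    case (elim X)
    have "g X = (\<lambda>x. \<Sum>i\<in>X. f i x)"
      using elim by (auto simp: g_def fun_eq_iff intro!: sum.cong)
    moreover have "integral {a..b} (\<lambda>x. \<Sum>i\<in>X. f i x) = (\<Sum>i\<in>X. integral {a..b} (f i))"
      using elim by (intro integral_sum) (auto intro!: integrable_continuous_real cont)
    ultimately show ?case using IJ(1)[of X] by (simp add: integral_unique)
  qed
  then have "((\<lambda>X. \<Sum>i\<in>X. integral {a..b} (f i)) \<longlongrightarrow> J) (finite_subsets_at_top A)"
    using IJ(3) by (rule tendsto_cong[THEN iffD1])
  then show "((\<lambda>i. integral {a..b} (f i)) has_sum integral {a..b} F) A"
    using IJ(2) by (simp add: has_sum_def integral_unique)
qed

text \<open>Tannery's theorem: by the M-test the finite partial sums converge uniformly in N, so the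
  limits over finite subsets and over N can be swapped. It carries out both r -> 1 in the damped
  series and N -> infinity in the Euler-Maclaurin formula.\<close>

lemma has_sum_tendsto_dominated:
  fixes f :: "'i \<Rightarrow> nat \<Rightarrow> complex"
  assumes lim: "\<And>i. i \<in> A \<Longrightarrow> (\<lambda>N. f i N) \<longlonglongrightarrow> g i"
    and bound: "\<And>i N. i \<in> A \<Longrightarrow> norm (f i N) \<le> M i"
    and summable: "M summable_on A"
  shows "(\<lambda>N. \<Sum>\<^sub>\<infinity>i\<in>A. f i N) \<longlonglongrightarrow> (\<Sum>\<^sub>\<infinity>i\<in>A. g i)" and "(\<lambda>i. norm (g i)) summable_on A"
proof -
  have ev: "\<forall>\<^sub>F X in finite_subsets_at_top A. finite X \<and> X \<subseteq> A"
    by (rule eventually_finite_subsets_at_top_weakI) auto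
  have gb: "norm (g i) \<le> M i" if "i \<in> A" for i
    by (rule tendsto_upperbound[OF tendsto_norm[OF lim[OF that]]]) (auto intro!: always_eventually bound that)
  show gs: "(\<lambda>i. norm (g i)) summable_on A"
    by (rule summable_on_comparison_test[OF summable]) (auto intro: gb)
  have ul: "uniform_limit UNIV (\<lambda>X N. \<Sum>i\<in>X. f i N) (\<lambda>N. \<Sum>\<^sub>\<infinity>i\<in>A. f i N) (finite_subsets_at_top A)"
    by (rule Weierstrass_m_test_general[OF bound summable])
  have l2: "\<forall>\<^sub>F X in finite_subsets_at_top A. ((\<lambda>N. \<Sum>i\<in>X. f i N) \<longlongrightarrow> (\<Sum>i\<in>X. g i)) sequentially"
    using ev by eventually_elim (auto intro!: tendsto_sum lim)
  have l3: "((\<lambda>X. \<Sum>i\<in>X. g i) \<longlongrightarrow> (\<Sum>\<^sub>\<infinity>i\<in>A. g i)) (finite_subsets_at_top A)"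
    by (rule infsum_tendsto) (rule abs_summable_summable[OF gs])
  show "(\<lambda>N. \<Sum>\<^sub>\<infinity>i\<in>A. f i N) \<longlonglongrightarrow> (\<Sum>\<^sub>\<infinity>i\<in>A. g i)"
    by (rule swap_uniform_limit'[OF l2 l3 ul]) auto
qed

lemma has_sum_minus_fun:
  fixes f g :: "'i \<Rightarrow> 'a :: topological_ab_group_add"
  assumes "(f has_sum a) A" "(g has_sum b) A"
  shows "((\<lambda>x. f x - g x) has_sum (a - b)) A"
proof -
  have "((\<lambda>x. - g x) has_sum - b) A"
    using assms(2) by (simp add: has_sum_uminus)
  from has_sum_add[OF assms(1) this] show ?thesis by simp
qed

text \<open>Imaginary part of the power series of Ln(1 - r e^{2 pi i x}). The Abel factor r < 1
  makes the convergence absolute; at r = 1 the sine series converges only conditionally.\<close>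

lemma sin_series_damped:
  fixes r x :: real
  assumes "0 \<le> r" "r < 1"
  shows "(\<lambda>n. r ^ Suc n * sin (2 * pi * real (Suc n) * x) / real (Suc n)) sums
           - Im (Ln (1 - r * cis (2 * pi * x)))"
proof -
  have "norm (- (r * cis (2 * pi * x))) < 1" using assms by (simp add: norm_mult)
  from Ln_series'[OF this]
  have "(\<lambda>n. - ((r * cis (2 * pi * x)) ^ n) / of_nat n) sums Ln (1 - r * cis (2 * pi * x))"
    by simp
  then have "(\<lambda>n. - ((r * cis (2 * pi * x)) ^ Suc n) / of_nat (Suc n)) sums Ln (1 - r * cis (2 * pi * x))"
    by (subst sums_Suc_iff) simp
  then have "(\<lambda>n. - Im (- ((r * cis (2 * pi * x)) ^ Suc n) / of_nat (Suc n))) sums - Im (Ln (1 - r * cis (2 * pi * x)))"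
    by (intro sums_minus sums_Im)
  moreover have "- Im (- ((r * cis (2 * pi * x)) ^ Suc n) / of_nat (Suc n)) =
      r ^ Suc n * sin (2 * pi * real (Suc n) * x) / real (Suc n)" for n
  proof -
    have Im_of_real_mult: "Im (of_real c * w) = c * Im w" for c w by simp
    have "(r * cis (2 * pi * x)) ^ Suc n = of_real (r ^ Suc n) * cis (real (Suc n) * (2 * pi * x))"
      by (simp only: power_mult_distrib of_real_power Complex.DeMoivre)
    moreover have "real (Suc n) * (2 * pi * x) = 2 * pi * real (Suc n) * x" by simp
    ultimately have "Im ((r * cis (2 * pi * x)) ^ Suc n) = r ^ Suc n * sin (2 * pi * real (Suc n) * x)"
      using Im_of_real_mult by (simp only: cis.sel)
    then show ?thesis by (simp only: Im_divide_of_nat uminus_complex.sel minus_divide_left minus_minus)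
  qed
  ultimately show ?thesis by (simp only:)
qed

lemma summable_on_inverse_Suc_squares: "(\<lambda>n. 1 / (real (Suc n))\<^sup>2) summable_on UNIV"
proof (subst summable_on_UNIV_nonneg_real_iff)
  show "summable (\<lambda>n. 1 / (real (Suc n))\<^sup>2)"
    using sums_summable[OF inverse_squares_sums] by (simp only: Suc_eq_plus1 of_nat_power)
qed simp

lemma one_minus_notin_nonpos:
  fixes r :: real
  assumes "0 \<le> r" "r < 1"
  shows "1 - of_real r * cis t \<notin> \<real>\<^sub>\<le>\<^sub>0"
proof
  assume "1 - of_real r * cis t \<in> \<real>\<^sub>\<le>\<^sub>0"
  then have "1 \<le> r * cos t" by (simp add: complex_nonpos_Reals_iff)
  also have "\<dots> \<le> r" using assms mult_left_mono[of "cos t" 1 r] by simp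
  finally show False using assms by simp
qed

text \<open>Termwise integration gains the second power of n in the denominator. It starts at 1/2
  and will later stop at b < 1, hence stays away from the integers, where Ln(1 - e^{2 pi i x}) is
  singular and r -> 1 would fail.\<close>

lemma integral_sin_series_damped:
  fixes r b :: real
  assumes r: "0 \<le> r" "r < 1" and b: "1/2 \<le> b"
  shows "((\<lambda>n. r ^ Suc n * (cos (2 * pi * real (Suc n) * b) - cos (pi * real (Suc n))) / (real (Suc n))\<^sup>2) has_sum
           2 * pi * integral {1/2..b} (\<lambda>x. Im (Ln (1 - r * cis (2 * pi * x))))) UNIV"
proof -
  define f where "f = (\<lambda>n x. complex_of_real (r ^ Suc n * sin (2 * pi * real (Suc n) * x) / real (Suc n)))"
  define F where "F = (\<lambda>x. complex_of_real (- Im (Ln (1 - r * cis (2 * pi * x)))))"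
  have bound: "norm (f n x) \<le> r ^ Suc n" for n x
  proof -
    have "r ^ Suc n * \<bar>sin (2 * pi * real (Suc n) * x)\<bar> \<le> r ^ Suc n * real (Suc n)"
      using r abs_sin_le_one[of "2 * pi * real (Suc n) * x"]
      by (intro mult_left_mono) (auto simp del: abs_sin_le_one)
    then show ?thesis using r by (simp add: f_def abs_mult field_simps norm_divide norm_mult norm_power del: of_nat_Suc)
  qed
  have rs: "summable (\<lambda>n. r ^ Suc n)"
    using r by (simp add: summable_mult summable_geometric)
  have sm: "(\<lambda>n. r ^ Suc n) summable_on UNIV"
    using r rs by (subst summable_on_UNIV_nonneg_real_iff) auto
  have hs: "((\<lambda>n. f n x) has_sum F x) UNIV" for x
  proof (rule norm_summable_imp_has_sum)
    show "summable (\<lambda>n. norm (f n x))"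
      by (rule summable_comparison_test'[OF rs]) (use bound in auto)
    show "(\<lambda>n. f n x) sums F x"
      unfolding f_def F_def by (rule sums_of_real[OF sin_series_damped[OF r]])
  qed
  have "((\<lambda>n. integral {1/2..b} (f n)) has_sum integral {1/2..b} F) UNIV"
    by (rule has_sum_integral_M_test(2)[OF _ hs bound sm])
       (auto simp: f_def simp del: of_nat_Suc power_Suc intro!: continuous_intros)
  moreover have "integral {1/2..b} (f n) =
      of_real (- (r ^ Suc n * (cos (2 * pi * real (Suc n) * b) - cos (pi * real (Suc n))) / (2 * pi * (real (Suc n))\<^sup>2)))" for n
  proof -
    define m where "m = real (Suc n)"
    have m: "m > 0" by (simp add: m_def)
    have "((\<lambda>x. complex_of_real (r ^ Suc n * sin (2 * pi * m * x) / m)) has_integral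
        of_real (- (r ^ Suc n * cos (2 * pi * m * b) / (2 * pi * m\<^sup>2))) -
        of_real (- (r ^ Suc n * cos (2 * pi * m * (1/2)) / (2 * pi * m\<^sup>2)))) {1/2..b}"
      using b m by (intro fundamental_theorem_of_calculus)
        (auto intro!: derivative_eq_intros has_vector_derivative_of_real
           simp: has_real_derivative_iff_has_vector_derivative[symmetric] power2_eq_square field_simps simp del: power_Suc)
    then have "integral {1/2..b} (f n) = of_real (- (r ^ Suc n * cos (2 * pi * m * b) / (2 * pi * m\<^sup>2))) -
        of_real (- (r ^ Suc n * cos (2 * pi * m * (1/2)) / (2 * pi * m\<^sup>2)))"
      unfolding f_def m_def[symmetric] by (rule integral_unique)
    also have "\<dots> = of_real (- (r ^ Suc n * (cos (2 * pi * m * b) - cos (pi * m)) / (2 * pi * m\<^sup>2)))"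
      by (subst of_real_diff[symmetric]) (simp add: diff_divide_distrib right_diff_distrib mult_ac del: power_Suc)
    finally show ?thesis by (simp only: m_def)
  qed
  ultimately have "((\<lambda>n. of_real (- (r ^ Suc n * (cos (2 * pi * real (Suc n) * b) - cos (pi * real (Suc n))) / (2 * pi * (real (Suc n))\<^sup>2)))) has_sum integral {1/2..b} F) UNIV"
    by simp
  moreover have "integral {1/2..b} F = of_real (- integral {1/2..b} (\<lambda>x. Im (Ln (1 - r * cis (2 * pi * x)))))"
  proof -
    have "(\<lambda>x. Im (Ln (1 - r * cis (2 * pi * x)))) integrable_on {1/2..b}"
      by (intro integrable_continuous_real continuous_intros one_minus_notin_nonpos r)
    from integral_linear[OF integrable_neg[OF this], of complex_of_real] bounded_linear_of_real
    show ?thesis by (simp add: F_def o_def)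
  qed
  ultimately have "((\<lambda>n. (- (r ^ Suc n * (cos (2 * pi * real (Suc n) * b) - cos (pi * real (Suc n))) / (2 * pi * (real (Suc n))\<^sup>2)))) has_sum - integral {1/2..b} (\<lambda>x. Im (Ln (1 - r * cis (2 * pi * x))))) UNIV"
    by (simp only: has_sum_of_real_iff)
  from has_sum_cmult_right[OF this, of "- 2 * pi"]
  have "((\<lambda>n. - 2 * pi * - (r ^ Suc n * (cos (2 * pi * real (Suc n) * b) - cos (pi * real (Suc n))) / (2 * pi * (real (Suc n))\<^sup>2))) has_sum
     - 2 * pi * - integral {1/2..b} (\<lambda>x. Im (Ln (1 - r * cis (2 * pi * x))))) UNIV" .
  moreover have "- 2 * pi * - (y / (2 * pi * w)) = y / w" for y w :: real by simp
  ultimately show ?thesis by (simp only: mult_minus_right mult_minus_left minus_minus)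
qed

text \<open>The factorisation 1 - e^{2 pi i x} = 2 sin(pi x) e^{i pi (x - 1/2)} displays modulus and
  argument; for 0 < x < 1 the argument is in the principal range. It serves the Fourier series here
  and later the sawtooth and the log-sine in \<open>A_coeff\<close>.\<close>

lemma Ln_one_minus_cis:
  fixes x :: real
  assumes "0 < x" "x < 1"
  shows "1 - cis (2 * pi * x) \<notin> \<real>\<^sub>\<le>\<^sub>0"
    and "Ln (1 - cis (2 * pi * x)) = of_real (ln (2 * sin (pi * x))) + \<i> * pi * (x - 1/2)"
proof -
  have s: "sin (pi * x) > 0" using assms by (intro sin_gt_zero) auto
  have "cis (2 * pi * x) = cis (pi * x) * cis (pi * x)"
    by (simp add: cis_mult mult.assoc)
  moreover have "1 = cis (pi * x) * cis (- (pi * x))"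
    by (simp add: cis_mult)
  ultimately have "1 - cis (2 * pi * x) = cis (pi * x) * (cis (- (pi * x)) - cis (pi * x))"
    by (metis right_diff_distrib)
  also have "cis (- (pi * x)) - cis (pi * x) = of_real (2 * sin (pi * x)) * cis (- (pi/2))"
    by (simp add: complex_eq_iff)
  also have "cis (pi * x) * (of_real (2 * sin (pi * x)) * cis (- (pi/2))) =
      of_real (2 * sin (pi * x)) * (cis (pi * x) * cis (- (pi / 2)))"
    by (simp only: mult_ac)
  also have "cis (pi * x) * cis (- (pi / 2)) = cis (pi * (x - 1/2))"
    by (subst cis_mult) (simp add: algebra_simps)
  also have "of_real (2 * sin (pi * x)) * cis (pi * (x - 1/2)) = exp (of_real (ln (2 * sin (pi * x))) + \<i> * of_real (pi * (x - 1/2)))"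
  proof -
    have "exp (of_real (ln (2 * sin (pi * x)))) = complex_of_real (2 * sin (pi * x))"
      using s by (subst exp_of_real) (subst exp_ln, simp_all)
    then show ?thesis by (simp only: exp_add cis_conv_exp)
  qed
  finally have e: "1 - cis (2 * pi * x) = exp (of_real (ln (2 * sin (pi * x))) + \<i> * of_real (pi * (x - 1/2)))" .
  have i: "Im (of_real (ln (2 * sin (pi * x))) + \<i> * of_real (pi * (x - 1/2))) = pi * (x - 1/2)" by simp
  have "\<bar>x - 1/2\<bar> < 1" using assms by (simp add: abs_less_iff)
  then have "\<bar>pi * (x - 1/2)\<bar> < pi" by (simp add: abs_mult)
  then have "- pi < pi * (x - 1/2)" "pi * (x - 1/2) \<le> pi" by linarith+
  then have "Ln (1 - cis (2 * pi * x)) = of_real (ln (2 * sin (pi * x))) + \<i> * of_real (pi * (x - 1/2))"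
    unfolding e by (intro Ln_exp) (simp_all only: i)
  then show "Ln (1 - cis (2 * pi * x)) = of_real (ln (2 * sin (pi * x))) + \<i> * pi * (x - 1/2)"
    by simp
  have "cos (2 * pi * x) < 1"
    using cos_double_sin[of "pi * x"] s by (simp add: mult_ac)
  then show "1 - cis (2 * pi * x) \<notin> \<real>\<^sub>\<le>\<^sub>0"
    by (auto simp: complex_nonpos_Reals_iff)
qed

text \<open>Passage to r = 1: Tannery's theorem on the series with majorant 2/n^2, and dominated
  convergence on the integral with majorant pi, a bound for every Im Ln. The limit integrand is the
  line pi (x - 1/2), whose integral gives the square.\<close>

lemma has_sum_cos_over_squares_diff:
  fixes b :: real
  assumes b: "1/2 \<le> b" "b < 1"
  shows "((\<lambda>n. (cos (2 * pi * real (Suc n) * b) - cos (pi * real (Suc n))) / (real (Suc n))\<^sup>2) has_sum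
           pi\<^sup>2 * (b - 1/2)\<^sup>2) UNIV"
proof -
  define r where "r = (\<lambda>k. real k / real (Suc k))"
  have r: "0 \<le> r k" "r k < 1" for k by (auto simp: r_def)
  have r1: "r \<longlonglongrightarrow> 1" unfolding r_def by real_asymp
  define c where "c = (\<lambda>n. (cos (2 * pi * real (Suc n) * b) - cos (pi * real (Suc n))) / (real (Suc n))\<^sup>2)"
  have cb: "\<bar>c n\<bar> \<le> 2 * (1 / (real (Suc n))\<^sup>2)" for n
  proof -
    have "\<bar>cos (2 * pi * real (Suc n) * b) - cos (pi * real (Suc n))\<bar> \<le> 2"
      using abs_cos_le_one[of "2 * pi * real (Suc n) * b"] abs_cos_le_one[of "pi * real (Suc n)"] by linarith
    then show ?thesis unfolding c_def abs_divide by (simp add: divide_right_mono)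
  qed
  have sm: "(\<lambda>n. 2 * (1 / (real (Suc n))\<^sup>2)) summable_on UNIV"
    by (intro summable_on_cmult_right summable_on_inverse_Suc_squares)
  define J where "J = (\<lambda>k. 2 * pi * integral {1/2..b} (\<lambda>x. Im (Ln (1 - r k * cis (2 * pi * x)))))"
  have hs: "((\<lambda>n. r k ^ Suc n * c n) has_sum J k) UNIV" for k
    unfolding c_def J_def using integral_sin_series_damped[OF r b(1)] by simp
  have "(\<lambda>k. \<Sum>\<^sub>\<infinity>n\<in>UNIV. complex_of_real (r k ^ Suc n * c n)) \<longlonglongrightarrow> (\<Sum>\<^sub>\<infinity>n\<in>UNIV. complex_of_real (c n))"
  proof (rule has_sum_tendsto_dominated(1)[OF _ _ sm])
    show "(\<lambda>k. complex_of_real (r k ^ Suc n * c n)) \<longlonglongrightarrow> complex_of_real (c n)" for n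
      using r1 by (auto intro!: tendsto_eq_intros simp del: power_Suc)
    show "norm (complex_of_real (r k ^ Suc n * c n)) \<le> 2 * (1 / (real (Suc n))\<^sup>2)" for n k
    proof -
      have "norm (complex_of_real (r k ^ Suc n * c n)) = r k ^ Suc n * \<bar>c n\<bar>"
        using r(1)[of k] by (simp only: norm_of_real abs_mult abs_of_nonneg zero_le_power)
      also have "\<dots> \<le> 1 * \<bar>c n\<bar>" using r[of k] by (intro mult_right_mono power_le_one) auto
      also have "\<dots> \<le> 2 * (1 / (real (Suc n))\<^sup>2)" using cb by (simp only: mult_1_left)
      finally show ?thesis .
    qed
  qed
  moreover have "(\<Sum>\<^sub>\<infinity>n\<in>UNIV. complex_of_real (r k ^ Suc n * c n)) = of_real (J k)" for k
    using hs[of k] by (intro infsumI) (simp only: has_sum_of_real_iff)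
  moreover have "c summable_on UNIV"
    by (rule abs_summable_summable, rule summable_on_comparison_test[OF sm]) (use cb in auto)
  then have cs: "(c has_sum infsum c UNIV) UNIV" by simp
  then have "(\<Sum>\<^sub>\<infinity>n\<in>UNIV. complex_of_real (c n)) = of_real (infsum c UNIV)"
    by (intro infsumI) (simp only: has_sum_of_real_iff)
  ultimately have lim: "J \<longlonglongrightarrow> infsum c UNIV"
    by (simp add: tendsto_of_real_iff)
  have "(\<lambda>k. integral {1/2..b} (\<lambda>x. Im (Ln (1 - r k * cis (2 * pi * x))))) \<longlonglongrightarrow>
        integral {1/2..b} (\<lambda>x. pi * (x - 1/2))"
  proof (rule dominated_convergence(2))
    show "(\<lambda>x. Im (Ln (1 - r k * cis (2 * pi * x)))) integrable_on {1/2..b}" for k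
      by (intro integrable_continuous_real continuous_intros one_minus_notin_nonpos r)
    show "(\<lambda>x. pi) integrable_on {1/2..b}" by (rule integrable_const_ivl)
    show "norm (Im (Ln (1 - complex_of_real (r k) * cis (2 * pi * x)))) \<le> pi" for k x
    proof -
      have "1 - complex_of_real (r k) * cis (2 * pi * x) \<noteq> 0"
        using one_minus_notin_nonpos[OF r, of k "2 * pi * x"] by (metis nonpos_Reals_zero_I)
      from mpi_less_Im_Ln[OF this] Im_Ln_le_pi[OF this] show ?thesis
        unfolding real_norm_def by (intro abs_leI) linarith+
    qed
    show "(\<lambda>k. Im (Ln (1 - complex_of_real (r k) * cis (2 * pi * x)))) \<longlonglongrightarrow> pi * (x - 1/2)"
      if x: "x \<in> {1/2..b}" for x
    proof -
      have x': "0 < x" "x < 1" using x b by auto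
      have "(\<lambda>k. Im (Ln (1 - complex_of_real (r k) * cis (2 * pi * x)))) \<longlonglongrightarrow>
          Im (Ln (1 - complex_of_real 1 * cis (2 * pi * x)))"
        using Ln_one_minus_cis(1)[OF x'] by (intro tendsto_intros r1) simp
      then show ?thesis using Ln_one_minus_cis(2)[OF x'] by simp
    qed
  qed
  then have "J \<longlonglongrightarrow> 2 * pi * integral {1/2..b} (\<lambda>x. pi * (x - 1/2))"
    unfolding J_def by (intro tendsto_intros)
  moreover have "((\<lambda>x. pi * (x - 1/2)) has_integral pi * (b - 1/2)\<^sup>2 / 2 - pi * (1/2 - 1/2)\<^sup>2 / 2) {1/2..b}"
    using b by (intro fundamental_theorem_of_calculus)
      (auto intro!: derivative_eq_intros simp: has_real_derivative_iff_has_vector_derivative[symmetric])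
  then have "integral {1/2..b} (\<lambda>x. pi * (x - 1/2)) = pi * (b - 1/2)\<^sup>2 / 2"
    by (intro integral_unique) simp
  ultimately have "J \<longlonglongrightarrow> pi\<^sup>2 * (b - 1/2)\<^sup>2"
    by (simp add: power2_eq_square mult_ac)
  with lim have "infsum c UNIV = pi\<^sup>2 * (b - 1/2)\<^sup>2" by (rule LIMSEQ_unique)
  with cs show ?thesis unfolding c_def by simp
qed

text \<open>Real part of the dilogarithm at e^{2 pi i x}; as a function on the whole line its
  continuity can be used at the endpoint x = 1.\<close>

definition cos_over_squares :: "real \<Rightarrow> real" where
  "cos_over_squares x = (\<Sum>\<^sub>\<infinity>n. cos (2 * pi * real (Suc n) * x) / (real (Suc n))\<^sup>2)"

lemma cos_over_squares_bound: "\<bar>cos t / (real (Suc n))\<^sup>2\<bar> \<le> 1 / (real (Suc n))\<^sup>2"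
  by (simp only: abs_divide abs_power2) (rule divide_right_mono, simp_all)

lemma has_sum_cos_over_squares:
  "((\<lambda>n. cos (2 * pi * real (Suc n) * x) / (real (Suc n))\<^sup>2) has_sum cos_over_squares x) UNIV"
  unfolding cos_over_squares_def
  by (rule has_sum_infsum, rule abs_summable_summable,
      rule summable_on_comparison_test[OF summable_on_inverse_Suc_squares])
     (simp_all only: real_norm_def cos_over_squares_bound abs_ge_zero)

lemma continuous_on_cos_over_squares: "continuous_on UNIV cos_over_squares"
proof (rule uniform_limit_theorem)
  show "uniform_limit UNIV (\<lambda>X x. \<Sum>n\<in>X. cos (2 * pi * real (Suc n) * x) / (real (Suc n))\<^sup>2)
          cos_over_squares (finite_subsets_at_top UNIV)"
    by (rule Weierstrass_m_test_general'[OF _ has_sum_cos_over_squares summable_on_inverse_Suc_squares])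
       (use cos_over_squares_bound in \<open>auto simp del: of_nat_Suc\<close>)
qed (auto intro!: always_eventually continuous_intros simp del: of_nat_Suc)

text \<open>On [1/2, 1) the series is known up to its value at 1/2. Continuity extends this to x =
  1, where the series is zeta(2) = pi^2/6 and so determines the constant; the reflection x -> 1 - x
  gives the other half.\<close>

lemma cos_over_squares_eq:
  assumes "0 \<le> x" "x \<le> 1"
  shows "cos_over_squares x = pi\<^sup>2 * (x\<^sup>2 - x + 1/6)"
proof -
  let ?C = cos_over_squares
  have diff: "?C b = ?C (1/2) + pi\<^sup>2 * (b - 1/2)\<^sup>2" if "1/2 \<le> b" "b < 1" for b
  proof -
    have "((\<lambda>n. cos (2 * pi * real (Suc n) * b) / (real (Suc n))\<^sup>2 - cos (2 * pi * real (Suc n) * (1/2)) / (real (Suc n))\<^sup>2)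
        has_sum (?C b - ?C (1/2))) UNIV"
      by (intro has_sum_minus_fun has_sum_cos_over_squares)
    moreover have "2 * pi * real (Suc n) * (1/2) = pi * real (Suc n)" for n by simp
    ultimately have "((\<lambda>n. (cos (2 * pi * real (Suc n) * b) - cos (pi * real (Suc n))) / (real (Suc n))\<^sup>2)
        has_sum (?C b - ?C (1/2))) UNIV"
      by (simp only: diff_divide_distrib)
    from infsumI[OF this] infsumI[OF has_sum_cos_over_squares_diff[OF that]] show ?thesis by simp
  qed
  have "continuous_on {1/2..1} ?C"
    using continuous_on_cos_over_squares continuous_on_subset by blast
  moreover have "continuous_on {1/2..1} (\<lambda>b. ?C (1/2) + pi\<^sup>2 * (b - 1/2)\<^sup>2)"
    by (intro continuous_intros)
  ultimately have "continuous_on (closure {1/2..<1}) (\<lambda>b. ?C b - (?C (1/2) + pi\<^sup>2 * (b - 1/2)\<^sup>2))"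
    by (intro continuous_on_diff) auto
  then have "?C b - (?C (1/2) + pi\<^sup>2 * (b - 1/2)\<^sup>2) = 0" if "b \<in> {1/2..1}" for b
  proof (rule continuous_constant_on_closure)
    show "?C b - (?C (1/2) + pi\<^sup>2 * (b - 1/2)\<^sup>2) = 0" if "b \<in> {1/2..<1}" for b
      unfolding right_minus_eq by (rule diff) (use that in auto)
  qed (use that in simp)
  then have diff': "?C b = ?C (1/2) + pi\<^sup>2 * (b - 1/2)\<^sup>2" if "b \<in> {1/2..1}" for b
    using that unfolding right_minus_eq .
  have "?C 1 = pi\<^sup>2 / 6"
  proof -
    have "cos (2 * pi * real (Suc n) * 1) = 1" for n
      using cos_int_2pin[of "int (Suc n)"] by (simp only: of_int_of_nat_eq mult_1_right)
    then have "((\<lambda>n. 1 / (real (Suc n))\<^sup>2) has_sum ?C 1) UNIV"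
      using has_sum_cos_over_squares[of 1] by simp
    then have "(\<lambda>n. 1 / (real (Suc n))\<^sup>2) sums ?C 1" by (rule has_sum_imp_sums)
    moreover have "(\<lambda>n. 1 / (real (Suc n))\<^sup>2) sums (pi\<^sup>2 / 6)"
      using inverse_squares_sums by (simp only: Suc_eq_plus1 of_nat_power)
    ultimately show ?thesis by (rule sums_unique2)
  qed
  with diff'[of 1] have half: "?C (1/2) = pi\<^sup>2 / 6 - pi\<^sup>2 / 4" by (simp add: power2_eq_square)
  have main: "?C b = pi\<^sup>2 * (b\<^sup>2 - b + 1/6)" if "b \<in> {1/2..1}" for b
    unfolding diff'[OF that] half by (simp add: power2_eq_square algebra_simps)
  show ?thesis
  proof (cases "x \<ge> 1/2")
    case False
    have "?C x = ?C (1 - x)"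
    proof -
      have "cos (2 * pi * real (Suc n) * (1 - x)) = cos (2 * pi * real (Suc n) * x)" for n
      proof -
        have "2 * pi * real (Suc n) * (1 - x) = - (2 * pi * real (Suc n) * x) + 2 * pi * of_int (int (Suc n))"
          by (simp only: of_int_of_nat_eq right_diff_distrib)
        then show ?thesis
          by (simp only: cos_add cos_int_2pin sin_int_2pin cos_minus mult_zero_right diff_zero mult_1_right)
      qed
      then show ?thesis by (simp add: cos_over_squares_def)
    qed
    also have "\<dots> = pi\<^sup>2 * (x\<^sup>2 - x + 1/6)"
      using main[of "1 - x"] False assms by (simp add: power2_eq_square algebra_simps)
    finally show ?thesis .
  qed (use main assms in auto)
qed

lemma has_sum_nonzero_intI:
  fixes f :: "int \<Rightarrow> 'a :: {topological_comm_monoid_add, t2_space}"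
  assumes "((\<lambda>n. f (int (Suc n))) has_sum a) UNIV" "((\<lambda>n. f (- int (Suc n))) has_sum b) UNIV"
  shows "(f has_sum (a + b)) (UNIV - {0})"
proof -
  have "(f has_sum a) {0<..}"
  proof -
    have "bij_betw (\<lambda>n. int (Suc n)) UNIV {0<..}"
      by (rule bij_betwI[of _ _ _ "\<lambda>n. nat (n - 1)"]) auto
    from has_sum_reindex_bij_betw[OF this, of f a] assms(1) show ?thesis by simp
  qed
  moreover have "(f has_sum b) {..<0}"
  proof -
    have "bij_betw (\<lambda>n. - int (Suc n)) UNIV {..<0}"
      by (rule bij_betwI[of _ _ _ "\<lambda>n. nat (- n - 1)"]) auto
    from has_sum_reindex_bij_betw[OF this, of f b] assms(2) show ?thesis by simp
  qed
  ultimately have "(f has_sum (a + b)) ({0<..} \<union> {..<0})"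
    by (intro has_sum_Un_disjoint) auto
  also have "{0<..} \<union> {..<0} = UNIV - {0::int}" by auto
  finally show ?thesis .
qed

lemma summable_on_inverse_int_squares: "(\<lambda>n. 1 / (real_of_int n)\<^sup>2) summable_on (UNIV - {0})"
proof -
  obtain S where "((\<lambda>n. 1 / (real (Suc n))\<^sup>2) has_sum S) UNIV"
    using summable_on_inverse_Suc_squares summable_on_def by blast
  then have "((\<lambda>n. 1 / (real_of_int n)\<^sup>2) has_sum (S + S)) (UNIV - {0})"
    by (intro has_sum_nonzero_intI) (simp_all only: of_int_minus of_int_of_nat_eq power2_minus)
  then show ?thesis using summable_on_def by blast
qed

text \<open>The value is B_2(x)/2, normalised so that its derivative is the sawtooth x - 1/2.
  Pairing n with - n turns the exponentials into cosines, so the real series above applies.\<close>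

lemma has_sum_Bernoulli2:
  fixes x :: real
  assumes "0 \<le> x" "x \<le> 1"
  shows "((\<lambda>n. cis (2 * pi * of_int n * x) / of_real ((2 * pi * of_int n)\<^sup>2)) has_sum
           of_real ((x\<^sup>2 - x + 1/6) / 2)) (UNIV - {0})"
proof -
  define s where "s = (\<lambda>n. cis (2 * pi * of_int n * x) / of_real ((2 * pi * of_int n)\<^sup>2))"
  have nb: "norm (s n) \<le> (1 / (4 * pi\<^sup>2)) * (1 / (real_of_int n)\<^sup>2)" for n
    by (simp add: s_def norm_divide norm_mult norm_power power_mult_distrib field_simps)
  have ss: "s summable_on (UNIV - {0})"
  proof (rule abs_summable_summable, rule summable_on_comparison_test)
    show "(\<lambda>n. (1 / (4 * pi\<^sup>2)) * (1 / (real_of_int n)\<^sup>2)) summable_on (UNIV - {0})"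
      by (intro summable_on_cmult_right summable_on_inverse_int_squares)
  qed (use nb in auto)
  have "bij_betw uminus (UNIV - {0::int}) (UNIV - {0})"
    by (rule bij_betwI[of _ _ _ uminus]) auto
  then have "infsum (\<lambda>n. s (- n)) (UNIV - {0}) = infsum s (UNIV - {0})" "(\<lambda>n. s (- n)) summable_on (UNIV - {0})"
    using infsum_reindex_bij_betw summable_on_reindex_bij_betw ss by blast+
  then have "((\<lambda>n. s n + s (- n)) has_sum (infsum s (UNIV - {0}) + infsum s (UNIV - {0}))) (UNIV - {0})"
    using ss by (intro has_sum_add) (auto simp: has_sum_iff)
  moreover have "s n + s (- n) = of_real (cos (2 * pi * of_int n * x) / (2 * (pi * of_int n)\<^sup>2))" for n
    by (simp add: s_def complex_eq_iff field_simps power2_eq_square)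
  moreover have "((\<lambda>n. complex_of_real (cos (2 * pi * of_int n * x) / (2 * (pi * of_int n)\<^sup>2))) has_sum
      of_real (1 / (2 * pi\<^sup>2) * cos_over_squares x + 1 / (2 * pi\<^sup>2) * cos_over_squares x)) (UNIV - {0})"
  proof (subst has_sum_of_real_iff, rule has_sum_nonzero_intI)
    have "((\<lambda>n. 1 / (2 * pi\<^sup>2) * (cos (2 * pi * real (Suc n) * x) / (real (Suc n))\<^sup>2)) has_sum
        (1 / (2 * pi\<^sup>2) * cos_over_squares x)) UNIV"
      by (intro has_sum_cmult_right has_sum_cos_over_squares)
    then show "((\<lambda>n. cos (2 * pi * of_int (int (Suc n)) * x) / (2 * (pi * of_int (int (Suc n)))\<^sup>2)) has_sum
        (1 / (2 * pi\<^sup>2) * cos_over_squares x)) UNIV"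
      by (simp only: of_int_of_nat_eq power_mult_distrib times_divide_times_eq mult_1_left mult.assoc)
    then show "((\<lambda>n. cos (2 * pi * of_int (- int (Suc n)) * x) / (2 * (pi * of_int (- int (Suc n)))\<^sup>2)) has_sum
        (1 / (2 * pi\<^sup>2) * cos_over_squares x)) UNIV"
      by (simp only: of_int_minus mult_minus_right mult_minus_left cos_minus power2_minus)
  qed
  ultimately have "2 * infsum s (UNIV - {0}) = of_real (1 / pi\<^sup>2 * cos_over_squares x)"
    using has_sum_unique by fastforce
  also have "1 / pi\<^sup>2 * cos_over_squares x = x\<^sup>2 - x + 1/6"
    by (simp add: cos_over_squares_eq[OF assms])
  finally have "infsum s (UNIV - {0}) = of_real ((x\<^sup>2 - x + 1/6) / 2)"
    by (simp add: field_simps)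
  with has_sum_infsum[OF ss] show ?thesis unfolding s_def by (simp only:)
qed

section \<open>The Euler-Maclaurin formula with Fourier coefficients\<close>

lemma cis_add_int: "cis (2 * pi * of_int n * (of_int m + x)) = cis (2 * pi * of_int n * x)"
proof -
  have "2 * pi * of_int n * (of_int m + x) = 2 * pi * of_int (n * m) + 2 * pi * of_int n * x"
    by (simp add: algebra_simps)
  also have "cis \<dots> = cis (2 * pi * of_int (n * m)) * cis (2 * pi * of_int n * x)"
    by (simp only: cis_mult)
  also have "cis (2 * pi * of_int (n * m)) = 1"
    by (rule cis_multiple_2pi) simp
  finally show ?thesis by simp
qed

text \<open>The series has period 1 and B_2(1 + y) = B_2(- y), so on all of [-1, 1] it is a
  polynomial in the absolute value. This is the range of x - a for x and a in [0, 1].\<close>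

lemma has_sum_Bernoulli2_abs:
  fixes y :: real
  assumes "\<bar>y\<bar> \<le> 1"
  shows "((\<lambda>n. cis (2 * pi * of_int n * y) / of_real ((2 * pi * of_int n)\<^sup>2)) has_sum
           of_real ((\<bar>y\<bar>\<^sup>2 - \<bar>y\<bar> + 1/6) / 2)) (UNIV - {0})"
proof (cases "y \<ge> 0")
  case True
  then show ?thesis using has_sum_Bernoulli2[of y] assms by simp
next
  case False
  have "(1 + y)\<^sup>2 - (1 + y) + 1/6 = \<bar>y\<bar>\<^sup>2 - \<bar>y\<bar> + 1/6"
    using False by (simp add: power2_eq_square algebra_simps)
  moreover have "cis (2 * pi * of_int n * (1 + y)) = cis (2 * pi * of_int n * y)" for n
    using cis_add_int[of n 1 y] by simp
  moreover have "((\<lambda>n. cis (2 * pi * of_int n * (1 + y)) / of_real ((2 * pi * of_int n)\<^sup>2)) has_sum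
           of_real (((1 + y)\<^sup>2 - (1 + y) + 1/6) / 2)) (UNIV - {0})"
    using assms False by (intro has_sum_Bernoulli2) auto
  ultimately show ?thesis by (simp only:)
qed

text \<open>The kernel b |x - a| with b = B_2/2 is the periodic Bernoulli function centred at a; its
  slope jumps by - 1 at x = a. Integrating f'' against it by parts twice on either side of a, the
  jump releases f a and the second derivative 1 of b releases the integral of f. The Fourier series
  of the kernel is then integrated termwise, which the decay 1/n^2 permits.\<close>

lemma Euler_Maclaurin_Fourier:
  fixes f f' f'' :: "real \<Rightarrow> complex" and a :: real
  assumes d1: "\<And>x. x \<in> {0..1} \<Longrightarrow> (f has_vector_derivative f' x) (at x within {0..1})"
    and d2: "\<And>x. x \<in> {0..1} \<Longrightarrow> (f' has_vector_derivative f'' x) (at x within {0..1})"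
    and cont: "continuous_on {0..1} f''"
    and a: "0 \<le> a" "a \<le> 1"
  shows "((\<lambda>n. cis (- 2 * pi * of_int n * a) / of_real ((2 * pi * of_int n)\<^sup>2) *
            (f' 1 - f' 0 - integral {0..1} (\<lambda>x. f'' x * cis (2 * pi * of_int n * x))))
          has_sum (f a - integral {0..1} f - of_real (a - 1/2) * (f 1 - f 0))) (UNIV - {0})"
proof -
  define w where "w = (\<lambda>n::int. complex_of_real ((2 * pi * of_int n)\<^sup>2))"
  define b where "b = (\<lambda>y. complex_of_real ((y\<^sup>2 - y + 1/6) / 2))"
  have bsum: "((\<lambda>n. cis (2 * pi * of_int n * y) / w n) has_sum b \<bar>y\<bar>) (UNIV - {0})" if "\<bar>y\<bar> \<le> 1" for y
    unfolding b_def w_def using has_sum_Bernoulli2_abs[OF that] by simp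
  have db: "(b has_vector_derivative of_real (y - 1/2)) (at y within S)" for y S
    unfolding b_def by (rule has_vector_derivative_of_real)
      (auto intro!: derivative_eq_intros)
  have h1: "((\<lambda>n. cis (- 2 * pi * of_int n * a) / w n * (f' 1 - f' 0)) has_sum b a * (f' 1 - f' 0)) (UNIV - {0})"
    using bsum[of "- a"] a by (intro has_sum_cmult_left) (simp add: mult_ac)
  define g where "g = (\<lambda>n x. f'' x * cis (2 * pi * of_int n * x) * (cis (- 2 * pi * of_int n * a) / w n))"
  obtain B where B: "\<And>x. x \<in> {0..1} \<Longrightarrow> norm (f'' x) \<le> B"
    using compact_continuous_image[OF cont compact_Icc] compact_imp_bounded bounded_iff by (metis imageI)
  have gint: "((\<lambda>n. integral {0..1} (g n)) has_sum integral {0..1} (\<lambda>x. f'' x * b \<bar>x - a\<bar>)) (UNIV - {0})"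
  proof (rule has_sum_integral_M_test(2))
    show "continuous_on {0..1} (g n)" for n
      unfolding g_def by (intro continuous_intros cont)
    show "((\<lambda>n. g n x) has_sum f'' x * b \<bar>x - a\<bar>) (UNIV - {0})" if "x \<in> {0..1}" for x
    proof -
      have "((\<lambda>n. f'' x * (cis (2 * pi * of_int n * (x - a)) / w n)) has_sum f'' x * b \<bar>x - a\<bar>) (UNIV - {0})"
        by (intro has_sum_cmult_right bsum) (use that a in auto)
      moreover have "cis (2 * pi * of_int n * (x - a)) = cis (2 * pi * of_int n * x) * cis (- 2 * pi * of_int n * a)" for n
        by (simp add: cis_mult right_diff_distrib)
      ultimately show ?thesis by (simp add: g_def mult_ac)
    qed
    show "norm (g n x) \<le> B / (4 * pi\<^sup>2) * (1 / (real_of_int n)\<^sup>2)" if "x \<in> {0..1}" for n x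
    proof -
      have "norm (g n x) = norm (f'' x) / (2 * pi * of_int n)\<^sup>2"
        unfolding g_def w_def norm_mult norm_divide norm_cis norm_of_real by simp
      also have "\<dots> \<le> B / (2 * pi * of_int n)\<^sup>2"
        using B[OF that] by (intro divide_right_mono) auto
      finally show ?thesis by (simp add: power_mult_distrib)
    qed
    show "(\<lambda>n. B / (4 * pi\<^sup>2) * (1 / (real_of_int n)\<^sup>2)) summable_on (UNIV - {0})"
      by (intro summable_on_cmult_right summable_on_inverse_int_squares)
  qed
  have gi: "integral {0..1} (g n) = cis (- 2 * pi * of_int n * a) / w n * integral {0..1} (\<lambda>x. f'' x * cis (2 * pi * of_int n * x))" for n
    unfolding g_def by (subst integral_mult_left) (simp only: mult.commute)
  have contf: "continuous_on {0..1} f"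
    using d1 by (meson has_vector_derivative_continuous continuous_on_eq_continuous_within)
  have cb: "continuous_on {0..1} (\<lambda>x. f'' x * b \<bar>x - a\<bar>)"
    unfolding b_def by (intro continuous_intros cont) auto
  \<comment> \<open>Antiderivatives of f'' b |x - a| - f on the two sides of a. At x = a they
    combine to - f a, because the slope of the kernel is 1/2 from the left and - 1/2 from the
    right.\<close>
  define Q where "Q = (\<lambda>x. f' x * b (x - a) - f x * of_real (x - a - 1/2))"
  define P where "P = (\<lambda>x. f' x * b (a - x) + f x * of_real (a - x - 1/2))"
  have "((\<lambda>x. f'' x * b \<bar>x - a\<bar> - f x) has_integral (Q 1 - Q a)) {a..1}"
  proof (rule fundamental_theorem_of_calculus)
    show "a \<le> 1" by fact
    fix x assume x: "x \<in> {a..1}"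
    have d1': "(f has_vector_derivative f' x) (at x within {a..1})"
      and d2': "(f' has_vector_derivative f'' x) (at x within {a..1})"
      using d1[of x] d2[of x] x a by (auto intro: has_vector_derivative_within_subset)
    have "((\<lambda>x. b (x - a)) has_vector_derivative 1 *\<^sub>R of_real (x - a - 1/2)) (at x within {a..1})"
      by (rule vector_diff_chain_within[OF _ db, unfolded o_def]) (auto intro!: derivative_eq_intros)
    then have db': "((\<lambda>x. b (x - a)) has_vector_derivative of_real (x - a - 1/2)) (at x within {a..1})" by simp
    have dl: "((\<lambda>x. complex_of_real (x - a - 1/2)) has_vector_derivative of_real 1) (at x within {a..1})"
      by (intro has_vector_derivative_of_real) (auto intro!: derivative_eq_intros)
    show "(Q has_vector_derivative (f'' x * b \<bar>x - a\<bar> - f x)) (at x within {a..1})"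
      unfolding Q_def
      by (rule has_vector_derivative_eq_rhs[OF has_vector_derivative_diff[OF
            has_vector_derivative_mult[OF d2' db'] has_vector_derivative_mult[OF d1' dl]]])
         (use x in \<open>simp add: algebra_simps\<close>)
  qed
  moreover have "((\<lambda>x. f'' x * b \<bar>x - a\<bar> - f x) has_integral (P a - P 0)) {0..a}"
  proof (rule fundamental_theorem_of_calculus)
    show "0 \<le> a" by fact
    fix x assume x: "x \<in> {0..a}"
    have d1': "(f has_vector_derivative f' x) (at x within {0..a})"
      and d2': "(f' has_vector_derivative f'' x) (at x within {0..a})"
      using d1[of x] d2[of x] x a by (auto intro: has_vector_derivative_within_subset)
    have "((\<lambda>x. b (a - x)) has_vector_derivative (- 1) *\<^sub>R of_real (a - x - 1/2)) (at x within {0..a})"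
      by (rule vector_diff_chain_within[OF _ db, unfolded o_def]) (auto intro!: derivative_eq_intros)
    then have db': "((\<lambda>x. b (a - x)) has_vector_derivative - of_real (a - x - 1/2)) (at x within {0..a})" by simp
    have dl: "((\<lambda>x. complex_of_real (a - x - 1/2)) has_vector_derivative of_real (- 1)) (at x within {0..a})"
      by (intro has_vector_derivative_of_real) (auto intro!: derivative_eq_intros)
    show "(P has_vector_derivative (f'' x * b \<bar>x - a\<bar> - f x)) (at x within {0..a})"
      unfolding P_def
      by (rule has_vector_derivative_eq_rhs[OF has_vector_derivative_add[OF
            has_vector_derivative_mult[OF d2' db'] has_vector_derivative_mult[OF d1' dl]]])
         (use x in \<open>simp add: algebra_simps\<close>)
  qed
  ultimately have "((\<lambda>x. f'' x * b \<bar>x - a\<bar> - f x) has_integral ((P a - P 0) + (Q 1 - Q a))) {0..1}"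
    using a by (intro has_integral_combine[of 0 a 1])
  then have int1: "((\<lambda>x. f'' x * b \<bar>x - a\<bar> - f x) has_integral ((P a - P 0) + (Q 1 - Q a))) {0..1}" .
  have int2: "((\<lambda>x. f'' x * b \<bar>x - a\<bar> - f x) has_integral
      (integral {0..1} (\<lambda>x. f'' x * b \<bar>x - a\<bar>) - integral {0..1} f)) {0..1}"
    by (intro has_integral_diff integrable_integral integrable_continuous_real cb contf)
  have I: "integral {0..1} (\<lambda>x. f'' x * b \<bar>x - a\<bar>) =
      (P a - P 0) + (Q 1 - Q a) + integral {0..1} f"
    using has_integral_unique[OF int2 int1] by (simp only: diff_eq_eq)
  \<comment> \<open>Symmetry of B_2: the kernel has the same value at both ends of [0, 1], so f'
    enters through f' 1 - f' 0 alone.\<close>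
  have "b (1 - a) = b a" by (simp add: b_def power2_eq_square algebra_simps)
  then have PQ: "(P a - P 0) + (Q 1 - Q a) = b a * (f' 1 - f' 0) - f a + of_real (a - 1/2) * (f 1 - f 0)"
    unfolding P_def Q_def by (simp add: algebra_simps) (simp add: diff_divide_distrib)
  have "((\<lambda>n. cis (- 2 * pi * of_int n * a) / w n * (f' 1 - f' 0) - integral {0..1} (g n)) has_sum
      (b a * (f' 1 - f' 0) - ((P a - P 0) + (Q 1 - Q a) + integral {0..1} f))) (UNIV - {0})"
    using has_sum_minus_fun[OF h1 gint] unfolding I .
  moreover have "b a * (f' 1 - f' 0) - ((P a - P 0) + (Q 1 - Q a) + integral {0..1} f) =
      f a - integral {0..1} f - of_real (a - 1/2) * (f 1 - f 0)"
    unfolding PQ by simp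
  moreover have "cis (- 2 * pi * of_int n * a) / w n * (f' 1 - f' 0) - integral {0..1} (g n) =
      cis (- 2 * pi * of_int n * a) / of_real ((2 * pi * of_int n)\<^sup>2) *
            (f' 1 - f' 0 - integral {0..1} (\<lambda>x. f'' x * cis (2 * pi * of_int n * x)))" for n
    unfolding gi w_def by (simp only: right_diff_distrib)
  ultimately show ?thesis by (simp only:)
qed

text \<open>The Fourier coefficients of exp(s x) on [0, 1] are multiples of 1/(s + 2 pi i n), so the
  previous formula for this function at a = 0, divided by exp s - 1, is the partial fraction
  expansion. The terms 1/(2 pi i n), which would cancel in pairs, are kept for the sake of absolute
  convergence.\<close>

lemma exp_partial_fractions:
  fixes s :: complex
  assumes s: "exp s \<noteq> 1"
  shows "((\<lambda>n. 1 / (s + 2 * pi * \<i> * of_int n) - 1 / (2 * pi * \<i> * of_int n)) has_sum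
           (1 / (exp s - 1) - 1 / s + 1 / 2)) (UNIV - {0})"
proof -
  have s0: "s \<noteq> 0" using s by auto
  have ns: "s + 2 * pi * \<i> * of_int n \<noteq> 0" for n :: int
  proof
    assume "s + 2 * pi * \<i> * of_int n = 0"
    then have "s = 2 * of_int (- n) * pi * \<i>" by (simp add: add_eq_0_iff mult_ac)
    then have "exp s = 1" by (simp only: exp_2pi_1_int mult_ac) (use exp_2pi_1_int[of "- n"] in \<open>simp add: mult_ac\<close>)
    with s show False by simp
  qed
  define f where "f = (\<lambda>x::real. exp (s * of_real x))"
  have d: "((\<lambda>x. c * exp (u * of_real x)) has_vector_derivative c * (u * exp (u * of_real x))) (at x within S)" for c u :: complex and x S
    by (rule has_vector_derivative_real_field) (auto intro!: derivative_eq_intros)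
  have int: "integral {0..1} (\<lambda>x. s\<^sup>2 * exp (s * of_real x) * cis (2 * pi * of_int n * x)) =
      s\<^sup>2 * (exp s - 1) / (s + 2 * pi * \<i> * of_int n)" for n :: int
  proof -
    define u where "u = s + 2 * pi * \<i> * of_int n"
    have u: "u \<noteq> 0" using ns by (simp add: u_def)
    have "((\<lambda>x. s\<^sup>2 / u * (u * exp (u * of_real x))) has_integral (s\<^sup>2 / u * exp (u * of_real 1) - s\<^sup>2 / u * exp (u * of_real 0))) {0..1}"
      by (intro fundamental_theorem_of_calculus d) auto
    moreover have "s\<^sup>2 / u * (u * exp (u * of_real x)) = s\<^sup>2 * exp (s * of_real x) * cis (2 * pi * of_int n * x)" for x
    proof -
      have "exp (u * of_real x) = exp (s * of_real x) * cis (2 * pi * of_int n * x)"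
        unfolding cis_conv_exp exp_add[symmetric] u_def by (simp add: algebra_simps)
      then show ?thesis using u by simp
    qed
    moreover have "exp (u * of_real 1) = exp s"
      using exp_2pi_1_int[of n] by (simp add: u_def exp_add mult_ac)
    ultimately show ?thesis
      by (intro integral_unique) (simp add: u_def diff_divide_distrib right_diff_distrib)
  qed
  have f0: "integral {0..1} f = (exp s - 1) / s"
  proof -
    have "((\<lambda>x. (1 / s) * (s * exp (s * of_real x))) has_integral ((1 / s) * exp (s * of_real 1) - (1 / s) * exp (s * of_real 0))) {0..1}"
      by (intro fundamental_theorem_of_calculus d) auto
    then show ?thesis using s0 by (intro integral_unique) (simp add: f_def diff_divide_distrib)
  qed
  have "((\<lambda>n. cis (- 2 * pi * of_int n * 0) / of_real ((2 * pi * of_int n)\<^sup>2) *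
            (s * f 1 - s * f 0 - integral {0..1} (\<lambda>x. (s\<^sup>2 * f x) * cis (2 * pi * of_int n * x))))
          has_sum (f 0 - integral {0..1} f - of_real (0 - 1/2) * (f 1 - f 0))) (UNIV - {0})"
  proof (rule Euler_Maclaurin_Fourier)
    show "(f has_vector_derivative s * f x) (at x within {0..1})" for x
      using d[of 1 s] by (simp add: f_def)
    show "((\<lambda>x. s * f x) has_vector_derivative s\<^sup>2 * f x) (at x within {0..1})" for x
      using d[of s s] by (simp add: f_def power2_eq_square mult_ac)
    show "continuous_on {0..1} (\<lambda>x. s\<^sup>2 * f x)"
      unfolding f_def by (intro continuous_intros)
  qed auto
  from has_sum_cmult_right[OF this, of "1 / (exp s - 1)"]
  have "((\<lambda>n. 1 / (exp s - 1) * (1 / of_real ((2 * pi * of_int n)\<^sup>2) *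
            (s * exp s - s - s\<^sup>2 * (exp s - 1) / (s + 2 * pi * \<i> * of_int n))))
          has_sum 1 / (exp s - 1) * (1 - (exp s - 1) / s + (1/2) * (exp s - 1))) (UNIV - {0})"
    unfolding f0 by (simp add: f_def int)
  also have "1 / (exp s - 1) * (1 - (exp s - 1) / s + (1/2) * (exp s - 1)) = 1 / (exp s - 1) - 1 / s + 1 / 2"
    using s s0 by (simp add: field_simps)
  also have "((\<lambda>n. 1 / (exp s - 1) * (1 / of_real ((2 * pi * of_int n)\<^sup>2) *
            (s * exp s - s - s\<^sup>2 * (exp s - 1) / (s + 2 * pi * \<i> * of_int n))))
          has_sum (1 / (exp s - 1) - 1 / s + 1 / 2)) (UNIV - {0}) \<longleftrightarrow> ?thesis"
  proof (rule has_sum_cong)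
    fix n :: int assume n: "n \<in> UNIV - {0}"
    define t where "t = 2 * pi * \<i> * of_int n"
    have t: "t \<noteq> 0" "s + t \<noteq> 0" using n ns[of n] by (auto simp: t_def)
    have t2: "complex_of_real ((2 * pi * of_int n)\<^sup>2) = - (t * t)"
      by (simp add: t_def power2_eq_square)
    have "1 / (exp s - 1) * (1 / - (t * t) * (s * exp s - s - s\<^sup>2 * (exp s - 1) / (s + t))) = 
       1 / - (t * t) * (s - s\<^sup>2 / (s + t))"
    proof -
      have "s * exp s - s - s\<^sup>2 * (exp s - 1) / (s + t) = (exp s - 1) * (s - s\<^sup>2 / (s + t))"
        by (simp add: algebra_simps diff_divide_distrib)
      then show ?thesis using s by simp
    qed
    also have "\<dots> = 1 / (s + t) - 1 / t"
      using t by (simp add: divide_simps) (simp add: algebra_simps power2_eq_square)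
    finally show "1 / (exp s - 1) * (1 / of_real ((2 * pi * of_int n)\<^sup>2) *
            (s * exp s - s - s\<^sup>2 * (exp s - 1) / (s + 2 * pi * \<i> * of_int n))) = 1 / (s + 2 * pi * \<i> * of_int n) - 1 / (2 * pi * \<i> * of_int n)"
      by (simp only: t2 t_def[symmetric])
  qed
  finally show ?thesis .
qed

section \<open>Series of reciprocals\<close>

abbreviation nonzero_ints :: "int set" where "nonzero_ints \<equiv> UNIV - {0}"

lemma has_sum_finite_sum:
  fixes f :: "'j \<Rightarrow> 'i \<Rightarrow> 'a :: topological_comm_monoid_add"
  assumes "finite J" "\<And>j. j \<in> J \<Longrightarrow> (f j has_sum g j) A"
  shows "((\<lambda>i. \<Sum>j\<in>J. f j i) has_sum (\<Sum>j\<in>J. g j)) A"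
  using assms by (induction J rule: finite_induct) (auto intro!: has_sum_add)

lemma summable_on_product_inverse_squares:
  assumes "I \<subseteq> nonzero_ints" "J \<subseteq> nonzero_ints"
  shows "(\<lambda>(m, n). C * (1 / (real_of_int m)\<^sup>2 * (1 / (real_of_int n)\<^sup>2))) summable_on (I \<times> J)"
proof -
  obtain S where S: "((\<lambda>n. 1 / (real_of_int n)\<^sup>2) has_sum S) J"
    using summable_on_subset[OF summable_on_inverse_int_squares assms(2)] summable_on_def by blast
  have "(\<lambda>(m, n). 1 / (real_of_int m)\<^sup>2 * (1 / (real_of_int n)\<^sup>2)) summable_on (I \<times> J)"
  proof (rule summable_on_SigmaI)
    show "((\<lambda>y. case (x, y) of (m, n) \<Rightarrow> 1 / (real_of_int m)\<^sup>2 * (1 / (real_of_int n)\<^sup>2)) has_sum 1 / (real_of_int x)\<^sup>2 * S) J" for x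
      unfolding prod.case by (intro has_sum_cmult_right S)
    show "(\<lambda>x. 1 / (real_of_int x)\<^sup>2 * S) summable_on I"
      by (intro summable_on_cmult_left summable_on_subset[OF summable_on_inverse_int_squares assms(1)])
  qed auto
  then have "(\<lambda>p. C * (case p of (m, n) \<Rightarrow> 1 / (real_of_int m)\<^sup>2 * (1 / (real_of_int n)\<^sup>2))) summable_on (I \<times> J)"
    by (rule summable_on_cmult_right)
  then show ?thesis by (simp only: prod.case_distrib)
qed

lemma shift_denominator_nonzero:
  assumes "Im s \<noteq> 0"
  shows "complex_of_real x + s \<noteq> 0"
  using assms by (auto simp: complex_eq_iff)

lemma has_vector_derivative_power_shift:
  fixes s :: complex
  assumes "Im s \<noteq> 0"
  shows "((\<lambda>x. 1 / (of_real x + s)) has_vector_derivative - 1 / (of_real x + s)\<^sup>2) (at x within S)"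
    and "((\<lambda>x. - 1 / (of_real x + s)\<^sup>2) has_vector_derivative 2 / (of_real x + s) ^ 3) (at x within S)"
proof -
  have nz: "complex_of_real x + s \<noteq> 0" by (rule shift_denominator_nonzero[OF assms])
  show "((\<lambda>x. 1 / (of_real x + s)) has_vector_derivative - 1 / (of_real x + s)\<^sup>2) (at x within S)"
    by (rule has_vector_derivative_real_field)
       (use nz in \<open>auto intro!: derivative_eq_intros simp: power2_eq_square\<close>)
  have "((\<lambda>x. - (1 / (of_real x + s) * (1 / (of_real x + s)))) has_vector_derivative
      - (1 / (of_real x + s) * (- 1 / (of_real x + s)\<^sup>2) + (- 1 / (of_real x + s)\<^sup>2) * (1 / (of_real x + s)))) (at x within S)"
    by (intro has_vector_derivative_minus has_vector_derivative_mult) fact+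
  then show "((\<lambda>x. - 1 / (of_real x + s)\<^sup>2) has_vector_derivative 2 / (of_real x + s) ^ 3) (at x within S)"
    by (simp add: power2_eq_square power3_eq_cube mult.assoc)
qed

text \<open>The formula is additive over unit intervals: boundary terms telescope, and as the
  frequencies are integers, translation by N leaves the exponentials unchanged. This gives an
  induction on N. The hypothesis on \<open>Im s\<close> keeps the pole - s off the real
  line.\<close>

lemma Euler_Maclaurin_Fourier_reciprocal:
  fixes s :: complex and a :: real and N :: nat
  assumes s: "Im s \<noteq> 0" and a: "0 \<le> a" "a \<le> 1"
  shows "((\<lambda>n. cis (- 2 * pi * of_int n * a) / of_real ((2 * pi * of_int n)\<^sup>2) *
            (1 / s\<^sup>2 - 1 / (of_nat N + s)\<^sup>2 - integral {0..real N} (\<lambda>x. 2 / (of_real x + s) ^ 3 * cis (2 * pi * of_int n * x))))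
          has_sum ((\<Sum>j<N. 1 / (of_real (a + real j) + s)) - integral {0..real N} (\<lambda>x. 1 / (of_real x + s))
            - of_real (a - 1/2) * (1 / (of_nat N + s) - 1 / s))) nonzero_ints"
proof (induction N)
  case (Suc N)
  have nz: "complex_of_real x + s \<noteq> 0" for x by (rule shift_denominator_nonzero[OF s])
  define t where "t = of_nat N + s"
  have t: "Im t \<noteq> 0" using s by (simp add: t_def)
  have nzt: "complex_of_real x + t \<noteq> 0" for x by (rule shift_denominator_nonzero[OF t])
  have c1: "continuous_on S (\<lambda>x. 1 / (of_real x + s))"
    and c3: "continuous_on S (\<lambda>x. 2 / (of_real x + s) ^ 3 * cis (2 * pi * of_int n * x))" for S and n :: int
    by (intro continuous_intros; simp add: nz)+
  define e where "e = (\<lambda>n. cis (- 2 * pi * of_int n * a) / of_real ((2 * pi * of_int n)\<^sup>2))"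
  have "((\<lambda>n. e n * (- 1 / (of_real 1 + t)\<^sup>2 - - 1 / (of_real 0 + t)\<^sup>2
              - integral {0..1} (\<lambda>x. 2 / (of_real x + t) ^ 3 * cis (2 * pi * of_int n * x))))
         has_sum (1 / (of_real a + t) - integral {0..1} (\<lambda>x. 1 / (of_real x + t))
            - of_real (a - 1/2) * (1 / (of_real 1 + t) - 1 / (of_real 0 + t)))) nonzero_ints"
    unfolding e_def
    by (rule Euler_Maclaurin_Fourier has_vector_derivative_power_shift t)+
       (intro continuous_intros, simp_all add: nzt a)
  also have "integral {0..1} (\<lambda>x. 1 / (of_real x + t)) = integral {real N..real (Suc N)} (\<lambda>x. 1 / (of_real x + s))"
    using integral_shift_real_ivl[of "real N" "real N" "real (Suc N)" "\<lambda>x. 1 / (of_real x + s)"]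
    by (simp add: t_def add.assoc)
  also have "(\<lambda>n. integral {0..1} (\<lambda>x. 2 / (of_real x + t) ^ 3 * cis (2 * pi * of_int n * x))) =
      (\<lambda>n. integral {real N..real (Suc N)} (\<lambda>x. 2 / (of_real x + s) ^ 3 * cis (2 * pi * of_int n * x)))"
  proof
    fix n :: int
    have "integral {real N - real N..real (Suc N) - real N} (\<lambda>x. 2 / (of_real (x + real N) + s) ^ 3 * cis (2 * pi * of_int n * (x + real N))) =
        integral {real N..real (Suc N)} (\<lambda>x. 2 / (of_real x + s) ^ 3 * cis (2 * pi * of_int n * x))"
      by (rule integral_shift_real_ivl)
    moreover have "cis (2 * pi * of_int n * (x + real N)) = cis (2 * pi * of_int n * x)" for x
      using cis_add_int[of n "int N" x] by (simp only: of_int_of_nat_eq add.commute)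
    ultimately show "integral {0..1} (\<lambda>x. 2 / (of_real x + t) ^ 3 * cis (2 * pi * of_int n * x)) =
        integral {real N..real (Suc N)} (\<lambda>x. 2 / (of_real x + s) ^ 3 * cis (2 * pi * of_int n * x))"
      by (simp add: t_def add.assoc)
  qed
  finally have step: "((\<lambda>n. e n * (- 1 / (of_real 1 + t)\<^sup>2 - - 1 / (of_real 0 + t)\<^sup>2
              - integral {real N..real (Suc N)} (\<lambda>x. 2 / (of_real x + s) ^ 3 * cis (2 * pi * of_int n * x))))
         has_sum (1 / (of_real a + t) - integral {real N..real (Suc N)} (\<lambda>x. 1 / (of_real x + s))
            - of_real (a - 1/2) * (1 / (of_real 1 + t) - 1 / (of_real 0 + t)))) nonzero_ints"
    by (simp only: fun_eq_iff)
  have comb: "integral {0..real (Suc N)} f = integral {0..real N} f + integral {real N..real (Suc N)} f"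
    if "\<And>S. continuous_on S f" for f :: "real \<Rightarrow> complex"
    using that by (intro Henstock_Kurzweil_Integration.integral_combine[symmetric] integrable_continuous_real) auto
  have T: "of_nat (Suc N) + s = of_real 1 + t" "of_real (a + real N) + s = of_real a + t" "of_nat N + s = of_real 0 + t"
    by (simp_all add: t_def)
  have lhs: "e n * (1 / s\<^sup>2 - 1 / (of_nat N + s)\<^sup>2 - i1) + e n * (- 1 / (of_real 1 + t)\<^sup>2 - - 1 / (of_real 0 + t)\<^sup>2 - i2) =
      e n * (1 / s\<^sup>2 - 1 / (of_nat (Suc N) + s)\<^sup>2 - (i1 + i2))" for n i1 i2
    unfolding T by (simp add: algebra_simps)
  have rhs: "(\<Sum>j<N. 1 / (of_real (a + real j) + s)) - i1 - of_real (a - 1/2) * (1 / (of_nat N + s) - 1 / s) +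
      (1 / (of_real a + t) - i2 - of_real (a - 1/2) * (1 / (of_real 1 + t) - 1 / (of_real 0 + t))) =
      (\<Sum>j<Suc N. 1 / (of_real (a + real j) + s)) - (i1 + i2) - of_real (a - 1/2) * (1 / (of_nat (Suc N) + s) - 1 / s)" for i1 i2
    unfolding sum.lessThan_Suc T by (simp add: algebra_simps)
  from has_sum_add[OF Suc.IH step[unfolded e_def]] show ?case
    unfolding comb[OF c1] comb[OF c3] lhs[unfolded e_def] rhs .
qed simp

section \<open>Bounds and limits for Fourier integrals with a nonreal shift\<close>

lemma norm_shift_ge: "\<bar>Im s\<bar> \<le> norm (complex_of_real x + s)"
  using abs_Im_le_cmod[of "complex_of_real x + s"] by simp

lemma inverse_square_norm_shift:
  "1 / (norm (complex_of_real x + s))\<^sup>2 = 1 / ((x + Re s)\<^sup>2 + (Im s)\<^sup>2)"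
  by (simp add: cmod_power2)

lemma arctan_antiderivative:
  assumes "c \<noteq> (0::real)"
  shows "((\<lambda>x. arctan ((x + b) / c) / c) has_real_derivative 1 / ((x + b)\<^sup>2 + c\<^sup>2)) (at x within S)"
proof -
  have "c\<^sup>2 + (x + b)\<^sup>2 > 0" using assms by (simp add: pos_add_strict add_pos_nonneg)
  then show ?thesis using assms
    by (auto intro!: derivative_eq_intros simp: divide_simps power2_eq_square)
qed

text \<open>The arctangent has total variation pi, whence a bound independent of both b and Re
  s.\<close>

lemma integral_inverse_square_norm_le:
  assumes s: "Im s \<noteq> 0" and "(0::real) \<le> b"
  shows "integral {0..b} (\<lambda>x. 1 / (norm (complex_of_real x + s))\<^sup>2) \<le> pi / \<bar>Im s\<bar>"
proof -
  define c where "c = \<bar>Im s\<bar>"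
  have c: "c > 0" using s by (simp add: c_def)
  have "((\<lambda>x. 1 / ((x + Re s)\<^sup>2 + c\<^sup>2)) has_integral (arctan ((b + Re s) / c) / c - arctan ((0 + Re s) / c) / c)) {0..b}"
    using assms(2) c by (intro fundamental_theorem_of_calculus)
      (auto simp: has_real_derivative_iff_has_vector_derivative[symmetric] intro!: arctan_antiderivative)
  then have "integral {0..b} (\<lambda>x. 1 / (norm (complex_of_real x + s))\<^sup>2) = (arctan ((b + Re s) / c) - arctan ((0 + Re s) / c)) / c"
    unfolding inverse_square_norm_shift c_def by (simp add: integral_unique diff_divide_distrib)
  also have "\<dots> \<le> pi / c"
    using arctan_bounded[of "(b + Re s) / c"] arctan_bounded[of "(0 + Re s) / c"] c
    by (intro divide_right_mono) auto
  finally show ?thesis by (simp add: c_def)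
qed

lemma set_integrable_inverse_square_norm:
  assumes s: "Im s \<noteq> 0"
  shows "set_integrable lborel {0..} (\<lambda>x. 1 / (norm (complex_of_real x + s))\<^sup>2)"
proof -
  define c where "c = \<bar>Im s\<bar>"
  have c: "c > 0" using s by (simp add: c_def)
  have "filterlim (\<lambda>x. (x + Re s) / c) at_top at_top" using c by real_asymp
  then have lim: "((\<lambda>x. arctan ((x + Re s) / c) / c) \<longlongrightarrow> (pi / 2) / c) at_top"
    by (intro tendsto_divide tendsto_const filterlim_compose[OF tendsto_arctan_at_top]) (use c in auto)
  have m: "(\<lambda>x. 1 / ((x + Re s)\<^sup>2 + c\<^sup>2)) \<in> borel_measurable borel" by measurable
  have fin: "(\<integral>\<^sup>+x. ennreal (1 / ((x + Re s)\<^sup>2 + c\<^sup>2)) * indicator {0 ..} x \<partial>lborel) = (pi / 2) / c - arctan ((0 + Re s) / c) / c"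
    by (rule nn_integral_FTC_atLeast[OF m _ _ lim]) (use c in \<open>auto intro!: arctan_antiderivative\<close>)
  then have "(\<integral>\<^sup>+x. ennreal (indicator {0 ..} x * (1 / ((x + Re s)\<^sup>2 + c\<^sup>2))) \<partial>lborel) < \<infinity>"
  proof -
    have "ennreal (indicator {0 ..} x * (1 / ((x + Re s)\<^sup>2 + c\<^sup>2))) = ennreal (1 / ((x + Re s)\<^sup>2 + c\<^sup>2)) * indicator {0 ..} x" for x :: real
      by (auto split: split_indicator)
    then show ?thesis using fin by simp
  qed
  then show ?thesis
    unfolding set_integrable_def inverse_square_norm_shift c_def
    by (intro integrableI_nonneg) (auto intro!: AE_I2)
qed

text \<open>A half-line Fourier transform, absolutely convergent for every real p as long as Im s is
  nonzero. The summands of \<open>f_series\<close> and the principal values of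
  \<open>I_series\<close> will be expressed by it jointly.\<close>

definition fourier_inverse_square :: "real \<Rightarrow> complex \<Rightarrow> complex" where
  "fourier_inverse_square p s = (LINT x:{0..}|lborel. cis (2 * pi * p * x) / (of_real x + s)\<^sup>2)"

lemma set_integrable_fourier_inverse_square:
  assumes s: "Im s \<noteq> 0" and "S \<subseteq> {0..}" "S \<in> sets borel"
  shows "set_integrable lborel S (\<lambda>x. cis (2 * pi * p * x) / (of_real x + s)\<^sup>2)"
proof -
  have "set_integrable lborel {0..} (\<lambda>x. cis (2 * pi * p * x) / (of_real x + s)\<^sup>2)"
    unfolding set_integrable_def
  proof (rule Bochner_Integration.integrable_bound)
    show "integrable lborel (\<lambda>x. indicator {0..} x *\<^sub>R (1 / (norm (complex_of_real x + s))\<^sup>2))"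
      using set_integrable_inverse_square_norm[OF s] unfolding set_integrable_def .
    have "continuous_on UNIV (\<lambda>x. cis (2 * pi * p * x) / (of_real x + s)\<^sup>2)"
      by (intro continuous_intros) (simp add: shift_denominator_nonzero[OF s])
    then have "(\<lambda>x. cis (2 * pi * p * x) / (of_real x + s)\<^sup>2) \<in> borel_measurable borel"
      by (rule borel_measurable_continuous_onI)
    then show "(\<lambda>x. indicator {0..} x *\<^sub>R (cis (2 * pi * p * x) / (of_real x + s)\<^sup>2)) \<in> borel_measurable lborel"
      by measurable
  qed (auto simp: norm_divide norm_power)
  then show ?thesis by (rule set_integrable_subset) (use assms in auto)
qed

lemma has_vector_derivative_cis:
  "((\<lambda>x. cis (c * x)) has_vector_derivative \<i> * of_real c * cis (c * x)) (at x within S)"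
  unfolding cis_conv_exp of_real_mult
  by (rule has_vector_derivative_real_field) (auto intro!: derivative_eq_intros)

text \<open>The factor belonging to frequency n in
  \<open>Euler_Maclaurin_Fourier_reciprocal\<close>. This form, with the cube, admits a bound
  uniform in n; the form in \<open>fourier_coeff_by_parts\<close> has a visible limit as N
  grows.\<close>

definition fourier_coeff :: "complex \<Rightarrow> nat \<Rightarrow> int \<Rightarrow> complex" where
  "fourier_coeff s N n = 1 / s\<^sup>2 - 1 / (of_nat N + s)\<^sup>2
     - integral {0..real N} (\<lambda>x. 2 / (of_real x + s) ^ 3 * cis (2 * pi * of_int n * x))"

text \<open>Integration by parts undoes one differentiation of the reciprocal. The boundary terms
  are exactly 1/s^2 - 1/(N + s)^2, because e^{2 pi i n x} is 1 at both integer endpoints.\<close>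

lemma fourier_coeff_by_parts:
  assumes s: "Im s \<noteq> 0"
  shows "fourier_coeff s N n =
     - 2 * pi * \<i> * of_int n * (LINT x:{0..real N}|lborel. cis (2 * pi * of_int n * x) / (of_real x + s)\<^sup>2)"
proof -
  have nz: "complex_of_real x + s \<noteq> 0" for x by (rule shift_denominator_nonzero[OF s])
  define e where "e = (\<lambda>x. cis (2 * pi * of_int n * x))"
  have eN: "e (real N) = 1" "e 0 = 1"
    using cis_multiple_2pi[of "of_int (n * int N)"] by (simp_all add: e_def mult_ac)
  have "((\<lambda>x. - 1 / (of_real x + s)\<^sup>2 * (\<i> * of_real (2 * pi * of_int n) * e x) + 2 / (of_real x + s) ^ 3 * e x) has_integral
      (- 1 / (of_real (real N) + s)\<^sup>2 * e (real N) - - 1 / (of_real 0 + s)\<^sup>2 * e 0)) {0..real N}"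
    unfolding e_def
    by (intro fundamental_theorem_of_calculus has_vector_derivative_mult
          has_vector_derivative_power_shift(2) has_vector_derivative_cis s) auto
  then have "1 / s\<^sup>2 - 1 / (of_nat N + s)\<^sup>2 =
      integral {0..real N} (\<lambda>x. - 1 / (of_real x + s)\<^sup>2 * (\<i> * of_real (2 * pi * of_int n) * e x) + 2 / (of_real x + s) ^ 3 * e x)"
    by (simp add: eN integral_unique)
  also have "\<dots> = integral {0..real N} (\<lambda>x. - 1 / (of_real x + s)\<^sup>2 * (\<i> * of_real (2 * pi * of_int n) * e x)) +
      integral {0..real N} (\<lambda>x. 2 / (of_real x + s) ^ 3 * e x)"
    unfolding e_def
    by (intro Henstock_Kurzweil_Integration.integral_add integrable_continuous_real continuous_intros) (simp_all add: nz)
  also have "integral {0..real N} (\<lambda>x. - 1 / (of_real x + s)\<^sup>2 * (\<i> * of_real (2 * pi * of_int n) * e x)) =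
      integral {0..real N} (\<lambda>x. (- 2 * pi * \<i> * of_int n) * (e x / (of_real x + s)\<^sup>2))"
    by (intro Henstock_Kurzweil_Integration.integral_cong) (simp add: mult_ac)
  also have "\<dots> = - 2 * pi * \<i> * of_int n * integral {0..real N} (\<lambda>x. e x / (of_real x + s)\<^sup>2)"
    by (rule integral_mult_right)
  also have "integral {0..real N} (\<lambda>x. e x / (of_real x + s)\<^sup>2) = (LINT x:{0..real N}|lborel. e x / (of_real x + s)\<^sup>2)"
    unfolding e_def
    by (rule set_borel_integral_eq_integral(2)[OF set_integrable_fourier_inverse_square[OF s], symmetric]) auto
  finally show ?thesis unfolding fourier_coeff_def e_def by (simp only: diff_eq_eq)
qed

lemma fourier_coeff_tendsto:
  assumes s: "Im s \<noteq> 0"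
  shows "(\<lambda>N. fourier_coeff s N n) \<longlonglongrightarrow> - 2 * pi * \<i> * of_int n * fourier_inverse_square (of_int n) s"
proof -
  have "((\<lambda>b. LINT x:{0..b}|lborel. cis (2 * pi * of_int n * x) / (of_real x + s)\<^sup>2) \<longlongrightarrow> fourier_inverse_square (of_int n) s) at_top"
    unfolding fourier_inverse_square_def
    by (intro tendsto_set_lebesgue_integral_at_top set_integrable_fourier_inverse_square s) auto
  from filterlim_compose[OF this filterlim_real_sequentially]
  show ?thesis unfolding fourier_coeff_by_parts[OF s] by (intro tendsto_mult tendsto_const)
qed

text \<open>Uniform in N and n and of order 1/(Im s)^2, hence 1/m^2 for the poles at hand.
  Estimating the form by parts instead would cost a factor n and a power of Im s.\<close>

lemma norm_fourier_coeff_le: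
  assumes s: "Im s \<noteq> 0"
  shows "norm (fourier_coeff s N n) \<le> (2 + 2 * pi) / (Im s)\<^sup>2"
proof -
  define c where "c = \<bar>Im s\<bar>"
  have c: "c > 0" using s by (simp add: c_def)
  have nz: "complex_of_real x + s \<noteq> 0" for x by (rule shift_denominator_nonzero[OF s])
  have ge: "c \<le> norm (complex_of_real x + s)" for x unfolding c_def by (rule norm_shift_ge)
  have sq: "norm (1 / (complex_of_real x + s)\<^sup>2) \<le> 1 / c\<^sup>2" for x
    using ge[of x] c by (simp add: norm_divide norm_power frac_le power_mono)
  have "norm (integral {0..real N} (\<lambda>x. 2 / (of_real x + s) ^ 3 * cis (2 * pi * of_int n * x))) \<le>
      integral {0..real N} (\<lambda>x. 2 / c * (1 / (norm (complex_of_real x + s))\<^sup>2))"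
  proof (rule integral_norm_bound_integral)
    show "(\<lambda>x. 2 / (of_real x + s) ^ 3 * cis (2 * pi * of_int n * x)) integrable_on {0..real N}"
      by (intro integrable_continuous_real continuous_intros) (simp add: nz)
    show "(\<lambda>x. 2 / c * (1 / (norm (complex_of_real x + s))\<^sup>2)) integrable_on {0..real N}"
      using c by (intro integrable_continuous_real continuous_intros) (auto simp: nz)
    fix x
    have "norm (2 / (of_real x + s) ^ 3 * cis (2 * pi * of_int n * x)) =
        2 / norm (complex_of_real x + s) * (1 / (norm (complex_of_real x + s))\<^sup>2)"
      by (simp add: norm_mult norm_divide norm_power power2_eq_square power3_eq_cube)
    also have "\<dots> \<le> 2 / c * (1 / (norm (complex_of_real x + s))\<^sup>2)"
      using c ge[of x] by (intro mult_right_mono frac_le) auto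
    finally show "norm (2 / (of_real x + s) ^ 3 * cis (2 * pi * of_int n * x)) \<le> 2 / c * (1 / (norm (complex_of_real x + s))\<^sup>2)" .
  qed
  also have "\<dots> = 2 / c * integral {0..real N} (\<lambda>x. 1 / (norm (complex_of_real x + s))\<^sup>2)"
    by (rule integral_mult_right)
  also have "\<dots> \<le> 2 / c * (pi / c)"
    using c integral_inverse_square_norm_le[OF s, of "real N"] by (intro mult_left_mono) (auto simp: c_def)
  finally have i3: "norm (integral {0..real N} (\<lambda>x. 2 / (of_real x + s) ^ 3 * cis (2 * pi * of_int n * x))) \<le> 2 * pi / c\<^sup>2"
    by (simp add: power2_eq_square)
  have "norm (fourier_coeff s N n) \<le> norm (1 / s\<^sup>2) + norm (1 / (of_nat N + s)\<^sup>2) + 2 * pi / c\<^sup>2"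
    unfolding fourier_coeff_def by (intro norm_triangle_le_diff add_mono i3 order_refl)
  also have "\<dots> \<le> 1 / c\<^sup>2 + 1 / c\<^sup>2 + 2 * pi / c\<^sup>2"
    using sq[of 0] sq[of "real N"] by (intro add_mono) auto
  also have "\<dots> = (2 + 2 * pi) / (Im s)\<^sup>2"
    by (simp add: c_def add_divide_distrib)
  finally show ?thesis .
qed

text \<open>\<open>U\<close> is the sum over the poles. Each summand 1/(x + s m) - 1/s m is O(1/m^2)
  for fixed x and vanishes at x = 0; the constants 1/s m cancel between sum and integral, and U 0 =
  0 leaves no boundary term at 0. The double series is summed over n first, and its terms have a
  majorant C/(m^2 n^2) independent of N, whence the limit.\<close>

lemma reciprocal_series_limit:
  fixes W :: complex and k :: nat and I :: "int set" and U :: "real \<Rightarrow> complex" and a :: real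
  defines "s \<equiv> \<lambda>m::int. - \<i> * of_real (of_int m / of_nat k) * W"
  assumes W: "Re W > 0" and k: "k > 0" and I: "I \<subseteq> nonzero_ints" and a: "0 \<le> a" "a \<le> 1"
    and U: "\<And>x. x \<ge> 0 \<Longrightarrow> ((\<lambda>m. 1 / (of_real x + s m) - 1 / s m) has_sum U x) I"
  defines "term \<equiv> \<lambda>(m, n). cis (- 2 * pi * of_int n * a) / of_real ((2 * pi * of_int n)\<^sup>2) *
            (- 2 * pi * \<i> * of_int n * fourier_inverse_square (of_int n) (s m))"
  shows "(\<lambda>p. norm (term p)) summable_on (I \<times> nonzero_ints)"
    and "(\<lambda>N. (\<Sum>j<N. U (a + real j)) - integral {0..real N} U - of_real (a - 1/2) * U (real N))
           \<longlonglongrightarrow> (\<Sum>\<^sub>\<infinity>p\<in>I \<times> nonzero_ints. term p)"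
proof -
  have Ims: "Im (s m) = - (of_int m / real k * Re W)" for m by (simp add: s_def)
  have Ims0: "Im (s m) \<noteq> 0" if "m \<in> I" for m using that I W k by (auto simp: Ims)
  have s0: "s m \<noteq> 0" if "m \<in> I" for m using Ims0[OF that] by auto
  define C where "C = (real k / Re W)\<^sup>2"
  have C: "1 / (Im (s m))\<^sup>2 = C * (1 / (of_int m)\<^sup>2)" for m
    by (simp add: Ims C_def power_mult_distrib power_divide)
  define D where "D = (\<lambda>(m, n) N. cis (- 2 * pi * of_int n * a) / of_real ((2 * pi * of_int n)\<^sup>2) * fourier_coeff (s m) N n)"
  define M where "M = (\<lambda>(m, n). (2 + 2 * pi) * C / (4 * pi\<^sup>2) * (1 / (real_of_int m)\<^sup>2 * (1 / (real_of_int n)\<^sup>2)))"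
  have Msum: "M summable_on (I \<times> nonzero_ints)"
    unfolding M_def by (rule summable_on_product_inverse_squares[OF I]) auto
  have bound: "norm (D p N) \<le> M p" if "p \<in> I \<times> nonzero_ints" for p N
  proof -
    obtain m n where p: "p = (m, n)" "m \<in> I" using \<open>p \<in> I \<times> nonzero_ints\<close> by auto
    have "norm (D p N) = 1 / (2 * pi * of_int n)\<^sup>2 * norm (fourier_coeff (s m) N n)"
      unfolding p D_def prod.case norm_mult norm_divide norm_cis norm_of_real by simp
    also have "\<dots> \<le> 1 / (2 * pi * of_int n)\<^sup>2 * ((2 + 2 * pi) / (Im (s m))\<^sup>2)"
      by (intro mult_left_mono norm_fourier_coeff_le Ims0 p) auto
    also have "(2 + 2 * pi) / (Im (s m))\<^sup>2 = (2 + 2 * pi) * (C * (1 / (of_int m)\<^sup>2))"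
      unfolding C[symmetric] by simp
    also have "1 / (2 * pi * of_int n)\<^sup>2 * \<dots> = M p"
      by (simp add: p M_def power_mult_distrib)
    finally show ?thesis .
  qed
  have lim: "(\<lambda>N. D p N) \<longlonglongrightarrow> term p" if "p \<in> I \<times> nonzero_ints" for p
  proof -
    obtain m n where p: "p = (m, n)" "m \<in> I" using \<open>p \<in> I \<times> nonzero_ints\<close> by auto
    show ?thesis
      unfolding D_def term_def p prod.case by (intro tendsto_mult tendsto_const fourier_coeff_tendsto Ims0 p)
  qed
  note dom = has_sum_tendsto_dominated[OF lim bound Msum]
  show "(\<lambda>p. norm (term p)) summable_on (I \<times> nonzero_ints)" by (rule dom(2))
  define \<phi> where "\<phi> = (\<lambda>m x. 1 / (complex_of_real x + s m) - 1 / s m)"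
  have "(\<Sum>\<^sub>\<infinity>p\<in>I \<times> nonzero_ints. D p N) = (\<Sum>j<N. U (a + real j)) - integral {0..real N} U - of_real (a - 1/2) * U (real N)" for N
  proof -
    have "(\<lambda>p. D p N) summable_on (I \<times> nonzero_ints)"
      by (rule abs_summable_summable, rule summable_on_comparison_test[OF Msum]) (use bound in auto)
    then have "((\<lambda>p. D p N) has_sum (\<Sum>\<^sub>\<infinity>p\<in>I \<times> nonzero_ints. D p N)) (I \<times> nonzero_ints)" by simp
    \<comment> \<open>For fixed m the sum over n is the Euler-Maclaurin formula for a single
      reciprocal.\<close>
    moreover have "((\<lambda>n. D (m, n) N) has_sum
        ((\<Sum>j<N. \<phi> m (a + real j)) - integral {0..real N} (\<phi> m) - of_real (a - 1/2) * \<phi> m (real N))) nonzero_ints"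
      if m: "m \<in> I" for m
    proof -
      have "integral {0..real N} (\<phi> m) = integral {0..real N} (\<lambda>x. 1 / (of_real x + s m)) - integral {0..real N} (\<lambda>x. 1 / s m)"
        unfolding \<phi>_def
        by (intro Henstock_Kurzweil_Integration.integral_diff integrable_continuous_real continuous_intros)
           (simp_all add: shift_denominator_nonzero[OF Ims0[OF m]] s0[OF m])
      moreover have "(\<Sum>j<N. \<phi> m (a + real j)) = (\<Sum>j<N. 1 / (of_real (a + real j) + s m)) - of_nat N / s m"
        by (simp add: \<phi>_def sum_subtractf)
      ultimately have "(\<Sum>j<N. \<phi> m (a + real j)) - integral {0..real N} (\<phi> m) - of_real (a - 1/2) * \<phi> m (real N) =
          (\<Sum>j<N. 1 / (of_real (a + real j) + s m)) - integral {0..real N} (\<lambda>x. 1 / (of_real x + s m))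
            - of_real (a - 1/2) * (1 / (of_nat N + s m) - 1 / s m)"
        by (simp add: \<phi>_def scaleR_conv_of_real)
      then show ?thesis
        using Euler_Maclaurin_Fourier_reciprocal[OF Ims0[OF m] a, of N]
        unfolding D_def prod.case fourier_coeff_def by (simp only:)
    qed
    ultimately have "((\<lambda>m. (\<Sum>j<N. \<phi> m (a + real j)) - integral {0..real N} (\<phi> m) - of_real (a - 1/2) * \<phi> m (real N)) has_sum
        (\<Sum>\<^sub>\<infinity>p\<in>I \<times> nonzero_ints. D p N)) I"
      by (rule has_sum_SigmaD)
    moreover have "((\<lambda>m. (\<Sum>j<N. \<phi> m (a + real j)) - integral {0..real N} (\<phi> m) - of_real (a - 1/2) * \<phi> m (real N)) has_sum
        ((\<Sum>j<N. U (a + real j)) - integral {0..real N} U - of_real (a - 1/2) * U (real N))) I"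
    proof (intro has_sum_minus_fun has_sum_cmult_right)
      show "((\<lambda>m. \<Sum>j<N. \<phi> m (a + real j)) has_sum (\<Sum>j<N. U (a + real j))) I"
        unfolding \<phi>_def using a by (intro has_sum_finite_sum U) auto
      show "((\<lambda>m. \<phi> m (real N)) has_sum U (real N)) I"
        unfolding \<phi>_def by (intro U) simp
      show "((\<lambda>m. integral {0..real N} (\<phi> m)) has_sum integral {0..real N} U) I"
      proof (rule has_sum_integral_M_test(2))
        show "continuous_on {0..real N} (\<phi> m)" if "m \<in> I" for m
          unfolding \<phi>_def by (intro continuous_intros) (simp_all add: shift_denominator_nonzero[OF Ims0[OF that]] s0[OF that])
        show "((\<lambda>m. \<phi> m x) has_sum U x) I" if "x \<in> {0..real N}" for x
          unfolding \<phi>_def using that by (intro U) simp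
        \<comment> \<open>N is fixed here, so the factor x, at most N, is harmless: this majorant
          only has to be summable over m.\<close>
        show "norm (\<phi> m x) \<le> real N * C * (1 / (of_int m)\<^sup>2)" if m: "m \<in> I" and x: "x \<in> {0..real N}" for m x
        proof -
          have nz: "complex_of_real x + s m \<noteq> 0" by (rule shift_denominator_nonzero[OF Ims0[OF m]])
          have "\<phi> m x = - of_real x / ((of_real x + s m) * s m)"
            using nz s0[OF m] by (simp add: \<phi>_def field_simps)
          then have "norm (\<phi> m x) = x / (norm (of_real x + s m) * norm (s m))"
            using x by (simp add: norm_divide norm_mult)
          also have "\<dots> \<le> real N / (\<bar>Im (s m)\<bar> * \<bar>Im (s m)\<bar>)"
            using x Ims0[OF m] norm_shift_ge[of "s m" x] abs_Im_le_cmod[of "s m"]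
            by (intro frac_le mult_mono) (auto simp: zero_less_mult_iff)
          also have "\<dots> = real N * (1 / (Im (s m))\<^sup>2)" by (simp add: power2_eq_square)
          finally show ?thesis unfolding C by simp
        qed
        show "(\<lambda>m. real N * C * (1 / (real_of_int m)\<^sup>2)) summable_on I"
          by (intro summable_on_cmult_right summable_on_subset[OF summable_on_inverse_int_squares I])
      qed
    qed
    ultimately show ?thesis by (rule has_sum_unique)
  qed
  with dom(1) show "(\<lambda>N. (\<Sum>j<N. U (a + real j)) - integral {0..real N} U - of_real (a - 1/2) * U (real N))
           \<longlonglongrightarrow> (\<Sum>\<^sub>\<infinity>p\<in>I \<times> nonzero_ints. term p)" by simp
qed

section \<open>Laplace transforms and the Sokhotski-Plemelj formula\<close>

lemma set_integrable_x_exp: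
  fixes c :: real
  assumes "c > 0"
  shows "set_integrable lborel {0..} (\<lambda>x. x * exp (- c * x))" "set_integrable lborel {0..} (\<lambda>x. exp (- c * x))"
proof -
  have "((\<lambda>x. - (x / c + 1 / c\<^sup>2) * exp (- c * x)) \<longlongrightarrow> 0) at_top"
    using assms by real_asymp
  then have "(\<integral>\<^sup>+x. ennreal (x * exp (- c * x)) * indicator {0 ..} x \<partial>lborel) = 0 - (- (0 / c + 1 / c\<^sup>2) * exp (- c * 0))"
    by (intro nn_integral_FTC_atLeast)
       (use assms in \<open>auto intro!: derivative_eq_intros simp: field_simps power2_eq_square\<close>)
  moreover have "ennreal (x * exp (- c * x)) * indicator {0 ..} x = ennreal (indicator {0..} x * (x * exp (- c * x)))" for x :: real
    by (auto split: split_indicator)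
  ultimately have "(\<integral>\<^sup>+x. ennreal (indicator {0..} x * (x * exp (- c * x))) \<partial>lborel) < \<infinity>"
    by simp
  then show "set_integrable lborel {0..} (\<lambda>x. x * exp (- c * x))"
    unfolding set_integrable_def
    by (intro integrableI_nonneg) (auto intro!: AE_I2 simp: indicator_def)
  have "((\<lambda>x. - (1 / c) * exp (- c * x)) \<longlongrightarrow> 0) at_top"
    using assms by real_asymp
  then have "(\<integral>\<^sup>+x. ennreal (exp (- c * x)) * indicator {0 ..} x \<partial>lborel) = 0 - (- (1 / c) * exp (- c * 0))"
    by (intro nn_integral_FTC_atLeast)
       (use assms in \<open>auto intro!: derivative_eq_intros simp: field_simps power2_eq_square\<close>)
  moreover have "ennreal (exp (- c * x)) * indicator {0 ..} x = ennreal (indicator {0..} x * (exp (- c * x)))" for x :: real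
    by (auto split: split_indicator)
  ultimately have "(\<integral>\<^sup>+x. ennreal (indicator {0..} x * (exp (- c * x))) \<partial>lborel) < \<infinity>"
    by simp
  then show "set_integrable lborel {0..} (\<lambda>x. exp (- c * x))"
    unfolding set_integrable_def
    by (intro integrableI_nonneg) (auto intro!: AE_I2 simp: indicator_def)
qed

lemma set_integrable_exp_complex:
  fixes P :: complex
  assumes "Re P > 0"
  shows "set_integrable lborel {0..} (\<lambda>x. exp (- P * of_real x))"
    and "set_integrable lborel {0..} (\<lambda>x. of_real x * exp (- P * of_real x))"
  by (rule set_integrable_bound[OF set_integrable_x_exp(2)[OF assms]]
           set_integrable_bound[OF set_integrable_x_exp(1)[OF assms]],
      auto simp: norm_mult set_borel_measurable_def intro!: AE_I2)+

lemma FTC_at_top: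
  fixes f F :: "real \<Rightarrow> complex"
  assumes int: "set_integrable lborel {0..} f"
    and F: "\<And>x. x \<ge> 0 \<Longrightarrow> (F has_vector_derivative f x) (at x within {0..})"
    and lim: "(F \<longlongrightarrow> l) at_top"
  shows "(LINT x:{0..}|lborel. f x) = l - F 0"
proof -
  have "((\<lambda>b. LINT x:{0..b}|lborel. f x) \<longlongrightarrow> (LINT x:{0..}|lborel. f x)) at_top"
    by (intro tendsto_set_lebesgue_integral_at_top int) auto
  moreover have "\<forall>\<^sub>F b in at_top. (LINT x:{0..b}|lborel. f x) = F b - F 0"
    using eventually_ge_at_top[of 0]
  proof eventually_elim
    case (elim b)
    have "set_integrable lborel {0..b} f"
      by (rule set_integrable_subset[OF int]) auto
    moreover have "(f has_integral (F b - F 0)) {0..b}"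
      by (intro fundamental_theorem_of_calculus elim has_vector_derivative_within_subset[OF F]) auto
    ultimately show ?case
      by (simp add: set_borel_integral_eq_integral(2) integral_unique)
  qed
  ultimately have "((\<lambda>b. F b - F 0) \<longlongrightarrow> (LINT x:{0..}|lborel. f x)) at_top"
    by (rule Lim_transform_eventually)
  moreover have "((\<lambda>b. F b - F 0) \<longlongrightarrow> l - F 0) at_top"
    by (intro tendsto_intros lim)
  ultimately show ?thesis by (intro tendsto_unique[of at_top]) auto
qed

lemma laplace_one:
  fixes P :: complex
  assumes P: "Re P > 0"
  shows "(LINT x:{0..}|lborel. exp (- P * of_real x)) = 1 / P"
proof -
  have P0: "P \<noteq> 0" using P by auto
  have "((\<lambda>x. - 1 / P * exp (- P * of_real x)) \<longlongrightarrow> 0) at_top"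
  proof (rule Lim_null_comparison)
    show "\<forall>\<^sub>F x in at_top. norm (- 1 / P * exp (- P * of_real x)) \<le> 1 / norm P * exp (- Re P * x)"
      by (simp add: norm_mult norm_divide)
    show "((\<lambda>x. 1 / norm P * exp (- Re P * x)) \<longlongrightarrow> 0) at_top"
      using P by real_asymp
  qed
  then have "(LINT x:{0..}|lborel. exp (- P * of_real x)) = 0 - (- 1 / P * exp (- P * of_real 0))"
    by (intro FTC_at_top set_integrable_exp_complex P)
       (use P0 in \<open>auto intro!: has_vector_derivative_real_field derivative_eq_intros\<close>)
  then show ?thesis by simp
qed

lemma laplace_x:
  fixes P :: complex
  assumes P: "Re P > 0"
  shows "(LINT x:{0..}|lborel. of_real x * exp (- P * of_real x)) = 1 / P\<^sup>2"
proof -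
  have P0: "P \<noteq> 0" using P by auto
  have "((\<lambda>x. - (of_real x / P + 1 / P\<^sup>2) * exp (- P * of_real x)) \<longlongrightarrow> 0) at_top"
  proof (rule Lim_null_comparison)
    show "\<forall>\<^sub>F x in at_top. norm (- (of_real x / P + 1 / P\<^sup>2) * exp (- P * of_real x)) \<le> (\<bar>x\<bar> / norm P + 1 / (norm P)\<^sup>2) * exp (- Re P * x)"
      by (intro always_eventually allI, unfold norm_mult norm_minus_cancel, rule mult_mono)
         (auto simp: norm_divide norm_power intro!: norm_triangle_le)
    have "norm P > 0" using P0 by simp
    then show "((\<lambda>x. (\<bar>x\<bar> / norm P + 1 / (norm P)\<^sup>2) * exp (- Re P * x)) \<longlongrightarrow> 0) at_top"
      using P by real_asymp
  qed
  then have "(LINT x:{0..}|lborel. of_real x * exp (- P * of_real x)) = 0 - (- (of_real 0 / P + 1 / P\<^sup>2) * exp (- P * of_real 0))"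
    by (intro FTC_at_top set_integrable_exp_complex P)
       (use P0 in \<open>auto intro!: has_vector_derivative_real_field derivative_eq_intros simp: field_simps power2_eq_square\<close>)
  then show ?thesis by simp
qed

lemma set_lebesgue_integral_Icc_FTC:
  fixes f F :: "real \<Rightarrow> complex"
  assumes "a \<le> b" and "\<And>x. x \<in> {a..b} \<Longrightarrow> (F has_vector_derivative f x) (at x within {a..b})"
    and "continuous_on {a..b} f"
  shows "set_integrable lborel {a..b} f" "(LINT x:{a..b}|lborel. f x) = F b - F a"
proof -
  show i: "set_integrable lborel {a..b} f"
    unfolding set_integrable_def by (rule borel_integrable_compact) (use assms in auto)
  show "(LINT x:{a..b}|lborel. f x) = F b - F a"
    using fundamental_theorem_of_calculus[OF assms(1,2)]
    by (simp add: set_borel_integral_eq_integral(2)[OF i] integral_unique)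
qed

text \<open>The antiderivative is a branch of log(x - N - i eta) up to a constant. Its real part is
  even about N and cancels over the symmetric interval; what survives is the change of argument,
  which tends to pi times the sign of eta as eta -> 0.\<close>

lemma integral_inverse_shifted_symmetric:
  fixes N \<eta> :: real
  assumes "N > 0" "\<eta> \<noteq> 0"
  shows "set_integrable lborel {0..2*N} (\<lambda>x. 1 / (of_real (x - N) - \<i> * of_real \<eta>))"
    and "(LINT x:{0..2*N}|lborel. 1 / (of_real (x - N) - \<i> * of_real \<eta>)) = 2 * \<i> * of_real (arctan (N / \<eta>))"
proof -
  define F where "F = (\<lambda>x. Complex (ln ((x - N)\<^sup>2 + \<eta>\<^sup>2) / 2) (arctan ((x - N) / \<eta>)))"
  have pos: "(x - N)\<^sup>2 + \<eta>\<^sup>2 > 0" for x using assms(2) by (simp add: add_nonneg_pos)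
  have nz: "complex_of_real (x - N) - \<i> * of_real \<eta> \<noteq> 0" for x using assms(2) by (simp add: complex_eq_iff)
  have d: "(F has_vector_derivative 1 / (of_real (x - N) - \<i> * of_real \<eta>)) (at x within S)" for x S
  proof -
    have q: "1 + ((x - N) / \<eta>)\<^sup>2 = ((x - N)\<^sup>2 + \<eta>\<^sup>2) / \<eta>\<^sup>2"
      using assms(2) by (simp add: field_simps power2_eq_square)
    have "((\<lambda>x. ln ((x - N)\<^sup>2 + \<eta>\<^sup>2) / 2) has_real_derivative (x - N) / ((x - N)\<^sup>2 + \<eta>\<^sup>2)) (at x within S)"
    proof -
      have "((\<lambda>x. (x - N)\<^sup>2 + \<eta>\<^sup>2) has_real_derivative 2 * (x - N)) (at x within S)"
        by (auto intro!: derivative_eq_intros)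
      then have "((\<lambda>x. ln ((x - N)\<^sup>2 + \<eta>\<^sup>2)) has_real_derivative inverse ((x - N)\<^sup>2 + \<eta>\<^sup>2) * (2 * (x - N))) (at x within S)"
        using DERIV_chain2[where f = ln and g = "\<lambda>x. (x - N)\<^sup>2 + \<eta>\<^sup>2" and x = x, OF DERIV_ln[OF pos[of x]]] by blast
      from DERIV_cdivide[OF this, of 2]
      have "((\<lambda>x. ln ((x - N)\<^sup>2 + \<eta>\<^sup>2) / 2) has_real_derivative
          inverse ((x - N)\<^sup>2 + \<eta>\<^sup>2) * (2 * (x - N)) / 2) (at x within S)" .
      moreover have "inverse A * (2 * y) / 2 = y / A" for A y :: real
        by (cases "A = 0") (auto simp: field_simps)
      ultimately show ?thesis by (simp only:)
    qed
    moreover have "((\<lambda>x. arctan ((x - N) / \<eta>)) has_real_derivative \<eta> / ((x - N)\<^sup>2 + \<eta>\<^sup>2)) (at x within S)"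
    proof -
      have "((\<lambda>x. arctan ((x - N) / \<eta>)) has_real_derivative inverse (1 + ((x - N) / \<eta>)\<^sup>2) * (1 / \<eta>)) (at x within S)"
        by (rule DERIV_chain2[where f = arctan and g = "\<lambda>x. (x - N) / \<eta>"])
           (use assms(2) in \<open>auto intro!: derivative_eq_intros\<close>)
      also have "inverse (1 + ((x - N) / \<eta>)\<^sup>2) * (1 / \<eta>) = \<eta> / ((x - N)\<^sup>2 + \<eta>\<^sup>2)"
        unfolding q using assms(2) pos[of x] by (simp add: power2_eq_square)
      finally show ?thesis .
    qed
    ultimately have "(F has_vector_derivative Complex ((x - N) / ((x - N)\<^sup>2 + \<eta>\<^sup>2)) (\<eta> / ((x - N)\<^sup>2 + \<eta>\<^sup>2))) (at x within S)"
      unfolding F_def has_vector_derivative_complex_iff by (simp add: has_real_derivative_iff_has_vector_derivative)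
    also have "Complex ((x - N) / ((x - N)\<^sup>2 + \<eta>\<^sup>2)) (\<eta> / ((x - N)\<^sup>2 + \<eta>\<^sup>2)) = 1 / (of_real (x - N) - \<i> * of_real \<eta>)"
      by (simp add: complex_eq_iff Re_divide Im_divide)
    finally show ?thesis .
  qed
  have c: "continuous_on {0..2*N} (\<lambda>x. 1 / (of_real (x - N) - \<i> * of_real \<eta>))"
    by (intro continuous_intros) (use nz in auto)
  note I = set_lebesgue_integral_Icc_FTC[of 0 "2 * N" F, OF _ d c]
  show "set_integrable lborel {0..2*N} (\<lambda>x. 1 / (of_real (x - N) - \<i> * of_real \<eta>))"
    using I(1) assms by simp
  have "F (2 * N) - F 0 = 2 * \<i> * of_real (arctan (N / \<eta>))"
    by (simp add: F_def complex_eq_iff arctan_minus)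
  then show "(LINT x:{0..2*N}|lborel. 1 / (of_real (x - N) - \<i> * of_real \<eta>)) = 2 * \<i> * of_real (arctan (N / \<eta>))"
    using I(2) assms by simp
qed

text \<open>The logarithms cancel because the interval and the deleted gap are both symmetric about
  N.\<close>

lemma integral_inverse_deleted_symmetric:
  fixes N \<epsilon> :: real
  assumes "0 < \<epsilon>" "\<epsilon> < N"
  shows "set_integrable lborel ({0..N-\<epsilon>} \<union> {N+\<epsilon>..2*N}) (\<lambda>x. 1 / complex_of_real (x - N))"
    and "(LINT x:{0..N-\<epsilon>} \<union> {N+\<epsilon>..2*N}|lborel. 1 / complex_of_real (x - N)) = 0"
proof -
  have 1: "set_integrable lborel {0..N-\<epsilon>} (\<lambda>x. 1 / complex_of_real (x - N))"
     "(LINT x:{0..N-\<epsilon>}|lborel. 1 / complex_of_real (x - N)) = of_real (ln (N - (N - \<epsilon>))) - of_real (ln (N - 0))"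
    by (rule set_lebesgue_integral_Icc_FTC[of 0 "N - \<epsilon>" "\<lambda>x. of_real (ln (N - x))"];
        (use assms in \<open>auto intro!: continuous_intros derivative_eq_intros has_vector_derivative_of_real simp: divide_simps\<close>))+
  have 2: "set_integrable lborel {N+\<epsilon>..2*N} (\<lambda>x. 1 / complex_of_real (x - N))"
     "(LINT x:{N+\<epsilon>..2*N}|lborel. 1 / complex_of_real (x - N)) = of_real (ln (2*N - N)) - of_real (ln (N + \<epsilon> - N))"
    by (rule set_lebesgue_integral_Icc_FTC[of "N + \<epsilon>" "2 * N" "\<lambda>x. of_real (ln (x - N))"];
        (use assms in \<open>auto intro!: continuous_intros derivative_eq_intros has_vector_derivative_of_real simp: divide_simps\<close>))+
  show "set_integrable lborel ({0..N-\<epsilon>} \<union> {N+\<epsilon>..2*N}) (\<lambda>x. 1 / complex_of_real (x - N))"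
    by (rule set_integrable_Un[OF 1(1) 2(1)]) auto
  have "(LINT x:{0..N-\<epsilon>} \<union> {N+\<epsilon>..2*N}|lborel. 1 / complex_of_real (x - N)) =
      (LINT x:{0..N-\<epsilon>}|lborel. 1 / complex_of_real (x - N)) + (LINT x:{N+\<epsilon>..2*N}|lborel. 1 / complex_of_real (x - N))"
    by (rule set_integral_Un[OF _ 1(1) 2(1)]) (use assms in auto)
  then show "(LINT x:{0..N-\<epsilon>} \<union> {N+\<epsilon>..2*N}|lborel. 1 / complex_of_real (x - N)) = 0"
    by (simp only: 1(2) 2(2)) simp
qed

text \<open>Subtracting \<open>\<phi> N\<close> on the symmetric interval \<open>{0..2 * N}\<close> removes the singularity; what is
  subtracted contributes \<open>0\<close> to the principal value and \<open>2 i arctan (N / h)\<close> to the shifted integral.\<close>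

lemma plemelj:
  fixes \<phi> :: "real \<Rightarrow> complex" and N B :: real
  assumes N: "N > 0" and int: "set_integrable lborel {0..} \<phi>"
    and cont: "continuous_on UNIV \<phi>"
    and lip: "\<And>x. x \<in> {0..2*N} \<Longrightarrow> norm (\<phi> x - \<phi> N) \<le> B * \<bar>x - N\<bar>"
  obtains L where
    "\<And>h. (\<And>n. h n \<noteq> 0) \<Longrightarrow> h \<longlonglongrightarrow> 0 \<Longrightarrow> (\<And>n. sgn (h n) = \<sigma>) \<Longrightarrow>
       (\<lambda>n. LINT x:{0..}|lborel. \<phi> x / (of_real (x - N) - \<i> * of_real (h n))) \<longlonglongrightarrow> L + \<i> * pi * of_real \<sigma> * \<phi> N"
    "pv_integral {0..} N (\<lambda>x. \<phi> x / of_real (x - N)) = L"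
proof
  \<comment> \<open>The regularised quotient, bounded near N by the Lipschitz estimate. Subtracting
    only on [0, 2 N] keeps it integrable over the half-line, since a constant divided by x - N is
    not integrable at infinity.\<close>
  define g where "g = (\<lambda>x. (\<phi> x - indicator {0..2*N} x *\<^sub>R \<phi> N) / of_real (x - N))"
  define L where "L = (LINT x:{0..}|lborel. g x)"
  have [measurable]: "\<phi> \<in> borel_measurable borel"
    using cont by (rule borel_measurable_continuous_onI)
  have [measurable]: "g \<in> borel_measurable borel"
    unfolding g_def by measurable
  have "0 \<le> B * \<bar>0 - N\<bar>" by (rule order_trans[OF norm_ge_zero lip]) (use N in auto)
  then have B: "B \<ge> 0" using N by (simp add: zero_le_mult_iff)
  \<comment> \<open>Majorant of \<open>g\<close>: the Lipschitz constant on [0, 2 N], and beyond it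
    x - N > N.\<close>
  define w where "w = (\<lambda>x. indicator {0..2*N} x * B + indicator {0..} x * norm (\<phi> x) / N)"
  have iphi: "integrable lborel (\<lambda>x. indicator {0..} x * norm (\<phi> x) / N)"
    using integrable_norm[OF int[unfolded set_integrable_def]]
    by (intro Bochner_Integration.integrable_divide) (simp add: norm_scaleR)
  have wi: "integrable lborel w"
    unfolding w_def by (intro Bochner_Integration.integrable_add iphi) (simp add: emeasure_lborel_Icc_eq)
  have wb: "norm (indicator {0..} x *\<^sub>R g x) \<le> w x" for x
  proof (cases "x \<in> {0..2*N}")
    case True
    have "norm (g x) \<le> B"
    proof (cases "x = N")
      case False
      then show ?thesis using lip[OF True] True
        by (simp add: g_def norm_divide divide_le_eq flip: of_real_diff)
    qed (simp add: g_def B)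
    moreover have "norm (\<phi> x) / N \<ge> 0" using N by simp
    moreover have "norm (indicator {0..} x *\<^sub>R g x) = norm (g x)" "w x = B + norm (\<phi> x) / N"
      using True by (simp_all add: w_def)
    ultimately show ?thesis by linarith
  next
    case False
    show ?thesis
    proof (cases "x \<ge> 0")
      case True
      with False have x: "x > 2 * N" by auto
      then have "norm (g x) = norm (\<phi> x) / (x - N)"
        using N by (simp add: g_def norm_divide flip: of_real_diff)
      also have "\<dots> \<le> norm (\<phi> x) / N" using x N by (intro divide_left_mono) auto
      finally show ?thesis using x N by (simp add: w_def)
    qed (use N in \<open>simp add: w_def\<close>)
  qed
  have chi: "set_integrable lborel {0..} g"
    unfolding set_integrable_def
  proof (rule Bochner_Integration.integrable_bound[OF wi])
    show "AE x in lborel. norm (indicator {0..} x *\<^sub>R g x) \<le> norm (w x)"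
      by (intro AE_I2 order_trans[OF wb]) simp
  qed measurable

  show "(\<lambda>n. LINT x:{0..}|lborel. \<phi> x / (of_real (x - N) - \<i> * of_real (h n))) \<longlonglongrightarrow> L + \<i> * pi * of_real \<sigma> * \<phi> N"
    if h: "\<And>n. h n \<noteq> 0" "h \<longlonglongrightarrow> 0" "\<And>n. sgn (h n) = \<sigma>" for h
  proof -
    define D where "D = (\<lambda>n x. complex_of_real (x - N) - \<i> * of_real (h n))"
    have D0: "D n x \<noteq> 0" for n x using h(1)[of n] by (simp add: D_def complex_eq_iff)
    \<comment> \<open>This factor separates the shift from the singularity: it has modulus at most 1
      and tends to 1 off N, so dominated convergence applies to \<open>q n x * g x\<close>.\<close>
    define q where "q = (\<lambda>n x. of_real (x - N) / D n x)"
    have qb: "norm (q n x) \<le> 1" for n x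
    proof -
      have "\<bar>x - N\<bar> \<le> norm (D n x)"
        using abs_Re_le_cmod[of "D n x"] by (simp add: D_def)
      then show ?thesis using D0[of n x] by (simp add: q_def norm_divide divide_le_eq_1 flip: of_real_diff)
    qed
    have qm [measurable]: "q n \<in> borel_measurable borel" for n
      unfolding q_def D_def by measurable
    have ql: "(\<lambda>n. q n x) \<longlonglongrightarrow> 1" if "x \<noteq> N" for x
    proof -
      have "(\<lambda>n. q n x) \<longlonglongrightarrow> of_real (x - N) / (of_real (x - N) - \<i> * of_real 0)"
        unfolding q_def D_def using that by (intro tendsto_intros h(2)) (simp add: complex_eq_iff)
      then show ?thesis using that by (simp del: of_real_diff)
    qed
    have lim: "(\<lambda>n. LINT x:{0..}|lborel. q n x * g x) \<longlonglongrightarrow> L"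
      unfolding L_def set_lebesgue_integral_def
    proof (rule integral_dominated_convergence[OF _ _ wi])
      show "AE x in lborel. (\<lambda>n. indicator {0..} x *\<^sub>R (q n x * g x)) \<longlonglongrightarrow> indicator {0..} x *\<^sub>R g x"
      proof (rule AE_I2)
        fix x
        show "(\<lambda>n. indicator {0..} x *\<^sub>R (q n x * g x)) \<longlonglongrightarrow> indicator {0..} x *\<^sub>R g x"
        proof (cases "x = N")
          case False
          have "(\<lambda>n. indicator {0..} x *\<^sub>R (q n x * g x)) \<longlonglongrightarrow> indicator {0..} x *\<^sub>R (1 * g x)"
            by (intro tendsto_intros ql False)
          then show ?thesis by simp
        qed (simp add: g_def)
      qed
      show "AE x in lborel. norm (indicator {0..} x *\<^sub>R (q n x * g x)) \<le> w x" for n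
      proof (rule AE_I2)
        fix x
        have "norm (indicator {0..} x *\<^sub>R (q n x * g x)) = norm (q n x) * norm (indicator {0..} x *\<^sub>R g x)"
          by (simp add: norm_mult)
        also have "\<dots> \<le> 1 * norm (indicator {0..} x *\<^sub>R g x)"
          by (intro mult_right_mono qb) simp
        finally show "norm (indicator {0..} x *\<^sub>R (q n x * g x)) \<le> w x" using wb[of x] by simp
      qed
    qed measurable
    have split: "(LINT x:{0..}|lborel. \<phi> x / D n x) = (LINT x:{0..}|lborel. q n x * g x) + \<phi> N * (2 * \<i> * of_real (arctan (N / h n)))" for n
    proof -
      have qi: "integrable lborel (\<lambda>x. indicator {0..} x *\<^sub>R (q n x * g x))"
      proof (rule Bochner_Integration.integrable_bound[OF chi[unfolded set_integrable_def]])
        show "AE x in lborel. norm (indicator {0..} x *\<^sub>R (q n x * g x)) \<le> norm (indicator {0..} x *\<^sub>R g x)"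
        proof (rule AE_I2)
          fix x
          have "norm (q n x) * norm (g x) \<le> 1 * norm (g x)" by (intro mult_right_mono qb) simp
          then show "norm (indicator {0..} x *\<^sub>R (q n x * g x)) \<le> norm (indicator {0..} x *\<^sub>R g x)"
            by (simp add: norm_mult indicator_def)
        qed
      qed measurable
      have i2: "integrable lborel (\<lambda>x. \<phi> N * (indicator {0..2*N} x *\<^sub>R (1 / D n x)))"
        using integral_inverse_shifted_symmetric(1)[OF N h(1)[of n]] unfolding D_def set_integrable_def
        by (rule Bochner_Integration.integrable_mult_right)
      have "indicator {0..} x *\<^sub>R (\<phi> x / D n x) =
          indicator {0..} x *\<^sub>R (q n x * g x) + \<phi> N * (indicator {0..2*N} x *\<^sub>R (1 / D n x))" if "x \<noteq> N" for x
      proof -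
        have "complex_of_real (x - N) \<noteq> 0" using that by simp
        then have "q n x * g x = (\<phi> x - indicator {0..2*N} x *\<^sub>R \<phi> N) / D n x"
          by (simp add: q_def g_def del: of_real_diff)
        then show ?thesis
          by (cases "x \<in> {0..2*N}") (auto simp: diff_divide_distrib indicator_def)
      qed
      moreover have "AE x in lborel. x \<noteq> N" by (rule AE_lborel_singleton)
      ultimately have "(LINT x|lborel. indicator {0..} x *\<^sub>R (\<phi> x / D n x)) =
          (LINT x|lborel. indicator {0..} x *\<^sub>R (q n x * g x) + \<phi> N * (indicator {0..2*N} x *\<^sub>R (1 / D n x)))"
        by (intro integral_cong_AE) (auto simp: D_def elim!: eventually_mono)
      also have "\<dots> = (LINT x|lborel. indicator {0..} x *\<^sub>R (q n x * g x)) + \<phi> N * (LINT x|lborel. indicator {0..2*N} x *\<^sub>R (1 / D n x))"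
        by (subst Bochner_Integration.integral_add[OF qi i2]) (simp only: integral_mult_right_zero)
      also have "(LINT x|lborel. indicator {0..2*N} x *\<^sub>R (1 / D n x)) = 2 * \<i> * of_real (arctan (N / h n))"
        using integral_inverse_shifted_symmetric(2)[OF N h(1)[of n]] unfolding D_def set_lebesgue_integral_def .
      finally show ?thesis unfolding set_lebesgue_integral_def .
    qed
    \<comment> \<open>\<open>h\<close> tends to 0 with the constant sign \<sigma>, so N / h tends to
      infinity with that sign.\<close>
    have at: "(\<lambda>n. arctan (N / h n)) \<longlonglongrightarrow> \<sigma> * (pi / 2)"
    proof (cases "\<sigma> > 0")
      case True
      then have "h n > 0" for n using h(3)[of n] by (simp add: sgn_if split: if_splits)
      then have "filterlim h (at_right 0) sequentially"
        using h(1,2) by (auto simp: filterlim_at intro!: always_eventually)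
      then have "filterlim (\<lambda>n. inverse (h n)) at_top sequentially"
        by (rule filterlim_compose[OF filterlim_inverse_at_top_right])
      then have "filterlim (\<lambda>n. N * inverse (h n)) at_top sequentially"
        by (intro filterlim_tendsto_pos_mult_at_top[OF tendsto_const N])
      then have "(\<lambda>n. arctan (N * inverse (h n))) \<longlonglongrightarrow> pi / 2"
        by (rule filterlim_compose[OF tendsto_arctan_at_top])
      moreover have "\<sigma> = 1" using True h(3)[of 0] by (auto simp: sgn_if split: if_splits)
      moreover have "N * inverse (h n) = N / h n" for n by (simp add: field_simps)
      ultimately show ?thesis by simp
    next
      case False
      then have "h n < 0" for n using h(3)[of n] h(1)[of n] by (simp add: sgn_if split: if_splits)
      then have "filterlim (\<lambda>n. - h n) (at_right 0) sequentially"
        using tendsto_minus[OF h(2)] h(1) by (auto simp: filterlim_at intro!: always_eventually)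
      then have "filterlim (\<lambda>n. inverse (- h n)) at_top sequentially"
        by (rule filterlim_compose[OF filterlim_inverse_at_top_right])
      then have "filterlim (\<lambda>n. N * inverse (- h n)) at_top sequentially"
        by (intro filterlim_tendsto_pos_mult_at_top[OF tendsto_const N])
      then have "(\<lambda>n. - arctan (N * inverse (- h n))) \<longlonglongrightarrow> - (pi / 2)"
        by (intro tendsto_minus filterlim_compose[OF tendsto_arctan_at_top])
      moreover have "\<sigma> = - 1" using False h(3)[of 0] h(1)[of 0] by (auto simp: sgn_if split: if_splits)
      moreover have "N * inverse (- h n) = - (N / h n)" for n by (simp add: field_simps)
      ultimately show ?thesis by (simp add: arctan_minus)
    qed
    have "(\<lambda>n. LINT x:{0..}|lborel. \<phi> x / D n x) \<longlonglongrightarrow> L + \<phi> N * (2 * \<i> * of_real (\<sigma> * (pi / 2)))"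
      unfolding split by (intro tendsto_intros lim at)
    then show ?thesis by (simp add: D_def mult_ac)
  qed

  show "pv_integral {0..} N (\<lambda>x. \<phi> x / of_real (x - N)) = L"
    unfolding pv_integral_def
  proof (rule tendsto_Lim)
    define G where "G = (\<lambda>\<epsilon>. LINT x:{0..} - {N - \<epsilon><..<N + \<epsilon>}|lborel. g x)"
    have "(G \<longlongrightarrow> L) (at_right 0)"
      unfolding tendsto_at_iff_sequentially
    proof (intro allI impI)
      fix X assume X: "\<forall>i::nat. X i \<in> {0<..} - {0::real}" "X \<longlonglongrightarrow> 0"
      show "(G \<circ> X) \<longlonglongrightarrow> L"
        unfolding o_def G_def L_def set_lebesgue_integral_def
      proof (rule integral_dominated_convergence[OF _ _ wi])
        show "AE x in lborel. (\<lambda>i. indicator ({0..} - {N - X i<..<N + X i}) x *\<^sub>R g x) \<longlonglongrightarrow> indicator {0..} x *\<^sub>R g x"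
        proof (rule AE_I2)
          fix x
          show "(\<lambda>i. indicator ({0..} - {N - X i<..<N + X i}) x *\<^sub>R g x) \<longlonglongrightarrow> indicator {0..} x *\<^sub>R g x"
          proof (cases "x = N")
            case False
            then have "\<forall>\<^sub>F i in sequentially. X i < \<bar>x - N\<bar>"
              using X(2) by (intro order_tendstoD(2)) auto
            then have "\<forall>\<^sub>F i in sequentially. indicator ({0..} - {N - X i<..<N + X i}) x *\<^sub>R g x = indicator {0..} x *\<^sub>R g x"
              by eventually_elim (auto simp: indicator_def)
            then show ?thesis by (rule tendsto_eventually)
          qed (simp add: g_def)
        qed
        show "AE x in lborel. norm (indicator ({0..} - {N - X i<..<N + X i}) x *\<^sub>R g x) \<le> w x" for i
        proof (rule AE_I2)
          fix x
          have "norm (indicator ({0..} - {N - X i<..<N + X i}) x *\<^sub>R g x) \<le> norm (indicator {0..} x *\<^sub>R g x)"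
            by (auto simp: indicator_def)
          then show "norm (indicator ({0..} - {N - X i<..<N + X i}) x *\<^sub>R g x) \<le> w x" using wb[of x] by simp
        qed
      qed measurable
    qed
    moreover have "\<forall>\<^sub>F \<epsilon> in at_right 0. G \<epsilon> = (LINT x:{0..} - {N - \<epsilon><..<N + \<epsilon>}|lborel. \<phi> x / of_real (x - N))"
      using eventually_at_right_less[of "0::real"] order_tendstoD(2)[OF tendsto_ident_at N]
    proof eventually_elim
      case (elim \<epsilon>)
      let ?S = "{0..} - {N - \<epsilon><..<N + \<epsilon>}" and ?T = "{0..N-\<epsilon>} \<union> {N+\<epsilon>..2*N}"
      have e: "0 < \<epsilon>" "\<epsilon> < N" using elim by auto
      note T = integral_inverse_deleted_symmetric[OF e]
      have i1: "integrable lborel (\<lambda>x. indicator ?S x *\<^sub>R g x)"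
        using set_integrable_subset[OF chi, of ?S] unfolding set_integrable_def by auto
      have i2: "integrable lborel (\<lambda>x. \<phi> N * (indicator ?T x *\<^sub>R (1 / complex_of_real (x - N))))"
        using T(1) unfolding set_integrable_def by (rule Bochner_Integration.integrable_mult_right)
      have "(LINT x:?S|lborel. \<phi> x / of_real (x - N)) =
         (LINT x|lborel. indicator ?S x *\<^sub>R g x + \<phi> N * (indicator ?T x *\<^sub>R (1 / complex_of_real (x - N))))"
        unfolding set_lebesgue_integral_def
      proof (rule Bochner_Integration.integral_cong[OF refl])
        fix x
        show "indicator ?S x *\<^sub>R (\<phi> x / of_real (x - N)) = indicator ?S x *\<^sub>R g x + \<phi> N * (indicator ?T x *\<^sub>R (1 / complex_of_real (x - N)))"
        proof (cases "x \<in> ?S")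
          case True
          then have "(x \<in> ?T) = (x \<in> {0..2*N})" using e by auto
          then show ?thesis using True by (simp add: g_def diff_divide_distrib indicator_def)
        next
          case False
          then have "x \<notin> ?T" using e by auto
          then show ?thesis using False by simp
        qed
      qed
      also have "\<dots> = (LINT x|lborel. indicator ?S x *\<^sub>R g x) + \<phi> N * (LINT x|lborel. indicator ?T x *\<^sub>R (1 / complex_of_real (x - N)))"
        by (subst Bochner_Integration.integral_add[OF i1 i2]) (simp only: integral_mult_right_zero)
      finally show ?case using T(2) unfolding G_def set_lebesgue_integral_def by simp
    qed
    ultimately show "((\<lambda>\<epsilon>. LINT x:{0..} - {N - \<epsilon><..<N + \<epsilon>}|lborel. \<phi> x / of_real (x - N)) \<longlongrightarrow> L) (at_right 0)"
      by (rule Lim_transform_eventually)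
  qed simp
qed

section \<open>Principal values as Fourier integrals\<close>

text \<open>With a kernel of modulus 1 the integrand has modulus |g a| |h x|, a product of
  integrable functions, so Fubini's theorem applies.\<close>

lemma Fubini_unimodular_kernel:
  fixes g h :: "real \<Rightarrow> complex" and K :: "real \<Rightarrow> real \<Rightarrow> complex"
  assumes g: "integrable lborel g" and h: "integrable lborel h"
    and K [measurable]: "case_prod K \<in> borel_measurable (borel \<Otimes>\<^sub>M borel)"
    and norm_K: "\<And>a x. norm (K a x) = 1"
  shows "(LINT a|lborel. g a * (LINT x|lborel. h x * K a x)) = (LINT x|lborel. h x * (LINT a|lborel. g a * K a x))"
proof -
  have [measurable]: "g \<in> borel_measurable borel" "h \<in> borel_measurable borel"
    using g h by auto
  have Ka [measurable]: "K a \<in> borel_measurable borel" for a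
    using measurable_compose[OF _ K, of "\<lambda>x. (a, x)" borel] by simp
  have i: "integrable (lborel \<Otimes>\<^sub>M lborel) (case_prod (\<lambda>a x. g a * (h x * K a x)))"
  proof (rule lborel_pair.Fubini_integrable)
    show "case_prod (\<lambda>a x. g a * (h x * K a x)) \<in> borel_measurable (lborel \<Otimes>\<^sub>M lborel)"
      by measurable
    have "(\<lambda>a. LINT x|lborel. norm (case (a, x) of (a, x) \<Rightarrow> g a * (h x * K a x))) = (\<lambda>a. norm (g a) * (LINT x|lborel. norm (h x)))"
      by (simp add: norm_mult norm_K)
    then show "integrable lborel (\<lambda>a. LINT x|lborel. norm (case (a, x) of (a, x) \<Rightarrow> g a * (h x * K a x)))"
      using g by simp
    have "integrable lborel (\<lambda>x. h x * K a x)" for a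
      by (rule Bochner_Integration.integrable_bound[OF h]) (auto simp: norm_mult norm_K)
    then show "AE a in lborel. integrable lborel (\<lambda>x. case (a, x) of (a, x) \<Rightarrow> g a * (h x * K a x))"
      by simp
  qed
  have "(LINT x|lborel. LINT a|lborel. g a * (h x * K a x)) = (LINT a|lborel. LINT x|lborel. g a * (h x * K a x))"
    by (rule lborel_pair.Fubini_integral[OF i])
  moreover have "(LINT x|lborel. LINT a|lborel. g a * (h x * K a x)) = (LINT x|lborel. h x * (LINT a|lborel. g a * K a x))"
    by (simp add: mult.left_commute[of "g _"])
  ultimately show ?thesis by simp
qed

text \<open>The reciprocal square is a Laplace transform of x, taken at P = 2 pi w + 2 pi i a / v,
  which is 2 pi i / v times a - i v w; after the exchange the integral over a is exponential. The
  damping delta makes that integral converge and moves the pole to p v + i delta v / (2 pi), so the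
  side of the real axis on which it lies is given by the sign of v.\<close>

lemma damped_fourier_integral:
  fixes p v \<delta> :: real and w :: complex
  assumes v: "v \<noteq> 0" and w: "Re w > 0" and \<delta>: "\<delta> > 0"
  shows "(LINT a:{0..}|lborel. exp (- \<delta> * a) * (cis (2 * pi * p * a) / (of_real a + (- \<i> * of_real v * w))\<^sup>2)) =
     2 * pi * \<i> / v * (LINT x:{0..}|lborel. of_real x * exp (- (2 * pi * w) * of_real x) / (of_real (x - p * v) - \<i> * of_real (\<delta> * v / (2 * pi))))"
proof -
  define Q where "Q = of_real \<delta> - 2 * pi * \<i> * of_real p"
  define g where "g = (\<lambda>a::real. indicator {0..} a *\<^sub>R exp (- Q * of_real a))"
  define h where "h = (\<lambda>x::real. indicator {0..} x *\<^sub>R (of_real x * exp (- (2 * pi * w) * of_real x)))"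
  define K where "K = (\<lambda>a x :: real. exp (- (2 * pi * \<i> * of_real (a * x / v))))"
  have Q: "Re Q > 0" using \<delta> by (simp add: Q_def)
  have W: "Re (2 * pi * w) > 0" using w by simp
  have "(LINT a|lborel. g a * (LINT x|lborel. h x * K a x)) = (LINT x|lborel. h x * (LINT a|lborel. g a * K a x))"
  proof (rule Fubini_unimodular_kernel)
    show "integrable lborel g" "integrable lborel h"
      using set_integrable_exp_complex(1)[OF Q] set_integrable_exp_complex(2)[OF W]
      unfolding g_def h_def set_integrable_def by auto
    show "case_prod K \<in> borel_measurable (borel \<Otimes>\<^sub>M borel)"
      unfolding K_def by measurable
    show "norm (K a x) = 1" for a x
      by (simp add: K_def)
  qed
  moreover have "(LINT x|lborel. h x * K a x) = - (v\<^sup>2 / (4 * pi\<^sup>2)) * (1 / (of_real a + (- \<i> * of_real v * w))\<^sup>2)" for a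
  proof -
    define P where "P = 2 * pi * w + 2 * pi * \<i> * of_real (a / v)"
    have "Re P > 0" using w by (simp add: P_def)
    from laplace_x[OF this] have "(LINT x|lborel. indicator {0..} x *\<^sub>R (of_real x * exp (- P * of_real x))) = 1 / P\<^sup>2"
      unfolding set_lebesgue_integral_def .
    moreover have "indicator {0..} x *\<^sub>R (of_real x * exp (- P * of_real x)) = h x * K a x" for x :: real
      unfolding h_def K_def P_def by (simp add: exp_add[symmetric] algebra_simps exp_diff[symmetric])
    ultimately have "(LINT x|lborel. h x * K a x) = 1 / P\<^sup>2" by simp
    also have "P = (2 * pi * \<i> / v) * (of_real a + (- \<i> * of_real v * w))"
      using v by (simp add: P_def field_simps)
    also have "1 / \<dots>\<^sup>2 = - (v\<^sup>2 / (4 * pi\<^sup>2)) * (1 / (of_real a + (- \<i> * of_real v * w))\<^sup>2)"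
      by (simp add: power_mult_distrib power_divide)
    finally show ?thesis .
  qed
  moreover have "(LINT a|lborel. g a * K a x) = v / (2 * pi * \<i>) * (1 / (of_real (x - p * v) - \<i> * of_real (\<delta> * v / (2 * pi))))" for x
  proof -
    define P where "P = Q + 2 * pi * \<i> * of_real (x / v)"
    have "Re P > 0" using \<delta> by (simp add: P_def Q_def)
    from laplace_one[OF this] have "(LINT a|lborel. indicator {0..} a *\<^sub>R exp (- P * of_real a)) = 1 / P"
      unfolding set_lebesgue_integral_def .
    moreover have "indicator {0..} a *\<^sub>R exp (- P * of_real a) = g a * K a x" for a :: real
      unfolding g_def K_def P_def by (simp add: exp_add[symmetric] algebra_simps exp_diff[symmetric])
    ultimately have "(LINT a|lborel. g a * K a x) = 1 / P" by simp
    also have "P = (2 * pi * \<i> / v) * (of_real (x - p * v) - \<i> * of_real (\<delta> * v / (2 * pi)))"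
      using v by (simp add: P_def Q_def field_simps)
    also have "1 / \<dots> = v / (2 * pi * \<i>) * (1 / (of_real (x - p * v) - \<i> * of_real (\<delta> * v / (2 * pi))))"
    proof -
      have "1 / ((2 * pi * \<i> / v) * D) = v / (2 * pi * \<i>) * (1 / D)" for D :: complex by simp
      then show ?thesis .
    qed
    finally show ?thesis .
  qed
  ultimately have eq: "(LINT a|lborel. g a * (- (v\<^sup>2 / (4 * pi\<^sup>2)) * (1 / (of_real a + (- \<i> * of_real v * w))\<^sup>2))) =
      (LINT x|lborel. h x * (v / (2 * pi * \<i>) * (1 / (of_real (x - p * v) - \<i> * of_real (\<delta> * v / (2 * pi))))))"
    by simp
  have "(LINT a|lborel. g a * (- (v\<^sup>2 / (4 * pi\<^sup>2)) * (1 / (of_real a + (- \<i> * of_real v * w))\<^sup>2))) =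
      (LINT a|lborel. - (v\<^sup>2 / (4 * pi\<^sup>2)) * (indicator {0..} a *\<^sub>R (exp (- \<delta> * a) * (cis (2 * pi * p * a) / (of_real a + (- \<i> * of_real v * w))\<^sup>2))))"
  proof (rule Bochner_Integration.integral_cong[OF refl])
    fix a
    have "exp (- Q * of_real a) = exp (- \<delta> * a) * cis (2 * pi * p * a)"
      unfolding cis_conv_exp exp_of_real[symmetric] exp_add[symmetric] Q_def by (simp add: algebra_simps)
    then show "g a * (- (v\<^sup>2 / (4 * pi\<^sup>2)) * (1 / (of_real a + (- \<i> * of_real v * w))\<^sup>2)) =
      - (v\<^sup>2 / (4 * pi\<^sup>2)) * (indicator {0..} a *\<^sub>R (exp (- \<delta> * a) * (cis (2 * pi * p * a) / (of_real a + (- \<i> * of_real v * w))\<^sup>2)))"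
      by (simp add: g_def mult_ac scaleR_conv_of_real)
  qed
  also have "\<dots> = - (v\<^sup>2 / (4 * pi\<^sup>2)) * (LINT a:{0..}|lborel. exp (- \<delta> * a) * (cis (2 * pi * p * a) / (of_real a + (- \<i> * of_real v * w))\<^sup>2))"
    unfolding set_lebesgue_integral_def by (rule integral_mult_right_zero)
  finally have l: "(LINT a|lborel. g a * (- (v\<^sup>2 / (4 * pi\<^sup>2)) * (1 / (of_real a + (- \<i> * of_real v * w))\<^sup>2))) = \<dots>" .
  have "(LINT x|lborel. h x * (v / (2 * pi * \<i>) * (1 / (of_real (x - p * v) - \<i> * of_real (\<delta> * v / (2 * pi)))))) =
      (LINT x|lborel. v / (2 * pi * \<i>) * (indicator {0..} x *\<^sub>R (of_real x * exp (- (2 * pi * w) * of_real x) / (of_real (x - p * v) - \<i> * of_real (\<delta> * v / (2 * pi))))))"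
    by (rule Bochner_Integration.integral_cong[OF refl]) (simp add: h_def mult_ac scaleR_conv_of_real)
  also have "\<dots> = v / (2 * pi * \<i>) * (LINT x:{0..}|lborel. of_real x * exp (- (2 * pi * w) * of_real x) / (of_real (x - p * v) - \<i> * of_real (\<delta> * v / (2 * pi))))"
    unfolding set_lebesgue_integral_def by (rule integral_mult_right_zero)
  finally have r: "(LINT x|lborel. h x * (v / (2 * pi * \<i>) * (1 / (of_real (x - p * v) - \<i> * of_real (\<delta> * v / (2 * pi)))))) = \<dots>" .
  have cancel: "X = 2 * pi * \<i> / v * Y" if "- (v\<^sup>2 / (4 * pi\<^sup>2)) * X = v / (2 * pi * \<i>) * Y" for X Y :: complex
  proof -
    have "X = (- (4 * pi\<^sup>2) / v\<^sup>2) * (- (v\<^sup>2 / (4 * pi\<^sup>2)) * X)" using v by simp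
    also have "\<dots> = (- (4 * pi\<^sup>2) / v\<^sup>2) * (v / (2 * pi * \<i>) * Y)" by (simp only: that)
    also have "\<dots> = 2 * pi * \<i> / v * Y" using v by (simp add: field_simps power2_eq_square)
    finally show ?thesis .
  qed
  show ?thesis by (rule cancel) (use eq l r in simp)
qed

text \<open>Let delta -> 0. If p v > 0, the pole approaches the half-line from the side given by sgn
  v, and the residue enters with the sign sgn v = (sgn p + sgn v)/2. If p v < 0, the pole stays
  away, the principal value is an ordinary integral and the two signs cancel. For p = n and v = m /
  R the left side is one summand of f plus one of I, up to a root of unity.\<close>

lemma pv_integral_eq_fourier:
  fixes p v :: real and w :: complex
  assumes p: "p \<noteq> 0" and v: "v \<noteq> 0" and w: "Re w > 0"
  shows "of_real ((sgn p + sgn v) / 4) * exp (- (2 * pi * w) * of_real (p * v)) +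
      1 / (2 * pi * \<i> * of_real (p * v)) *
        pv_integral {0..} (p * v) (\<lambda>x. of_real x * exp (- (2 * pi * w) * of_real x) / of_real (x - p * v)) =
      - 1 / (4 * pi\<^sup>2 * p) * fourier_inverse_square p (- \<i> * of_real v * w)"
proof -
  define s where "s = - \<i> * of_real v * w"
  have s: "Im s \<noteq> 0" using v w by (simp add: s_def)
  define \<delta> where "\<delta> = (\<lambda>n. 1 / real (Suc n))"
  have \<delta>: "\<delta> n > 0" "\<delta> n \<noteq> 0" for n by (simp_all add: \<delta>_def)
  have \<delta>0: "\<delta> \<longlonglongrightarrow> 0" unfolding \<delta>_def by real_asymp
  define \<phi> where "\<phi> = (\<lambda>x::real. of_real x * exp (- (2 * pi * w) * of_real x))"
  define h where "h = (\<lambda>n. \<delta> n * v / (2 * pi))"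
  have h: "h n \<noteq> 0" "sgn (h n) = sgn v" for n
  proof -
    have "h n = (\<delta> n / (2 * pi)) * v" "\<delta> n / (2 * pi) > 0" using \<delta>(1)[of n] by (simp_all add: h_def)
    then show "h n \<noteq> 0" "sgn (h n) = sgn v" using v \<delta>[of n] by (simp_all add: sgn_mult)
  qed
  have h0: "h \<longlonglongrightarrow> 0" unfolding h_def using \<delta>0 by (auto intro!: tendsto_eq_intros)
  define Kn where "Kn = (\<lambda>n. LINT x:{0..}|lborel. \<phi> x / (of_real (x - p * v) - \<i> * of_real (h n)))"
  have int: "set_integrable lborel {0..} \<phi>"
    unfolding \<phi>_def by (rule set_integrable_exp_complex(2)) (use w in simp)
  have cont: "continuous_on UNIV \<phi>"
    unfolding \<phi>_def by (intro continuous_intros)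
  have lim1: "(\<lambda>n. LINT a:{0..}|lborel. exp (- \<delta> n * a) * (cis (2 * pi * p * a) / (of_real a + s)\<^sup>2)) \<longlonglongrightarrow> fourier_inverse_square p s"
    unfolding fourier_inverse_square_def set_lebesgue_integral_def
  proof (rule integral_dominated_convergence)
    show "integrable lborel (\<lambda>x. indicator {0..} x *\<^sub>R (1 / (norm (complex_of_real x + s))\<^sup>2))"
      using set_integrable_inverse_square_norm[OF s] unfolding set_integrable_def .
    have "continuous_on UNIV (\<lambda>x. cis (2 * pi * p * x) / (of_real x + s)\<^sup>2)"
      by (intro continuous_intros) (simp add: shift_denominator_nonzero[OF s])
    then have [measurable]: "(\<lambda>x. cis (2 * pi * p * x) / (of_real x + s)\<^sup>2) \<in> borel_measurable borel"
      by (rule borel_measurable_continuous_onI)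
    show "(\<lambda>x. indicator {0..} x *\<^sub>R (cis (2 * pi * p * x) / (of_real x + s)\<^sup>2)) \<in> borel_measurable lborel"
      by measurable
    show "(\<lambda>x. indicator {0..} x *\<^sub>R (exp (- \<delta> n * x) * (cis (2 * pi * p * x) / (of_real x + s)\<^sup>2))) \<in> borel_measurable lborel" for n
      by measurable
    show "AE x in lborel. (\<lambda>n. indicator {0..} x *\<^sub>R (exp (- \<delta> n * x) * (cis (2 * pi * p * x) / (of_real x + s)\<^sup>2))) \<longlonglongrightarrow>
        indicator {0..} x *\<^sub>R (cis (2 * pi * p * x) / (of_real x + s)\<^sup>2)"
    proof (rule AE_I2)
      fix x :: real
      have "(\<lambda>n. indicator {0..} x *\<^sub>R (complex_of_real (exp (- \<delta> n * x)) * (cis (2 * pi * p * x) / (of_real x + s)\<^sup>2))) \<longlonglongrightarrow>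
        indicator {0..} x *\<^sub>R (complex_of_real (exp (- 0 * x)) * (cis (2 * pi * p * x) / (of_real x + s)\<^sup>2))"
        by (intro tendsto_intros \<delta>0)
      then show "(\<lambda>n. indicator {0..} x *\<^sub>R (exp (- \<delta> n * x) * (cis (2 * pi * p * x) / (of_real x + s)\<^sup>2))) \<longlonglongrightarrow>
        indicator {0..} x *\<^sub>R (cis (2 * pi * p * x) / (of_real x + s)\<^sup>2)" by simp
    qed
    show "AE x in lborel. norm (indicator {0..} x *\<^sub>R (exp (- \<delta> n * x) * (cis (2 * pi * p * x) / (of_real x + s)\<^sup>2)))
        \<le> indicator {0..} x *\<^sub>R (1 / (norm (complex_of_real x + s))\<^sup>2)" for n
    proof (rule AE_I2)
      fix x :: real
      show "norm (indicator {0..} x *\<^sub>R (exp (- \<delta> n * x) * (cis (2 * pi * p * x) / (of_real x + s)\<^sup>2)))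
        \<le> indicator {0..} x *\<^sub>R (1 / (norm (complex_of_real x + s))\<^sup>2)"
      proof (cases "x \<ge> 0")
        case True
        have "exp (- \<delta> n * x) \<le> 1" using True \<delta>(1)[of n] by simp
        then have "exp (- \<delta> n * x) * (1 / (norm (complex_of_real x + s))\<^sup>2) \<le> 1 * (1 / (norm (complex_of_real x + s))\<^sup>2)"
          by (rule mult_right_mono) simp
        then show ?thesis using True by (simp add: norm_mult norm_divide norm_power)
      qed simp
    qed
  qed
  have "(LINT a:{0..}|lborel. exp (- \<delta> n * a) * (cis (2 * pi * p * a) / (of_real a + s)\<^sup>2)) = 2 * pi * \<i> / v * Kn n" for n
    unfolding s_def Kn_def \<phi>_def h_def by (rule damped_fourier_integral[OF v w \<delta>(1)])
  with lim1 have lim2: "(\<lambda>n. 2 * pi * \<i> / v * Kn n) \<longlonglongrightarrow> fourier_inverse_square p s" by simp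
  define PV where "PV = pv_integral {0..} (p * v) (\<lambda>x. \<phi> x / of_real (x - p * v))"
  have lim3: "Kn \<longlonglongrightarrow> PV + \<i> * pi * of_real ((sgn p + sgn v) / 2) * \<phi> (p * v)"
  proof (cases "p * v > 0")
    case True
    then have sg: "(sgn p + sgn v) / 2 = sgn v"
      by (auto simp: zero_less_mult_iff)
    obtain B where B: "norm (\<phi> x - \<phi> (p * v)) \<le> B * \<bar>x - p * v\<bar>" if "x \<in> {0..2 * (p * v)}" for x
    proof -
      \<comment> \<open>\<phi> extended to complex arguments: a bound for its derivative on a disc
        containing [0, 2 p v] yields the Lipschitz estimate.\<close>
      define F where "F = (\<lambda>x. x * exp (- (2 * pi * w) * x))"
      define F' where "F' = (\<lambda>x. exp (- (2 * pi * w) * x) - 2 * pi * w * x * exp (- (2 * pi * w) * x))"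
      have "compact (F' ` cball 0 (2 * (p * v)))"
        unfolding F'_def by (intro compact_continuous_image continuous_intros compact_cball)
      then obtain B where B: "\<And>x. x \<in> cball 0 (2 * (p * v)) \<Longrightarrow> norm (F' x) \<le> B"
        using compact_imp_bounded bounded_iff by (metis imageI)
      have "norm (F x - F y) \<le> B * norm (x - y)" if "x \<in> cball 0 (2 * (p * v))" "y \<in> cball 0 (2 * (p * v))" for x y
      proof (rule field_differentiable_bound[OF convex_cball _ B that])
        show "(F has_field_derivative F' x) (at x within cball 0 (2 * (p * v)))" for x
          unfolding F_def F'_def by (auto intro!: derivative_eq_intros)
      qed
      then have "norm (F (of_real x) - F (of_real (p * v))) \<le> B * norm (of_real x - complex_of_real (p * v))"
        if "x \<in> {0..2 * (p * v)}" for x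
        using that True by (simp del: of_real_mult)
      moreover have "F (of_real x) = \<phi> x" for x by (simp add: F_def \<phi>_def)
      moreover have "norm (of_real x - complex_of_real (p * v)) = \<bar>x - p * v\<bar>" for x
        by (simp only: of_real_diff[symmetric] norm_of_real)
      ultimately show ?thesis by (intro that[of B]) (simp only:)
    qed
    obtain L where L: "\<And>h. (\<And>n. h n \<noteq> 0) \<Longrightarrow> h \<longlonglongrightarrow> 0 \<Longrightarrow> (\<And>n. sgn (h n) = sgn v) \<Longrightarrow>
       (\<lambda>n. LINT x:{0..}|lborel. \<phi> x / (of_real (x - p * v) - \<i> * of_real (h n))) \<longlonglongrightarrow> L + \<i> * pi * of_real (sgn v) * \<phi> (p * v)"
       "pv_integral {0..} (p * v) (\<lambda>x. \<phi> x / of_real (x - p * v)) = L"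
      using plemelj[OF True int cont B, where \<sigma> = "sgn v"] by blast
    show ?thesis using L(1)[OF h(1) h0 h(2)] unfolding sg Kn_def PV_def L(2) .
  next
    case False
    then have neg: "p * v < 0" using p v by (simp add: not_less le_less)
    then have sg: "sgn p + sgn v = 0" by (auto simp: mult_less_0_iff)
    define N where "N = p * v"
    have N: "N < 0" using neg by (simp add: N_def)
    \<comment> \<open>For eps < - N the deleted interval around N lies to the left of 0, so it
      removes nothing from the half-line.\<close>
    have "PV = (LINT x:{0..}|lborel. \<phi> x / of_real (x - N))"
      unfolding PV_def pv_integral_def N_def[symmetric]
    proof (rule tendsto_Lim)
      have "\<forall>\<^sub>F \<epsilon> in at_right (0::real). \<epsilon> < - N"
        using N by (intro order_tendstoD(2)[OF tendsto_ident_at]) auto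
      then have "\<forall>\<^sub>F \<epsilon> in at_right (0::real). (LINT x:{0..} - {N - \<epsilon><..<N + \<epsilon>}|lborel. \<phi> x / of_real (x - N)) = (LINT x:{0..}|lborel. \<phi> x / of_real (x - N))"
      proof eventually_elim
        case (elim \<epsilon>)
        then have "{0..} - {N - \<epsilon><..<N + \<epsilon>} = {0..}" by auto
        then show ?case by simp
      qed
      then show "((\<lambda>\<epsilon>. LINT x:{0..} - {N - \<epsilon><..<N + \<epsilon>}|lborel. \<phi> x / of_real (x - N)) \<longlongrightarrow> (LINT x:{0..}|lborel. \<phi> x / of_real (x - N))) (at_right 0)"
        by (rule tendsto_eventually)
    qed simp
    moreover have "Kn \<longlonglongrightarrow> (LINT x:{0..}|lborel. \<phi> x / of_real (x - N))"
      unfolding Kn_def N_def[symmetric] set_lebesgue_integral_def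
    proof (rule integral_dominated_convergence)
      have [measurable]: "\<phi> \<in> borel_measurable borel"
        using cont by (rule borel_measurable_continuous_onI)
      show "integrable lborel (\<lambda>x. norm (indicator {0..} x *\<^sub>R \<phi> x) / - N)"
        using int unfolding set_integrable_def by (intro Bochner_Integration.integrable_divide integrable_norm)
      show "(\<lambda>x. indicator {0..} x *\<^sub>R (\<phi> x / of_real (x - N))) \<in> borel_measurable lborel" by measurable
      show "(\<lambda>x. indicator {0..} x *\<^sub>R (\<phi> x / (of_real (x - N) - \<i> * of_real (h n)))) \<in> borel_measurable lborel" for n by measurable
      show "AE x in lborel. (\<lambda>n. indicator {0..} x *\<^sub>R (\<phi> x / (of_real (x - N) - \<i> * of_real (h n)))) \<longlonglongrightarrow> indicator {0..} x *\<^sub>R (\<phi> x / of_real (x - N))"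
      proof (rule AE_I2)
        fix x :: real
        show "(\<lambda>n. indicator {0..} x *\<^sub>R (\<phi> x / (of_real (x - N) - \<i> * of_real (h n)))) \<longlonglongrightarrow> indicator {0..} x *\<^sub>R (\<phi> x / of_real (x - N))"
        proof (cases "x \<ge> 0")
          case True
          then have "x - N \<noteq> 0" using N by simp
          then have nz: "complex_of_real (x - N) - \<i> * of_real 0 \<noteq> 0" by (simp add: complex_eq_iff)
          have "(\<lambda>n. indicator {0..} x *\<^sub>R (\<phi> x / (of_real (x - N) - \<i> * of_real (h n)))) \<longlonglongrightarrow> indicator {0..} x *\<^sub>R (\<phi> x / (of_real (x - N) - \<i> * of_real 0))"
            by (intro tendsto_intros h0 nz)
          then show ?thesis by simp
        qed simp
      qed
      show "AE x in lborel. norm (indicator {0..} x *\<^sub>R (\<phi> x / (of_real (x - N) - \<i> * of_real (h n)))) \<le> norm (indicator {0..} x *\<^sub>R \<phi> x) / - N" for n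
      proof (rule AE_I2)
        fix x :: real
        show "norm (indicator {0..} x *\<^sub>R (\<phi> x / (of_real (x - N) - \<i> * of_real (h n)))) \<le> norm (indicator {0..} x *\<^sub>R \<phi> x) / - N"
        proof (cases "x \<ge> 0")
          case True
          have "- N \<le> \<bar>x - N\<bar>" using True N by simp
          also have "\<dots> \<le> norm (of_real (x - N) - \<i> * of_real (h n))"
            using abs_Re_le_cmod[of "of_real (x - N) - \<i> * of_real (h n)"] by simp
          finally have "norm (\<phi> x) / norm (of_real (x - N) - \<i> * of_real (h n)) \<le> norm (\<phi> x) / - N"
            using N by (intro divide_left_mono mult_pos_pos) auto
          then show ?thesis using True by (simp add: norm_divide)
        qed simp
      qed
    qed
    ultimately show ?thesis by (simp add: sg)
  qed
  have "fourier_inverse_square p s = 2 * pi * \<i> / v * (PV + \<i> * pi * of_real ((sgn p + sgn v) / 2) * \<phi> (p * v))"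
    by (rule LIMSEQ_unique[OF lim2]) (intro tendsto_mult tendsto_const lim3)
  also have "\<phi> (p * v) = of_real (p * v) * exp (- (2 * pi * w) * of_real (p * v))"
    by (simp add: \<phi>_def)
  finally have F: "fourier_inverse_square p s = 2 * pi * \<i> / v * (PV + \<i> * pi * of_real ((sgn p + sgn v) / 2) * (of_real (p * v) * exp (- (2 * pi * w) * of_real (p * v))))" .
  \<comment> \<open>Origin of the 1/4 in \<open>f_series\<close>: the residue carries 2 pi i / v
    times i pi p v / 2, that is - pi^2 p, against the prefactor - 1/(4 pi^2 p).\<close>
  have alg: "\<sigma> / 4 * E + 1 / (2 * pi * \<i> * (p * v)) * PV = - 1 / (4 * pi\<^sup>2 * p) * (2 * pi * \<i> / v * (PV + \<i> * pi * (\<sigma> / 2) * (p * v * E)))" for \<sigma> E :: complex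
    using p v by (simp add: field_simps power2_eq_square)
  show ?thesis
    unfolding s_def[symmetric] F PV_def[symmetric] \<phi>_def[symmetric]
    using alg[of "of_real (sgn p + sgn v)" "exp (- (2 * pi * w) * of_real (p * v))"]
    by (simp add: PV_def \<phi>_def)
qed

section \<open>Lambert series over residue classes\<close>

lemma exp_eq_1_multiple:
  assumes "exp (- (2 * pi * \<i> * of_int b / of_nat k)) = 1" "k > 0"
  shows "int k dvd b"
proof -
  obtain n :: int where "- (2 * pi * of_int b / of_nat k) = of_int (2 * n) * pi"
    using assms(1) by (auto simp: exp_eq_1)
  then have "pi * real_of_int b = pi * (- real k * of_int n)" using assms(2) by (simp add: field_simps)
  then have "real_of_int b = - real k * of_int n" using mult_left_cancel[OF pi_neq_zero] by blast
  then have "b = - int k * n" by (metis of_int_eq_iff of_int_minus of_int_mult of_int_of_nat_eq)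
  then show ?thesis by simp
qed

lemma norm_exp_gt_1: "Re s > 0 \<Longrightarrow> norm (exp s) > 1"
  by simp

lemma residue_class_bij:
  assumes "k > 0"
  shows "bij_betw (\<lambda>n. b - int k * n) UNIV {m. int k dvd m - b}"
proof (rule bij_betwI')
  show "(b - int k * x = b - int k * y) = (x = y)" for x y using assms by simp
  show "b - int k * x \<in> {m. int k dvd m - b}" for x by simp
  show "\<exists>x\<in>UNIV. y = b - int k * x" if "y \<in> {m. int k dvd m - b}" for y
  proof -
    have "int k dvd y - b" using that by simp
    then obtain c where "y - b = int k * c" by (rule dvdE)
    then show ?thesis by (intro bexI[of _ "- c"]) auto
  qed
qed

text \<open>The expansions at x and at 0 are subtracted: the terms 1/(2 pi i n) and the constant 1/2
  drop out, and the missing index n = 0 is supplied by 1/s1 and 1/s0. Index n corresponds to the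
  pole number m = b - k n. Since k does not divide b, the value g 0 is finite and m = 0 does not
  occur.\<close>

lemma partial_fractions_class:
  fixes Z :: complex and k :: nat and b :: int and x :: real
  defines "s \<equiv> \<lambda>m::int. - \<i> * of_real (of_int m / of_nat k) * (1 / Z)"
    and "g \<equiv> \<lambda>x::real. 1 / (exp (2 * pi * of_real x * Z - 2 * pi * \<i> * of_int b / of_nat k) - 1)"
  assumes Z: "Re Z > 0" and k: "k > 0" and b: "\<not> int k dvd b" and x: "x \<ge> 0"
  shows "((\<lambda>m. 1 / (of_real x + s m) - 1 / s m) has_sum 2 * pi * Z * (g x - g 0)) {m. m \<noteq> 0 \<and> int k dvd m - b}"
proof -
  have Z0: "Z \<noteq> 0" using Z by auto
  define s1 where "s1 = 2 * pi * of_real x * Z - 2 * pi * \<i> * of_int b / of_nat k"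
  define s0 where "s0 = - (2 * pi * \<i> * of_int b / of_nat k)"
  have e0: "exp s0 \<noteq> 1" using exp_eq_1_multiple[of b k] b k by (auto simp: s0_def)
  have e1: "exp s1 \<noteq> 1"
  proof (cases "x = 0")
    case True
    then show ?thesis using e0 by (simp add: s1_def s0_def)
  next
    case False
    then have "Re s1 > 0" using x Z by (simp add: s1_def)
    then have "norm (exp s1) > 1" by (rule norm_exp_gt_1)
    then show ?thesis by (metis less_irrefl norm_one)
  qed
  define f where "f = (\<lambda>n::int. 1 / (s1 + 2 * pi * \<i> * of_int n) - 1 / (s0 + 2 * pi * \<i> * of_int n))"
  have "(f has_sum (1 / (exp s1 - 1) - 1 / s1 + 1/2) - (1 / (exp s0 - 1) - 1 / s0 + 1/2)) nonzero_ints"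
    using has_sum_minus_fun[OF exp_partial_fractions[OF e1] exp_partial_fractions[OF e0]]
    by (simp add: f_def)
  then have "(f has_sum f 0 + ((1 / (exp s1 - 1) - 1 / s1 + 1/2) - (1 / (exp s0 - 1) - 1 / s0 + 1/2))) (insert 0 nonzero_ints)"
    by (intro has_sum_insert) auto
  moreover have "insert 0 nonzero_ints = UNIV" by auto
  moreover have "f 0 + ((1 / (exp s1 - 1) - 1 / s1 + 1/2) - (1 / (exp s0 - 1) - 1 / s0 + 1/2)) = g x - g 0"
    by (simp add: f_def g_def s1_def s0_def)
  ultimately have "(f has_sum (g x - g 0)) UNIV" by simp
  then have f: "((\<lambda>n. 2 * pi * Z * f n) has_sum 2 * pi * Z * (g x - g 0)) UNIV" by (rule has_sum_cmult_right)
  have fs: "2 * pi * Z * f n = 1 / (of_real x + s (b - int k * n)) - 1 / s (b - int k * n)" for n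
  proof -
    have "s1 + 2 * pi * \<i> * of_int n = 2 * pi * Z * (of_real x + s (b - int k * n))"
      using k Z0 by (simp add: s1_def s_def field_simps)
    moreover have "s0 + 2 * pi * \<i> * of_int n = 2 * pi * Z * s (b - int k * n)"
      using k Z0 by (simp add: s0_def s_def field_simps)
    ultimately have "f n = 1 / (2 * pi * Z) * (1 / (of_real x + s (b - int k * n))) - 1 / (2 * pi * Z) * (1 / s (b - int k * n))"
      by (simp add: f_def)
    then have "f n = 1 / (2 * pi * Z) * (1 / (of_real x + s (b - int k * n)) - 1 / s (b - int k * n))"
      by (simp only: right_diff_distrib)
    then show ?thesis using Z0 by simp
  qed
  have "((\<lambda>m. 1 / (of_real x + s m) - 1 / s m) has_sum 2 * pi * Z * (g x - g 0)) {m. int k dvd m - b}"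
    using f unfolding fs
    by (subst has_sum_reindex_bij_betw[OF residue_class_bij[OF k, of b], symmetric])
  moreover have "{m. int k dvd m - b} = {m. m \<noteq> 0 \<and> int k dvd m - b}" using b by auto
  ultimately show ?thesis by simp
qed

text \<open>Here m = 0 belongs to the residue class; its pole at x = 0 is the term 1/(2 pi x Z) that
  is split off. There is no finite value at 0 to compare with, and the constant 1/2 takes its place.
  At x = 0 every summand of the series is 0.\<close>

lemma partial_fractions_zero_class:
  fixes Z :: complex and k :: nat and b :: int and x :: real
  defines "s \<equiv> \<lambda>m::int. - \<i> * of_real (of_int m / of_nat k) * (1 / Z)"
  assumes Z: "Re Z > 0" and k: "k > 0" and b: "int k dvd b" and x: "x \<ge> 0"
  shows "((\<lambda>m. 1 / (of_real x + s m) - 1 / s m) has_sum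
     (if x = 0 then 0 else 2 * pi * Z * (1 / (exp (2 * pi * of_real x * Z) - 1) - 1 / (2 * pi * of_real x * Z) + 1/2))) {m. m \<noteq> 0 \<and> int k dvd m - b}"
proof (cases "x = 0")
  case False
  have Z0: "Z \<noteq> 0" using Z by auto
  define s1 where "s1 = 2 * pi * of_real x * Z"
  have "Re s1 > 0" using x Z False by (simp add: s1_def)
  then have "norm (exp s1) > 1" by (rule norm_exp_gt_1)
  then have e1: "exp s1 \<noteq> 1" by (metis less_irrefl norm_one)
  define f where "f = (\<lambda>n::int. 1 / (s1 + 2 * pi * \<i> * of_int n) - 1 / (2 * pi * \<i> * of_int n))"
  have "(f has_sum (1 / (exp s1 - 1) - 1 / s1 + 1/2)) nonzero_ints"
    unfolding f_def by (rule exp_partial_fractions[OF e1])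
  then have f: "((\<lambda>n. 2 * pi * Z * f n) has_sum 2 * pi * Z * (1 / (exp s1 - 1) - 1 / s1 + 1/2)) nonzero_ints"
    by (rule has_sum_cmult_right)
  have fs: "2 * pi * Z * f n = 1 / (of_real x + s (0 - int k * n)) - 1 / s (0 - int k * n)" for n
  proof -
    have "s1 + 2 * pi * \<i> * of_int n = 2 * pi * Z * (of_real x + s (0 - int k * n))"
      using k Z0 by (simp add: s1_def s_def field_simps)
    moreover have "2 * pi * \<i> * of_int n = 2 * pi * Z * s (0 - int k * n)"
      using k Z0 by (simp add: s_def field_simps)
    ultimately have "f n = 1 / (2 * pi * Z * (of_real x + s (0 - int k * n))) - 1 / (2 * pi * Z * s (0 - int k * n))"
      unfolding f_def by (simp only:)
    then have "f n = 1 / (2 * pi * Z) * (1 / (of_real x + s (0 - int k * n))) - 1 / (2 * pi * Z) * (1 / s (0 - int k * n))"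
      by (simp only: times_divide_times_eq mult_1_left)
    then have "f n = 1 / (2 * pi * Z) * (1 / (of_real x + s (0 - int k * n)) - 1 / s (0 - int k * n))"
      by (simp only: right_diff_distrib)
    then show ?thesis using Z0 by simp
  qed
  have dvd: "int k dvd m - b \<longleftrightarrow> int k dvd m - 0" for m using b by (simp add: dvd_diff_right_iff dvd_diff_left_iff)
  have "bij_betw (\<lambda>n. 0 - int k * n) nonzero_ints {m. m \<noteq> 0 \<and> int k dvd m - b}"
  proof (rule bij_betwI')
    show "(0 - int k * x = 0 - int k * y) = (x = y)" for x y using k by simp
    show "0 - int k * x \<in> {m. m \<noteq> 0 \<and> int k dvd m - b}" if "x \<in> nonzero_ints" for x
      unfolding dvd using that k by simp
    show "\<exists>x\<in>nonzero_ints. y = 0 - int k * x" if "y \<in> {m. m \<noteq> 0 \<and> int k dvd m - b}" for y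
    proof -
      have "int k dvd y" "y \<noteq> 0" using that unfolding dvd by auto
      then obtain c where "y = int k * c" "y \<noteq> 0" by (auto elim!: dvdE)
      then show ?thesis by (intro bexI[of _ "- c"]) auto
    qed
  qed
  from has_sum_reindex_bij_betw[OF this, of "\<lambda>m. 1 / (of_real x + s m) - 1 / s m"] f[unfolded fs] False
  show ?thesis by (simp add: s1_def)
qed simp

section \<open>Limit of the sums over one residue class\<close>

lemma exp_minus_tendsto_zero:
  fixes Z c :: complex
  assumes "Re Z > 0"
  shows "(\<lambda>N. exp (- (2 * pi * of_nat N * Z - c))) \<longlonglongrightarrow> 0"
proof (rule Lim_null_comparison)
  show "\<forall>\<^sub>F N in sequentially. norm (exp (- (2 * pi * of_nat N * Z - c))) \<le> exp (Re c) * exp (- (2 * pi * Re Z) * real N)"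
    by (auto simp: exp_add[symmetric] algebra_simps)
  have "(\<lambda>N. exp (Re c) * exp (- d * real N)) \<longlonglongrightarrow> 0" if "d > 0" for d
    using that by real_asymp
  then show "(\<lambda>N. exp (Re c) * exp (- (2 * pi * Re Z) * real N)) \<longlonglongrightarrow> 0"
    using assms by simp
qed

text \<open>Keeps Ln(1 - E) off its branch cut: the disc of radius 1 about 1 meets the imaginary
  axis only at 0, the excluded point.\<close>

lemma Re_one_minus_pos:
  assumes "norm E \<le> 1" "E \<noteq> 1"
  shows "Re (1 - E) > 0"
proof -
  have "Re E \<le> 1" using complex_Re_le_cmod[of E] assms(1) by linarith
  moreover have "Re E \<noteq> 1"
  proof
    assume r: "Re E = 1"
    have "(norm E)\<^sup>2 \<le> 1" using assms(1) by (simp add: power_le_one)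
    then have "Im E = 0" using r by (simp add: cmod_power2)
    with r have "E = 1" by (simp add: complex_eq_iff)
    with assms(2) show False by simp
  qed
  ultimately show ?thesis by simp
qed

text \<open>Take U = 2 pi Z (g - g 0) in \<open>reciprocal_series_limit\<close>. As g has the
  antiderivative Ln(1 - e^{- \<theta>}) / (2 pi Z), which tends to 0 at infinity, the integral
  leaves only the logarithm at x = 0. The terms N g 0 of the sum and of the integral cancel.\<close>

lemma lambert_class_limit:
  fixes Z :: complex and k :: nat and b :: int and a :: real
  defines "s \<equiv> \<lambda>m::int. - \<i> * of_real (of_int m / of_nat k) * (1 / Z)"
    and "g \<equiv> \<lambda>x::real. 1 / (exp (2 * pi * of_real x * Z - 2 * pi * \<i> * of_int b / of_nat k) - 1)"
  assumes Z: "Re Z > 0" and k: "k > 0" and b: "\<not> int k dvd b" and a: "0 \<le> a" "a \<le> 1"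
  defines "term \<equiv> \<lambda>(m, n). cis (- 2 * pi * of_int n * a) / of_real ((2 * pi * of_int n)\<^sup>2) *
            (- 2 * pi * \<i> * of_int n * fourier_inverse_square (of_int n) (s m))"
  shows "(\<lambda>N. \<Sum>j<N. g (a + real j)) \<longlonglongrightarrow>
     (\<Sum>\<^sub>\<infinity>p\<in>{m. m \<noteq> 0 \<and> int k dvd m - b} \<times> nonzero_ints. term p) / (2 * pi * Z)
      - Ln (1 - exp (2 * pi * \<i> * of_int b / of_nat k)) / (2 * pi * Z) - of_real (a - 1/2) * g 0"
proof -
  define c where "c = 2 * pi * \<i> * of_int b / of_nat k"
  define \<theta> where "\<theta> = (\<lambda>x::real. 2 * pi * of_real x * Z - c)"
  have gth: "g x = 1 / (exp (\<theta> x) - 1)" for x by (simp add: g_def \<theta>_def c_def)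
  have Z0: "Z \<noteq> 0" using Z by auto
  have W: "Re (1 / Z) > 0" using Z by (auto simp: Re_divide intro!: divide_pos_pos add_pos_nonneg)
  define U where "U = (\<lambda>x::real. 2 * pi * Z * (g x - g 0))"
  have sub: "{m. m \<noteq> 0 \<and> int k dvd m - b} \<subseteq> nonzero_ints" by auto
  define S where "S = (\<Sum>\<^sub>\<infinity>p\<in>{m. m \<noteq> 0 \<and> int k dvd m - b} \<times> nonzero_ints. term p)"
  have lim: "(\<lambda>N. (\<Sum>j<N. U (a + real j)) - integral {0..real N} U - of_real (a - 1/2) * U (real N)) \<longlonglongrightarrow> S"
    unfolding S_def term_def s_def
    by (rule reciprocal_series_limit(2)[OF W k sub a]) (unfold U_def g_def, rule partial_fractions_class[OF Z k b])
  have ne: "exp (- \<theta> x) \<noteq> 1" and le: "norm (exp (- \<theta> x)) \<le> 1" if "x \<ge> 0" for x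
  proof -
    show "norm (exp (- \<theta> x)) \<le> 1" using that Z by (simp add: \<theta>_def c_def)
    show "exp (- \<theta> x) \<noteq> 1"
    proof (cases "x = 0")
      case True
      have "exp (- (2 * pi * \<i> * of_int (- b) / of_nat k)) \<noteq> 1"
        using exp_eq_1_multiple[of "- b" k] b k by auto
      then show ?thesis using True by (simp add: \<theta>_def c_def)
    next
      case False
      then have "norm (exp (- \<theta> x)) < 1" using that Z by (simp add: \<theta>_def c_def)
      then show ?thesis by (metis less_irrefl norm_one)
    qed
  qed
  have geq: "g x = exp (- \<theta> x) / (1 - exp (- \<theta> x))" for x
    unfolding gth by (simp add: exp_minus divide_simps)
  define P where "P = (\<lambda>x. Ln (1 - exp (- \<theta> x)) / (2 * pi * Z))"
  have gint: "(g has_integral (P N - P 0)) {0..N}" if "N \<ge> 0" for N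
  proof (rule fundamental_theorem_of_calculus)
    fix x assume x: "x \<in> {0..N}"
    have nn: "1 - exp (- \<theta> x) \<notin> \<real>\<^sub>\<le>\<^sub>0"
      using Re_one_minus_pos[OF le ne, of x] x by (auto simp: complex_nonpos_Reals_iff)
    have "((\<lambda>u. Ln (1 - exp (- (2 * pi * u * Z - c))) / (2 * pi * Z)) has_field_derivative g x) (at (of_real x))"
      using nn Z0 unfolding geq by (auto intro!: derivative_eq_intros simp: \<theta>_def) (simp only: divide_inverse mult.commute)
    from has_vector_derivative_real_field[OF this, of "{0..N}"]
    show "(P has_vector_derivative g x) (at x within {0..N})"
      by (simp add: P_def \<theta>_def)
  qed (use that in auto)
  have Uint: "integral {0..real N} U = 2 * pi * Z * (P (real N) - P 0 - of_nat N * g 0)" for N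
  proof -
    have "(U has_integral (2 * pi * Z * (P (real N) - P 0 - (real N - 0) *\<^sub>R g 0))) {0..real N}"
      unfolding U_def using has_integral_const_real[of "g 0" 0 "real N"]
      by (intro has_integral_mult_right has_integral_diff gint) auto
    then show ?thesis by (simp add: integral_unique scaleR_conv_of_real)
  qed
  have Usum: "(\<Sum>j<N. U (a + real j)) = 2 * pi * Z * ((\<Sum>j<N. g (a + real j)) - of_nat N * g 0)" for N
    by (simp add: U_def sum_distrib_left[symmetric] sum_subtractf)
  have e0: "(\<lambda>N. exp (- \<theta> (real N))) \<longlonglongrightarrow> 0"
    using exp_minus_tendsto_zero[OF Z, of c] by (simp add: \<theta>_def)
  have P0: "(\<lambda>N. P (real N)) \<longlonglongrightarrow> 0"
  proof -
    have "(\<lambda>N. P (real N)) \<longlonglongrightarrow> Ln (1 - 0) / (2 * pi * Z)"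
      unfolding P_def using Z0 by (intro tendsto_intros e0) auto
    then show ?thesis by simp
  qed
  have g0: "(\<lambda>N. g (real N)) \<longlonglongrightarrow> 0"
  proof -
    have "(\<lambda>N. g (real N)) \<longlonglongrightarrow> 0 / (1 - 0)"
      unfolding geq by (intro tendsto_intros e0) auto
    then show ?thesis by simp
  qed
  have "(\<lambda>N. ((\<Sum>j<N. U (a + real j)) - integral {0..real N} U - of_real (a - 1/2) * U (real N)) / (2 * pi * Z)
         + (P (real N) - P 0) + of_real (a - 1/2) * (g (real N) - g 0)) \<longlonglongrightarrow>
     S / (2 * pi * Z) + (0 - P 0) + of_real (a - 1/2) * (0 - g 0)"
    using Z0 by (intro tendsto_intros lim P0 g0) auto
  moreover have "((\<Sum>j<N. U (a + real j)) - integral {0..real N} U - of_real (a - 1/2) * U (real N)) / (2 * pi * Z)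
         + (P (real N) - P 0) + of_real (a - 1/2) * (g (real N) - g 0) = (\<Sum>j<N. g (a + real j))" for N
  proof -
    have "(\<Sum>j<N. U (a + real j)) - integral {0..real N} U - of_real (a - 1/2) * U (real N) =
        2 * pi * Z * ((\<Sum>j<N. g (a + real j)) - (P (real N) - P 0) - of_real (a - 1/2) * (g (real N) - g 0))"
      unfolding Usum Uint unfolding U_def by (simp add: algebra_simps)
    then show ?thesis using Z0 by simp
  qed
  ultimately show ?thesis
    by (simp add: S_def P_def \<theta>_def c_def)
qed

text \<open>Here the summand has the pole \<open>1 / (2 \<pi> x Z)\<close> at \<open>x = 0\<close>; the sum of its values diverges
  logarithmically and is the source of the digamma term.\<close>

lemma lambert_zero_class_limit:
  fixes Z :: complex and k :: nat and b :: int and a :: real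
  defines "s \<equiv> \<lambda>m::int. - \<i> * of_real (of_int m / of_nat k) * (1 / Z)"
    and "g \<equiv> \<lambda>x::real. 1 / (exp (2 * pi * of_real x * Z) - 1)"
  assumes Z: "Re Z > 0" and k: "k > 0" and b: "int k dvd b" and a: "0 < a" "a \<le> 1"
  defines "term \<equiv> \<lambda>(m, n). cis (- 2 * pi * of_int n * a) / of_real ((2 * pi * of_int n)\<^sup>2) *
            (- 2 * pi * \<i> * of_int n * fourier_inverse_square (of_int n) (s m))"
  shows "(\<lambda>N. \<Sum>j<N. g (a + real j)) \<longlonglongrightarrow>
     (\<Sum>\<^sub>\<infinity>p\<in>{m. m \<noteq> 0 \<and> int k dvd m - b} \<times> nonzero_ints. term p) / (2 * pi * Z)
      - (Ln (2 * pi * Z) + of_real (Digamma a)) / (2 * pi * Z) + of_real (a - 1/2) / 2"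
proof -
  have Z0: "Z \<noteq> 0" using Z by auto
  have W: "Re (1 / Z) > 0" using Z by (auto simp: Re_divide intro!: divide_pos_pos add_pos_nonneg)
  define \<kappa> where "\<kappa> = 2 * pi * Z"
  have \<kappa>: "Re \<kappa> > 0" "\<kappa> \<noteq> 0" using Z by (auto simp: \<kappa>_def)
  have g\<kappa>: "g x = 1 / (exp (\<kappa> * of_real x) - 1)" for x by (simp add: g_def \<kappa>_def mult_ac)
  define U where "U = (\<lambda>x::real. if x = 0 then 0 else \<kappa> * (g x - 1 / (\<kappa> * of_real x) + 1/2))"
  have sub: "{m. m \<noteq> 0 \<and> int k dvd m - b} \<subseteq> nonzero_ints" by auto
  define S where "S = (\<Sum>\<^sub>\<infinity>p\<in>{m. m \<noteq> 0 \<and> int k dvd m - b} \<times> nonzero_ints. term p)"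
  have U: "((\<lambda>m. 1 / (of_real x + s m) - 1 / s m) has_sum U x) {m. m \<noteq> 0 \<and> int k dvd m - b}" if "x \<ge> 0" for x
  proof -
    have "U x = (if x = 0 then 0 else 2 * pi * Z * (1 / (exp (2 * pi * of_real x * Z) - 1) - 1 / (2 * pi * of_real x * Z) + 1/2))"
      by (simp add: U_def g_def \<kappa>_def mult_ac)
    then show ?thesis unfolding s_def using partial_fractions_zero_class[OF Z k b that] by (simp only:)
  qed
  have lim: "(\<lambda>N. (\<Sum>j<N. U (a + real j)) - integral {0..real N} U - of_real (a - 1/2) * U (real N)) \<longlonglongrightarrow> S"
    unfolding S_def term_def s_def
    by (rule reciprocal_series_limit(2)[OF W k sub _ a(2)]) (use a U in \<open>auto simp: s_def\<close>)
  define E where "E = (\<lambda>x::real. exp (- (\<kappa> * of_real x)))"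
  have ER: "Re (1 - E x) > 0" if "x > 0" for x
  proof (rule Re_one_minus_pos)
    have lt: "norm (E x) < 1" using that \<kappa> by (simp add: E_def)
    then show "norm (E x) \<le> 1" by simp
    show "E x \<noteq> 1" using lt by (metis less_irrefl norm_one)
  qed
  have geq: "g x = E x / (1 - E x)" for x
    unfolding g\<kappa> E_def by (simp add: exp_minus divide_simps)
  \<comment> \<open>Antiderivatives of both singular terms of U are joined in Ln((1 - e^{- \<kappa>
    x}) / x), where the logarithmic singularities at 0 cancel. The value \<kappa> at 0 makes q
    continuous, and Re q > 0 keeps Ln off its cut. P 0 = Ln \<kappa> is the origin of Ln(2 pi
    Z).\<close>
  define q where "q = (\<lambda>x::real. if x = 0 then \<kappa> else (1 - E x) / of_real x)"
  have qR: "Re (q x) > 0" if "x \<ge> 0" for x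
    using ER[of x] \<kappa> that by (simp add: q_def Re_divide_of_real)
  have qn: "q x \<notin> \<real>\<^sub>\<le>\<^sub>0" if "x \<ge> 0" for x
    using qR[OF that] by (auto simp: complex_nonpos_Reals_iff)
  have qd: "((\<lambda>u. (1 - exp (- (\<kappa> * u))) / u) has_field_derivative \<kappa> * E x / of_real x - (1 - E x) / (of_real x)\<^sup>2) (at (of_real x))" if "x > 0" for x
    using that by (auto intro!: derivative_eq_intros simp: E_def field_simps power2_eq_square)
  have q0: "((\<lambda>x. (1 - E x) / of_real x) \<longlongrightarrow> \<kappa>) (at 0)"
  proof -
    have "((\<lambda>u. 1 - exp (- (\<kappa> * u))) has_field_derivative \<kappa>) (at 0)"
      by (auto intro!: derivative_eq_intros)
    then have "((\<lambda>u. (1 - exp (- (\<kappa> * u))) / u) \<longlongrightarrow> \<kappa>) (at 0)"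
      by (simp add: has_field_derivative_iff)
    moreover have "filterlim complex_of_real (at 0) (at 0)"
      by (auto simp: filterlim_at eventually_at_filter intro!: tendsto_eq_intros)
    ultimately show ?thesis unfolding E_def by (rule filterlim_compose)
  qed
  define P where "P = (\<lambda>x. Ln (q x) + \<kappa> / 2 * of_real x)"
  have Pc: "continuous_on {0..real N} P" for N
  proof -
    have "continuous (at x within {0..real N}) q" if "x \<in> {0..real N}" for x
    proof (cases "x = 0")
      case True
      have "(q \<longlongrightarrow> \<kappa>) (at 0)"
        by (rule Lim_transform_eventually[OF q0]) (auto simp: q_def eventually_at_filter)
      then have "isCont q 0" by (simp add: isCont_def q_def)
      then show ?thesis unfolding True by (rule continuous_at_imp_continuous_at_within)
    next
      case False
      have "\<forall>\<^sub>F y in nhds x. y \<noteq> 0" using False by (intro t1_space_nhds) auto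
      then have "\<forall>\<^sub>F y in nhds x. q y = (1 - E y) / of_real y"
        by eventually_elim (simp add: q_def)
      moreover have "isCont (\<lambda>y. (1 - E y) / complex_of_real y) x"
        using False unfolding E_def by (intro continuous_intros) auto
      ultimately have "isCont q x" by (subst isCont_cong)
      then show ?thesis by (rule continuous_at_imp_continuous_at_within)
    qed
    then have "continuous_on {0..real N} q" by (simp add: continuous_on_eq_continuous_within)
    then show ?thesis unfolding P_def by (intro continuous_intros) (use qn in auto)
  qed
  have Pd: "(P has_vector_derivative U x) (at x)" if x: "x > 0" for x
  proof -
    have A: "1 - E x \<noteq> 0" using ER[OF x] by auto
    have "((\<lambda>u. Ln ((1 - exp (- (\<kappa> * u))) / u) + \<kappa> / 2 * u) has_field_derivative
        (\<kappa> * E x / of_real x - (1 - E x) / (of_real x)\<^sup>2) / q x + \<kappa> / 2) (at (of_real x))"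
    proof -
      have "q x = (1 - exp (- (\<kappa> * of_real x))) / of_real x" using x by (simp add: q_def E_def)
      then have "((\<lambda>u. Ln ((1 - exp (- (\<kappa> * u))) / u)) has_field_derivative
          inverse (q x) * (\<kappa> * E x / of_real x - (1 - E x) / (of_real x)\<^sup>2)) (at (of_real x))"
        using DERIV_chain2[where f = Ln and g = "\<lambda>u. (1 - exp (- (\<kappa> * u))) / u" and x = "of_real x", OF has_field_derivative_Ln qd[OF x]] qn[of x] x
        by simp
      moreover have "inverse y * d = d / y" for y d :: complex by (simp add: field_simps)
      ultimately show ?thesis
        by (intro DERIV_add DERIV_cmult_Id) (simp only:)
    qed
    moreover have "(\<kappa> * E x / of_real x - (1 - E x) / (of_real x)\<^sup>2) / q x + \<kappa> / 2 = U x"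
    proof -
      have qx: "q x = (1 - E x) / of_real x" using x by (simp add: q_def)
      have "(\<kappa> * E x / of_real x - (1 - E x) / (of_real x)\<^sup>2) / q x = \<kappa> * E x / (1 - E x) - 1 / of_real x"
      proof -
        have "(c * e / y - d / y\<^sup>2) / (d / y) = c * e / d - 1 / y" if "d \<noteq> 0" "y \<noteq> 0" for c d e y :: complex
          using that by (simp add: field_simps power2_eq_square)
        from this[OF A, of "of_real x"] show ?thesis unfolding qx using x by simp
      qed
      moreover have "U x = \<kappa> * E x / (1 - E x) - \<kappa> * (1 / (\<kappa> * of_real x)) + \<kappa> / 2"
        using x by (simp add: U_def geq ring_distribs)
      ultimately show ?thesis using \<kappa> by simp
    qed
    ultimately have "((\<lambda>u. Ln ((1 - exp (- (\<kappa> * u))) / u) + \<kappa> / 2 * u) has_field_derivative U x) (at (of_real x))"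
      by simp
    from has_vector_derivative_real_field[OF this, of UNIV]
    have "((\<lambda>x. Ln ((1 - E x) / of_real x) + \<kappa> / 2 * of_real x) has_vector_derivative U x) (at x)"
      by (simp add: E_def)
    then show ?thesis
    proof (rule has_vector_derivative_transform_within_open)
      show "open {0::real<..}" "x \<in> {0<..}" using x by auto
    qed (simp add: P_def q_def)
  qed
  \<comment> \<open>Only continuity of P is available at the endpoint 0, hence the interior form of
    the fundamental theorem.\<close>
  have Uint: "integral {0..real N} U = P (real N) - P 0" for N
    by (rule integral_unique, rule fundamental_theorem_of_calculus_interior) (auto intro: Pc Pd)
  have Usum: "(\<Sum>j<N. U (a + real j)) = \<kappa> * (\<Sum>j<N. g (a + real j)) - of_real (\<Sum>j<N. inverse (a + real j)) + \<kappa> / 2 * of_nat N" for N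
  proof -
    have "U (a + real j) = \<kappa> * g (a + real j) - of_real (inverse (a + real j)) + \<kappa> / 2" for j
    proof -
      have nz: "a + real j \<noteq> 0" using a by (simp add: add_nonneg_eq_0_iff)
      have "U (a + real j) = \<kappa> * g (a + real j) - \<kappa> * (1 / (\<kappa> * of_real (a + real j))) + \<kappa> / 2"
        using nz by (simp add: U_def ring_distribs)
      also have "\<kappa> * (1 / (\<kappa> * of_real (a + real j))) = of_real (inverse (a + real j))"
        using \<kappa> nz by (simp add: inverse_eq_divide)
      finally show ?thesis .
    qed
    then show ?thesis by (simp add: sum.distrib sum_subtractf sum_distrib_left)
  qed
  have e0: "(\<lambda>N. E (real N)) \<longlonglongrightarrow> 0"
    using exp_minus_tendsto_zero[OF Z, of 0] by (simp add: E_def \<kappa>_def mult_ac)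
  have L0: "(\<lambda>N. Ln (1 - E (real N))) \<longlonglongrightarrow> 0"
  proof -
    have "(\<lambda>N. Ln (1 - E (real N))) \<longlonglongrightarrow> Ln (1 - 0)"
      by (intro tendsto_intros e0) auto
    then show ?thesis by simp
  qed
  have g0: "(\<lambda>N. g (real N)) \<longlonglongrightarrow> 0"
  proof -
    have "(\<lambda>N. g (real N)) \<longlonglongrightarrow> 0 / (1 - 0)"
      unfolding geq by (intro tendsto_intros e0) auto
    then show ?thesis by simp
  qed
  \<comment> \<open>The constant 1/2 of the zero class survives at infinity; after division by
    \<kappa> it yields the term (a - 1/2)/2.\<close>
  have U0: "(\<lambda>N. U (real N)) \<longlonglongrightarrow> \<kappa> / 2"
  proof -
    have inv: "(\<lambda>N. complex_of_real (inverse (real N))) \<longlonglongrightarrow> of_real 0"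
      by (intro tendsto_of_real lim_inverse_n)
    have "(\<lambda>N. \<kappa> * g (real N) - of_real (inverse (real N)) + \<kappa> / 2) \<longlonglongrightarrow> \<kappa> * 0 - of_real 0 + \<kappa> / 2"
      by (intro tendsto_add tendsto_diff tendsto_mult tendsto_const g0 inv)
    moreover have "\<forall>\<^sub>F N in sequentially. \<kappa> * g (real N) - of_real (inverse (real N)) + \<kappa> / 2 = U (real N)"
      using eventually_gt_at_top[of 0] 
    proof eventually_elim
      case (elim N)
      have "U (real N) = \<kappa> * g (real N) - \<kappa> * (1 / (\<kappa> * of_real (real N))) + \<kappa> / 2"
        using elim by (simp add: U_def ring_distribs)
      also have "\<kappa> * (1 / (\<kappa> * of_real (real N))) = of_real (inverse (real N))"
        using \<kappa> elim by (simp add: inverse_eq_divide)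
      finally show ?case by simp
    qed
    ultimately show ?thesis by (simp add: Lim_transform_eventually)
  qed
  \<comment> \<open>The ln N is the logarithm of the denominator of q N; it compensates the
    divergence of the sum over 1/(a + j), which comes from the pole of \<open>g\<close>.\<close>
  have D: "(\<lambda>N. ln (real N) - (\<Sum>j<N. inverse (a + real j))) \<longlonglongrightarrow> Digamma a"
    using Digamma_LIMSEQ[of a] a by simp
  define T where "T = (\<lambda>N. ((\<Sum>j<N. U (a + real j)) - integral {0..real N} U - of_real (a - 1/2) * U (real N)))"
  have "(\<lambda>N. (T N + of_real (a - 1/2) * U (real N) + Ln (1 - E (real N)) - Ln \<kappa> - of_real (ln (real N) - (\<Sum>j<N. inverse (a + real j)))) / \<kappa>) \<longlonglongrightarrow>
     (S + of_real (a - 1/2) * (\<kappa> / 2) + 0 - Ln \<kappa> - of_real (Digamma a)) / \<kappa>"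
    unfolding T_def using \<kappa> by (intro tendsto_intros lim U0 L0 D) auto
  moreover have "\<forall>\<^sub>F N in sequentially. (T N + of_real (a - 1/2) * U (real N) + Ln (1 - E (real N)) - Ln \<kappa> - of_real (ln (real N) - (\<Sum>j<N. inverse (a + real j)))) / \<kappa>
     = (\<Sum>j<N. g (a + real j))"
    using eventually_gt_at_top[of 0]
  proof eventually_elim
    case (elim N)
    have nz: "1 - E (real N) \<noteq> 0" using ER[of "real N"] elim by auto
    have "Ln (q (real N)) = Ln (1 - E (real N)) - of_real (ln (real N))"
      using elim nz Ln_divide_of_real[of "real N" "1 - E (real N)"] by (simp add: q_def)
    then have "T N + of_real (a - 1/2) * U (real N) + Ln (1 - E (real N)) - Ln \<kappa> - of_real (ln (real N) - (\<Sum>j<N. inverse (a + real j))) = \<kappa> * (\<Sum>j<N. g (a + real j))"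
      unfolding T_def Usum Uint P_def by (simp add: q_def)
    then show ?case using \<kappa> by simp
  qed
  ultimately have "(\<lambda>N. \<Sum>j<N. g (a + real j)) \<longlonglongrightarrow> (S + of_real (a - 1/2) * (\<kappa> / 2) + 0 - Ln \<kappa> - of_real (Digamma a)) / \<kappa>"
    by (rule Lim_transform_eventually)
  also have "(S + of_real (a - 1/2) * (\<kappa> / 2) + 0 - Ln \<kappa> - of_real (Digamma a)) / \<kappa> =
      S / \<kappa> - (Ln \<kappa> + of_real (Digamma a)) / \<kappa> + of_real (a - 1/2) / 2"
    using \<kappa> by (simp add: add_divide_distrib diff_divide_distrib)
  finally show ?thesis unfolding S_def \<kappa>_def .
qed

section \<open>The series F and the counting constant\<close>

text \<open>The decomposition is m = R (l + k j) + r. With r between 1 and R, every positive m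
  congruent to r modulo R is at least r, so the subtraction m - r of natural numbers is
  exact.\<close>

lemma residue_class_decomposition:
  assumes R: "R \<ge> 1" and r: "r \<in> {1..R}" and k: "k > (0::nat)"
  shows "bij_betw (\<lambda>(l, j). R * l + r + R * k * j) ({0..k - 1} \<times> UNIV) {m. m \<ge> 1 \<and> [m = r] (mod R)}"
proof (rule bij_betwI[where g = "\<lambda>m. (((m - r) div R) mod k, (m - r) div R div k)"])
  show "(\<lambda>(l, j). R * l + r + R * k * j) \<in> {0..k - 1} \<times> UNIV \<rightarrow> {m. m \<ge> 1 \<and> [m = r] (mod R)}"
    using r by (auto simp: cong_def mult.assoc)
  show "(\<lambda>m. (((m - r) div R) mod k, (m - r) div R div k)) \<in> {m. m \<ge> 1 \<and> [m = r] (mod R)} \<rightarrow> {0..k - 1} \<times> UNIV"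
    using k by (auto simp: less_Suc_eq_le[symmetric])
  show "(\<lambda>m. (((m - r) div R) mod k, (m - r) div R div k)) ((\<lambda>(l, j). R * l + r + R * k * j) p) = p"
    if "p \<in> {0..k - 1} \<times> UNIV" for p
  proof -
    obtain l j where p: "p = (l, j)" by (cases p)
    then have "l < k" using that k by auto
    have "R * l + r + R * k * j - r = R * (l + k * j)" by (simp add: algebra_simps)
    then show ?thesis using p \<open>l < k\<close> R by simp
  qed
  show "(\<lambda>(l, j). R * l + r + R * k * j) ((\<lambda>m. (((m - r) div R) mod k, (m - r) div R div k)) m) = m"
    if "m \<in> {m. m \<ge> 1 \<and> [m = r] (mod R)}" for m
  proof -
    have m: "m \<ge> 1" "[m = r] (mod R)" using that by auto
    have "r \<le> m"
    proof (rule ccontr)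
      assume "\<not> r \<le> m"
      then have "m < r" by simp
      then have "R dvd r - m" using m(2) mod_eq_dvd_iff_nat[of m r R] by (simp add: cong_def)
      moreover have "0 < r - m" "r - m < R" using \<open>m < r\<close> m(1) r by auto
      ultimately show False by (auto dest: dvd_imp_le)
    qed
    then have "R dvd m - r" using m(2) mod_eq_dvd_iff_nat[of r m R] by (simp add: cong_def)
    then obtain t where t: "m - r = R * t" by (rule dvdE)
    have "R * (t mod k) + r + R * k * (t div k) = R * (t mod k + k * (t div k)) + r"
      by (simp only: distrib_left mult.assoc add_ac)
    then show ?thesis using t \<open>r \<le> m\<close> R by simp
  qed
qed

lemma norm_nome: "norm (nome \<tau>) = exp (- 2 * pi * Im \<tau>)"
  by (simp add: nome_def)

text \<open>The hypothesis concerns ordered partial sums. Since |q| < 1, the Lambert series is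
  dominated by |q|^m / (1 - |q|), so the unconditional sum in \<open>F_series\<close> exists and may
  be regrouped into classes.\<close>

lemma F_series_eq_sum:
  assumes R: "R \<ge> 1" and r: "r \<in> {1..R}" and k: "k > (0::nat)" and \<tau>: "Im \<tau> > 0"
    and lim: "\<And>l. l \<in> {0..k - 1} \<Longrightarrow>
       (\<lambda>N. \<Sum>j<N. nome \<tau> ^ (R * l + r + R * k * j) / (1 - nome \<tau> ^ (R * l + r + R * k * j))) \<longlonglongrightarrow> L l"
  shows "F_series R r \<tau> = (\<Sum>l = 0..k - 1. L l)"
proof -
  define q where "q = norm (nome \<tau>)"
  have q: "0 \<le> q" "q < 1" using \<tau> by (simp_all add: q_def norm_nome)
  define G where "G = (\<lambda>m. nome \<tau> ^ m / (1 - nome \<tau> ^ m))"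
  have Gb: "norm (G m) \<le> 1 / (1 - q) * q ^ m" if "m \<ge> 1" for m
  proof -
    have "q ^ m \<le> q ^ 1" using q that by (intro power_decreasing) auto
    moreover have "1 - q ^ m \<le> norm (1 - nome \<tau> ^ m)"
      using norm_triangle_ineq2[of 1 "nome \<tau> ^ m"] by (simp add: q_def norm_power)
    ultimately have "1 - q \<le> norm (1 - nome \<tau> ^ m)" by simp
    then have "q ^ m / norm (1 - nome \<tau> ^ m) \<le> q ^ m / (1 - q)"
      using q by (intro divide_left_mono mult_pos_pos) auto
    then show ?thesis by (simp add: G_def norm_divide norm_power q_def)
  qed
  have "summable (\<lambda>m. 1 / (1 - q) * q ^ m)"
    using q by (intro summable_mult summable_geometric) auto
  then have "(\<lambda>m. 1 / (1 - q) * q ^ m) summable_on UNIV"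
    using q by (subst summable_on_UNIV_nonneg_real_iff) auto
  then have "(\<lambda>m. 1 / (1 - q) * q ^ m) summable_on {m. m \<ge> 1 \<and> [m = r] (mod R)}"
    by (rule summable_on_subset) auto
  then have Gs: "(\<lambda>m. norm (G m)) summable_on {m. m \<ge> 1 \<and> [m = r] (mod R)}"
    by (rule summable_on_comparison_test) (use Gb in auto)
  define \<mu> where "\<mu> = (\<lambda>(l, j). R * l + r + R * k * j)"
  note bij = residue_class_decomposition[OF R r k, folded \<mu>_def]
  have "(\<lambda>p. norm (G (\<mu> p))) summable_on ({0..k - 1} \<times> UNIV)"
    using summable_on_reindex_bij_betw[OF bij, of "\<lambda>m. norm (G m)"] Gs by simp
  then have S: "(\<lambda>p. G (\<mu> p)) summable_on ({0..k - 1} \<times> UNIV)"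
    by (rule abs_summable_summable)
  have "F_series R r \<tau> = infsum G {m. m \<ge> 1 \<and> [m = r] (mod R)}"
    by (simp add: F_series_def G_def)
  also have "\<dots> = (\<Sum>\<^sub>\<infinity>p\<in>{0..k - 1} \<times> UNIV. G (\<mu> p))"
    using infsum_reindex_bij_betw[OF bij, of G] by simp
  also have "\<dots> = (\<Sum>\<^sub>\<infinity>l\<in>{0..k - 1}. \<Sum>\<^sub>\<infinity>j. G (\<mu> (l, j)))"
    by (rule infsum_Sigma_banach[OF S, symmetric])
  also have "\<dots> = (\<Sum>l = 0..k - 1. \<Sum>\<^sub>\<infinity>j. G (\<mu> (l, j)))"
    by simp
  also have "\<dots> = (\<Sum>l = 0..k - 1. L l)"
  proof (rule sum.cong[OF refl])
    fix l assume l: "l \<in> {0..k - 1}"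
    have "(\<lambda>j. G (\<mu> (l, j))) summable_on UNIV"
      using summable_on_SigmaD1[of "\<lambda>l j. G (\<mu> (l, j))" "{0..k - 1}" "\<lambda>_. UNIV" l] S l by (simp add: case_prod_unfold)
    then have "((\<lambda>j. G (\<mu> (l, j))) has_sum (\<Sum>\<^sub>\<infinity>j. G (\<mu> (l, j)))) UNIV" by simp
    then have "(\<lambda>j. G (\<mu> (l, j))) sums (\<Sum>\<^sub>\<infinity>j. G (\<mu> (l, j)))" by (rule has_sum_imp_sums)
    then have "(\<lambda>N. \<Sum>j<N. G (\<mu> (l, j))) \<longlonglongrightarrow> (\<Sum>\<^sub>\<infinity>j. G (\<mu> (l, j)))" by (simp add: sums_def)
    moreover have "(\<lambda>N. \<Sum>j<N. G (\<mu> (l, j))) \<longlonglongrightarrow> L l"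
      using lim[OF l] by (simp add: G_def \<mu>_def)
    ultimately show "(\<Sum>\<^sub>\<infinity>j. G (\<mu> (l, j))) = L l" by (rule LIMSEQ_unique)
  qed
  finally show ?thesis .
qed

text \<open>With x = m / (R k) and Z = R z / k one has m z / k^2 = x Z. In m h / k the part R j h is
  an integer and drops out, which leaves the phase h M / k common to the whole class.\<close>

lemma nome_power_quotient:
  fixes h k R M j :: nat and z :: complex
  assumes k: "k > 0" and R: "R > 0"
  shows "nome (of_nat h / of_nat k + \<i> * z / (of_nat k)\<^sup>2) ^ (M + R * k * j) / (1 - nome (of_nat h / of_nat k + \<i> * z / (of_nat k)\<^sup>2) ^ (M + R * k * j)) =
    1 / (exp (2 * pi * of_real (real M / real (R * k) + real j) * (of_nat R * z / of_nat k) - 2 * pi * \<i> * of_int (int (h * M)) / of_nat k) - 1)"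
proof -
  define m where "m = M + R * k * j"
  define \<tau> where "\<tau> = of_nat h / of_nat k + \<i> * z / (of_nat k)\<^sup>2"
  define y where "y = 2 * pi * of_real (real M / real (R * k) + real j) * (of_nat R * z / of_nat k) - 2 * pi * \<i> * of_int (int (h * M)) / of_nat k"
  have "nome \<tau> ^ m = exp (of_nat m * (2 * pi * \<i> * \<tau>))"
    by (simp add: nome_def exp_of_nat_mult)
  also have "of_nat m * (2 * pi * \<i> * \<tau>) = - y + 2 * complex_of_int (int (h * R * j)) * complex_of_real pi * \<i>"
    using k R by (simp add: y_def \<tau>_def m_def field_simps power2_eq_square)
  also have "exp \<dots> = exp (- y)"
    unfolding exp_add using exp_2pi_1_int[of "int (h * R * j)"] by (simp add: mult_ac)
  finally have "nome \<tau> ^ m = exp (- y)" .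
  moreover have "exp (- y) / (1 - exp (- y)) = 1 / (exp y - 1)"
    by (simp add: exp_minus divide_simps)
  ultimately have "nome \<tau> ^ m / (1 - nome \<tau> ^ m) = 1 / (exp y - 1)"
    by (simp only:)
  then show ?thesis by (simp only: m_def \<tau>_def y_def)
qed

text \<open>Counts the l whose summand has a pole at 0. Each of them contributes the same multiple
  of Ln z / z, and this is the origin of \<open>C_coeff\<close>. After division by d = gcd R k the
  congruence has one solution modulo k / d, hence d solutions modulo k.\<close>

lemma card_linear_congruence:
  fixes R k r :: nat
  assumes "k > 0" "R > 0"
  shows "card {l \<in> {0..k - 1}. k dvd R * l + r} = (if gcd R k dvd r then gcd R k else 0)"
proof (cases "gcd R k dvd r")
  case False
  have "{l \<in> {0..k - 1}. k dvd R * l + r} = {}"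
  proof (rule ccontr)
    assume "\<not> ?thesis"
    then obtain l where "k dvd R * l + r" by auto
    then have "gcd R k dvd R * l + r" by (meson dvd_trans gcd_dvd2)
    then have "gcd R k dvd r" by (metis dvd_add_right_iff dvd_mult2 gcd_dvd1)
    with False show False by simp
  qed
  then show ?thesis using False by simp
next
  case True
  define d where "d = gcd R k"
  have d: "d > 0" using assms by (simp add: d_def)
  obtain R' k' where R': "R = d * R'" and k': "k = d * k'" and cop: "coprime R' k'"
    using gcd_coprime_exists[of R k] assms unfolding d_def by (auto simp: mult.commute)
  obtain r' where r': "r = d * r'" using True unfolding d_def by (rule dvdE)
  have k'0: "k' > 0" using assms(1) k' by simp
  have iff: "k dvd R * l + r \<longleftrightarrow> k' dvd R' * l + r'" for l
  proof -
    have "R * l + r = d * (R' * l + r')" by (simp add: R' r' algebra_simps)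
    then show ?thesis using d by (simp add: k')
  qed
  obtain x where x: "[R' * x = 1] (mod k')" using cong_solve_coprime_nat[OF cop] by auto
  \<comment> \<open>The solution - r' / R' modulo k', with k' - 1 standing for - 1 in the natural
    numbers.\<close>
  define l0 where "l0 = (x * (k' - 1) * r') mod k'"
  have l0: "k' dvd R' * l + r' \<longleftrightarrow> l mod k' = l0" for l
  proof -
    have "[R' * (x * (k' - 1) * r') + r' = 1 * ((k' - 1) * r') + r'] (mod k')"
      using cong_add[OF cong_mult[OF x cong_refl[of "(k' - 1) * r'"]] cong_refl[of r']]
      by (simp add: mult_ac)
    also have "1 * ((k' - 1) * r') + r' = k' * r'" using k'0 by (simp add: algebra_simps)
    finally have base: "[R' * l0 + r' = 0] (mod k')"
      unfolding l0_def cong_def by (metis mod_add_left_eq mod_mult_right_eq mod_mult_self1_is_0 mod_0)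
    have "k' dvd R' * l + r' \<longleftrightarrow> [R' * l + r' = R' * l0 + r'] (mod k')"
      using base by (metis cong_0_iff cong_sym cong_trans)
    also have "\<dots> \<longleftrightarrow> [l = l0] (mod k')"
      using cop by (simp add: cong_add_rcancel_nat cong_mult_lcancel_nat)
    also have "\<dots> \<longleftrightarrow> l mod k' = l0"
      unfolding cong_def l0_def by simp
    finally show ?thesis .
  qed
  have "bij_betw (\<lambda>t. l0 + k' * t) {..<d} {l \<in> {0..k - 1}. k dvd R * l + r}"
  proof (rule bij_betwI[where g = "\<lambda>l. l div k'"])
    have l0k: "l0 < k'" using k'0 by (simp add: l0_def)
    show "(\<lambda>t. l0 + k' * t) \<in> {..<d} \<rightarrow> {l \<in> {0..k - 1}. k dvd R * l + r}"
    proof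
      fix t assume "t \<in> {..<d}"
      then have "k' * Suc t \<le> k' * d" by (intro mult_le_mono2) simp
      then have "l0 + k' * t < k" using l0k by (simp add: k' mult.commute)
      then show "l0 + k' * t \<in> {l \<in> {0..k - 1}. k dvd R * l + r}"
        using l0k by (simp add: iff l0)
    qed
    show "(\<lambda>l. l div k') \<in> {l \<in> {0..k - 1}. k dvd R * l + r} \<rightarrow> {..<d}"
      using assms(1) k'0 by (auto simp: less_mult_imp_div_less k' mult.commute less_Suc_eq_le[symmetric])
    show "(l0 + k' * t) div k' = t" if "t \<in> {..<d}" for t using l0k by simp
    show "l0 + k' * (l div k') = l" if "l \<in> {l \<in> {0..k - 1}. k dvd R * l + r}" for l
    proof -
      have "l mod k' = l0" using that by (simp add: iff l0)
      then show ?thesis by (metis mult_div_mod_eq add.commute)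
    qed
  qed
  then have "card {l \<in> {0..k - 1}. k dvd R * l + r} = d"
    using bij_betw_same_card by fastforce
  then show ?thesis using True by (simp add: d_def)
qed

section \<open>The Weil multiplier\<close>

lemma cis_add_integer: "cis (2 * pi * (x + of_int n)) = cis (2 * pi * x)"
  using cis_add_int[of 1 n x] by (simp add: add.commute)

lemma sum_cis_residues:
  fixes k :: nat and c :: int
  assumes k: "k > 0"
  shows "(\<Sum>\<nu> = 0..k - 1. cis (2 * pi * (of_nat \<nu> * of_int c / of_nat k))) = (if int k dvd c then of_nat k else 0)"
proof -
  define \<omega> where "\<omega> = cis (2 * pi * (of_int c / of_nat k))"
  have pow: "\<omega> ^ \<nu> = cis (2 * pi * (of_nat \<nu> * of_int c / of_nat k))" for \<nu>
    unfolding \<omega>_def Complex.DeMoivre by (simp add: mult_ac)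
  have iv: "{0..k - 1} = {..<k}" using k by auto
  have sum: "(\<Sum>\<nu> = 0..k - 1. cis (2 * pi * (of_nat \<nu> * of_int c / of_nat k))) = (\<Sum>\<nu><k. \<omega> ^ \<nu>)"
    by (simp only: pow iv)
  show ?thesis
  proof (cases "int k dvd c")
    case True
    then obtain d where "c = int k * d" by (rule dvdE)
    then have "\<omega> = cis (2 * pi * of_int d)" using k by (simp add: \<omega>_def)
    then have "\<omega> = 1" by (simp add: cis_multiple_2pi)
    then show ?thesis unfolding sum using True by simp
  next
    case False
    have "\<omega> \<noteq> 1"
    proof
      assume "\<omega> = 1"
      then have "exp (- (2 * pi * \<i> * of_int (- c) / of_nat k)) = 1"
        by (simp add: \<omega>_def cis_conv_exp mult_ac)
      from exp_eq_1_multiple[OF this k] False show False by simp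
    qed
    moreover have "\<omega> ^ k = 1"
      using k by (simp add: pow cis_multiple_2pi)
    ultimately show ?thesis unfolding sum using False by (simp add: geometric_sum)
  qed
qed

text \<open>The sum over \<nu>1 runs over powers of a k-th root of unity and selects the \<nu>2 for
  which h (R \<nu>2 + r) is congruent to \<alpha>2 modulo k; its value k reduces the prefactor 1/(R
  k) to 1/R.\<close>

lemma weil_multiplier_eq:
  fixes R r h k :: nat and h' \<alpha>1 \<alpha>2 :: int
  assumes R: "R > 0" and k: "k > 0"
  shows "weil_multiplier R r h h' k (\<alpha>1, \<alpha>2) =
    cis (2 * pi * (of_int (- h' * \<alpha>1 * \<alpha>2) / real (R * k))) / of_nat R *
     (\<Sum>l = 0..k - 1. if int k dvd int h * (int R * int l + int r) - \<alpha>2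
        then cis (2 * pi * (of_int (- \<alpha>1 * (int R * int l + int r)) / real (R * k))) else 0)"
proof -
  have root: "root_of_unity (R * k) powi n = cis (2 * pi * (of_int n / real (R * k)))" for n
  proof -
    have "root_of_unity (R * k) = cis (2 * pi / real (R * k))"
      by (simp add: root_of_unity_def cis_conv_exp mult_ac)
    then show ?thesis by (simp add: cis_power_int mult_ac)
  qed
  have e: "exp (2 * pi * \<i> / of_nat k
               * (of_nat R * of_nat h * of_nat \<nu>1 * (of_nat \<nu>2 + of_nat r / of_nat R)
                  - of_int \<alpha>2 * of_nat \<nu>1
                  - of_int \<alpha>1 * (of_nat \<nu>2 + of_nat r / of_nat R))) =
      cis (2 * pi * (of_nat \<nu>1 * of_int (int h * (int R * int \<nu>2 + int r) - \<alpha>2) / of_nat k)) *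
      cis (2 * pi * (of_int (- \<alpha>1 * (int R * int \<nu>2 + int r)) / real (R * k)))" for \<nu>1 \<nu>2
  proof -
    have "2 * pi * \<i> / of_nat k
               * (of_nat R * of_nat h * of_nat \<nu>1 * (of_nat \<nu>2 + of_nat r / of_nat R)
                  - of_int \<alpha>2 * of_nat \<nu>1
                  - of_int \<alpha>1 * (of_nat \<nu>2 + of_nat r / of_nat R)) =
       \<i> * of_real (2 * pi * (of_nat \<nu>1 * of_int (int h * (int R * int \<nu>2 + int r) - \<alpha>2) / of_nat k) +
           2 * pi * (of_int (- \<alpha>1 * (int R * int \<nu>2 + int r)) / real (R * k)))"
      using R k by (simp add: field_simps)
    then show ?thesis by (simp only: cis_conv_exp[symmetric] cis_mult)
  qed
  have "(\<Sum>\<nu>1 = 0..k - 1. \<Sum>\<nu>2 = 0..k - 1.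
          exp (2 * pi * \<i> / of_nat k
               * (of_nat R * of_nat h * of_nat \<nu>1 * (of_nat \<nu>2 + of_nat r / of_nat R)
                  - of_int \<alpha>2 * of_nat \<nu>1
                  - of_int \<alpha>1 * (of_nat \<nu>2 + of_nat r / of_nat R)))) =
      (\<Sum>l = 0..k - 1. (\<Sum>\<nu>1 = 0..k - 1. cis (2 * pi * (of_nat \<nu>1 * of_int (int h * (int R * int l + int r) - \<alpha>2) / of_nat k))) *
         cis (2 * pi * (of_int (- \<alpha>1 * (int R * int l + int r)) / real (R * k))))"
    unfolding e by (subst sum.swap) (simp only: sum_distrib_right)
  also have "\<dots> = of_nat k * (\<Sum>l = 0..k - 1. if int k dvd int h * (int R * int l + int r) - \<alpha>2
        then cis (2 * pi * (of_int (- \<alpha>1 * (int R * int l + int r)) / real (R * k))) else 0)"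
    unfolding sum_cis_residues[OF k] sum_distrib_left by (intro sum.cong) auto
  finally show ?thesis
    unfolding weil_multiplier_def fst_conv snd_conv root using k by simp
qed

lemma sum_periodic_shift:
  fixes f :: "int \<Rightarrow> complex" and k :: nat
  assumes per: "\<And>l. f (l + int k) = f l" and k: "k > 0"
  shows "(\<Sum>l = 0..k - 1. f (int l + c)) = (\<Sum>l = 0..k - 1. f (int l))"
proof -
  have up: "f (l + int k * int t) = f l" for l t
  proof (induction t)
    case (Suc t)
    then show ?case using per[of "l + int k * int t"] by (simp add: algebra_simps)
  qed simp
  have md: "f (x mod int k) = f x" for x
  proof (cases "x div int k \<ge> 0")
    case True
    then show ?thesis using up[of "x mod int k" "nat (x div int k)"] by simp
  next
    case False
    have "x + int k * int (nat (- (x div int k))) = x mod int k"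
      using False by (simp add: minus_mult_div_eq_mod[symmetric])
    then show ?thesis using up[of x "nat (- (x div int k))"] by simp
  qed
  have bij: "bij_betw (\<lambda>l. nat ((int l + c) mod int k)) {0..k - 1} {0..k - 1}"
  proof (rule bij_betwI[where g = "\<lambda>l. nat ((int l - c) mod int k)"])
    have lt: "nat (x mod int k) \<in> {0..k - 1}" for x
    proof -
      have "nat (x mod int k) < k" using k by (simp add: nat_less_iff)
      then show ?thesis by simp
    qed
    show "(\<lambda>l. nat ((int l + c) mod int k)) \<in> {0..k - 1} \<rightarrow> {0..k - 1}"
      "(\<lambda>l. nat ((int l - c) mod int k)) \<in> {0..k - 1} \<rightarrow> {0..k - 1}"
      using lt by blast+
    show "nat ((int (nat ((int x + c) mod int k)) - c) mod int k) = x" if "x \<in> {0..k - 1}" for x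
    proof -
      have "int (nat ((int x + c) mod int k)) = (int x + c) mod int k" using k by simp
      moreover have "((int x + c) mod int k - c) mod int k = int x mod int k"
        by (simp add: mod_diff_left_eq)
      moreover have "x < k" using that k by auto
      ultimately show ?thesis by simp
    qed
    show "nat ((int (nat ((int x - c) mod int k)) + c) mod int k) = x" if "x \<in> {0..k - 1}" for x
    proof -
      have "int (nat ((int x - c) mod int k)) = (int x - c) mod int k" using k by simp
      moreover have "((int x - c) mod int k + c) mod int k = int x mod int k"
        by (simp add: mod_add_left_eq)
      moreover have "x < k" using that k by auto
      ultimately show ?thesis by simp
    qed
  qed
  have "(\<Sum>l = 0..k - 1. f (int l + c)) = (\<Sum>l = 0..k - 1. f (int (nat ((int l + c) mod int k))))"
    using k by (intro sum.cong refl) (simp add: md)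
  also have "\<dots> = (\<Sum>l = 0..k - 1. f (int l))"
    by (rule sum.reindex_bij_betw[OF bij])
  finally show ?thesis .
qed

text \<open>Multiplied by the phase of a lattice point in its class, the multiplier depends on m and
  n alone, and the condition on \<alpha>2 becomes the pole condition that m is congruent to h M
  modulo k. This is what trades the sum over \<alpha> for a sum over l.\<close>

lemma weil_multiplier_phase:
  fixes R r h k :: nat and h' \<alpha>1 \<alpha>2 m n :: int
  assumes R: "R > 0" and k: "k > 0" and h': "[int h * h' = - 1] (mod int k)"
    and n: "int R dvd n - \<alpha>1" and m: "int R dvd m - \<alpha>2"
  shows "weil_multiplier R r h h' k (\<alpha>1, \<alpha>2) * cis (2 * pi * (of_int (h' * n * m) / real (R * k))) =
     1 / of_nat R * (\<Sum>l = 0..k - 1. if int k dvd m - int h * (int R * int l + int r)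
        then cis (2 * pi * (of_int (- n * (int R * int l + int r)) / real (R * k))) else 0)"
proof -
  obtain m1 where m1: "n - \<alpha>1 = int R * m1" using n by (rule dvdE)
  obtain m2 where m2: "m - \<alpha>2 = int R * m2" using m by (rule dvdE)
  have hh: "int k dvd int h * h' + 1" using h' by (simp add: cong_iff_dvd_diff)
  define f where "f = (\<lambda>l::int. if int k dvd int h * (int R * l + int r) - \<alpha>2
        then cis (2 * pi * (of_int (- \<alpha>1 * (int R * l + int r)) / real (R * k))) else 0)"
  have per: "f (l + int k) = f l" for l
  proof -
    have "int h * (int R * (l + int k) + int r) - \<alpha>2 = (int h * (int R * l + int r) - \<alpha>2) + int k * (int h * int R)"
      by (simp add: algebra_simps)
    then have 1: "int k dvd int h * (int R * (l + int k) + int r) - \<alpha>2 \<longleftrightarrow> int k dvd int h * (int R * l + int r) - \<alpha>2"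
      by (metis dvd_add_left_iff dvd_triv_left)
    have "of_int (- \<alpha>1 * (int R * (l + int k) + int r)) / real (R * k) = of_int (- \<alpha>1 * (int R * l + int r)) / real (R * k) + of_int (- \<alpha>1)"
      using R k by (simp add: field_simps)
    then have 2: "cis (2 * pi * (of_int (- \<alpha>1 * (int R * (l + int k) + int r)) / real (R * k))) = cis (2 * pi * (of_int (- \<alpha>1 * (int R * l + int r)) / real (R * k)))"
      by (simp only: cis_add_integer)
    show ?thesis unfolding f_def 1 2 ..
  qed
  have "weil_multiplier R r h h' k (\<alpha>1, \<alpha>2) =
     cis (2 * pi * (of_int (- h' * \<alpha>1 * \<alpha>2) / real (R * k))) / of_nat R * (\<Sum>l = 0..k - 1. f (int l))"
    unfolding weil_multiplier_eq[OF R k] f_def ..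
  \<comment> \<open>Shifting l by h' m2 adds h h' R m2 to the left of the congruence, which is - R
    m2 modulo k and so replaces \<alpha>2 by \<alpha>2 + R m2 = m.\<close>
  also have "(\<Sum>l = 0..k - 1. f (int l)) = (\<Sum>l = 0..k - 1. f (int l + h' * m2))"
    by (rule sum_periodic_shift[of f k, OF per k, symmetric])
  finally have "weil_multiplier R r h h' k (\<alpha>1, \<alpha>2) * cis (2 * pi * (of_int (h' * n * m) / real (R * k))) =
     1 / of_nat R * (\<Sum>l = 0..k - 1. cis (2 * pi * (of_int (- h' * \<alpha>1 * \<alpha>2) / real (R * k))) * cis (2 * pi * (of_int (h' * n * m) / real (R * k))) * f (int l + h' * m2))"
    unfolding sum_distrib_left[symmetric] by (simp add: mult_ac)
  also have "(\<Sum>l = 0..k - 1. cis (2 * pi * (of_int (- h' * \<alpha>1 * \<alpha>2) / real (R * k))) * cis (2 * pi * (of_int (h' * n * m) / real (R * k))) * f (int l + h' * m2)) =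
     (\<Sum>l = 0..k - 1. if int k dvd m - int h * (int R * int l + int r)
        then cis (2 * pi * (of_int (- n * (int R * int l + int r)) / real (R * k))) else 0)"
  proof (rule sum.cong[OF refl])
    fix l :: nat
    define M where "M = int R * int l + int r"
    have "int h * (int R * (int l + h' * m2) + int r) - \<alpha>2 = - (m - int h * M) + (int h * h' + 1) * (int R * m2)"
      using m2 by (simp add: M_def algebra_simps)
    then have cond: "int k dvd int h * (int R * (int l + h' * m2) + int r) - \<alpha>2 \<longleftrightarrow> int k dvd m - int h * M"
      using hh by (metis dvd_add_left_iff dvd_minus_iff dvd_mult2)
    show "cis (2 * pi * (of_int (- h' * \<alpha>1 * \<alpha>2) / real (R * k))) * cis (2 * pi * (of_int (h' * n * m) / real (R * k))) * f (int l + h' * m2) =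
        (if int k dvd m - int h * (int R * int l + int r) then cis (2 * pi * (of_int (- n * (int R * int l + int r)) / real (R * k))) else 0)"
    proof (cases "int k dvd m - int h * M")
      case True
      \<comment> \<open>This makes the phases agree: the two exponents differ by m1 (M + h' m) / k,
        an integer.\<close>
      have "M + h' * m = (int h * h' + 1) * M + h' * (m - int h * M)" by (simp add: algebra_simps)
      then have "int k dvd M + h' * m" using hh True by (metis dvd_add dvd_mult dvd_mult2)
      then obtain t where t: "M + h' * m = int k * t" by (rule dvdE)
      have \<alpha>: "\<alpha>1 = n - int R * m1" "\<alpha>2 = m - int R * m2" using m1 m2 by auto
      have "- h' * \<alpha>1 * \<alpha>2 + h' * n * m + - \<alpha>1 * (int R * (int l + h' * m2) + int r) = - n * M + int R * m1 * (M + h' * m)"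
        unfolding \<alpha> M_def by (simp add: algebra_simps)
      also have "\<dots> = - n * M + int (R * k) * (m1 * t)" unfolding t by (simp add: algebra_simps)
      finally have "of_int (- h' * \<alpha>1 * \<alpha>2) / real (R * k) + of_int (h' * n * m) / real (R * k) + of_int (- \<alpha>1 * (int R * (int l + h' * m2) + int r)) / real (R * k)
          = of_int (- n * M + int (R * k) * (m1 * t)) / real (R * k)"
        by (simp only: add_divide_distrib[symmetric] of_int_add[symmetric])
      also have "\<dots> = of_int (- n * M) / real (R * k) + of_int (m1 * t)"
        using R k by (simp add: diff_divide_distrib)
      finally have "cis (2 * pi * (of_int (- h' * \<alpha>1 * \<alpha>2) / real (R * k))) * cis (2 * pi * (of_int (h' * n * m) / real (R * k))) *
          cis (2 * pi * (of_int (- \<alpha>1 * (int R * (int l + h' * m2) + int r)) / real (R * k))) = cis (2 * pi * (of_int (- n * M) / real (R * k)))"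
        unfolding cis_mult distrib_left[symmetric] by (simp only: cis_add_integer)
      then show ?thesis using True cond by (simp add: f_def M_def)
    next
      case False
      then show ?thesis using cond by (simp add: f_def M_def)
    qed
  qed
  finally show ?thesis .
qed

text \<open>The order is reversed: the Fourier frequency n gives the first coordinate, the pole
  number m the second.\<close>

lemma shifted_lattice_bij:
  fixes R :: nat and \<alpha>1 \<alpha>2 :: int
  assumes R: "R > 0"
  shows "bij_betw (\<lambda>(m, n). (of_int n / real R, of_int m / real R))
     {(m, n). m \<noteq> 0 \<and> n \<noteq> 0 \<and> int R dvd m - \<alpha>2 \<and> int R dvd n - \<alpha>1} (shifted_lattice R (\<alpha>1, \<alpha>2))"
  unfolding bij_betw_def
proof
  show "inj_on (\<lambda>(m, n). (of_int n / real R, of_int m / real R))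
     {(m, n). m \<noteq> 0 \<and> n \<noteq> 0 \<and> int R dvd m - \<alpha>2 \<and> int R dvd n - \<alpha>1}"
    using R by (auto simp: inj_on_def)
  show "(\<lambda>(m, n). (of_int n / real R, of_int m / real R)) `
     {(m, n). m \<noteq> 0 \<and> n \<noteq> 0 \<and> int R dvd m - \<alpha>2 \<and> int R dvd n - \<alpha>1} = shifted_lattice R (\<alpha>1, \<alpha>2)"
  proof (intro equalityI subsetI)
    fix p assume "p \<in> (\<lambda>(m, n). (of_int n / real R, of_int m / real R)) `
     {(m, n). m \<noteq> 0 \<and> n \<noteq> 0 \<and> int R dvd m - \<alpha>2 \<and> int R dvd n - \<alpha>1}"
    then obtain m n where p: "p = (of_int n / real R, of_int m / real R)" "m \<noteq> 0" "n \<noteq> 0" "int R dvd m - \<alpha>2" "int R dvd n - \<alpha>1"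
      by auto
    obtain m1 where "n - \<alpha>1 = int R * m1" using p(5) by (rule dvdE)
    then have "n = int R * m1 + \<alpha>1" by simp
    then have 1: "of_int n / real R = of_int m1 + of_int \<alpha>1 / real R" using R by (simp add: field_simps)
    obtain m2 where "m - \<alpha>2 = int R * m2" using p(4) by (rule dvdE)
    then have "m = int R * m2 + \<alpha>2" by simp
    then have 2: "of_int m / real R = of_int m2 + of_int \<alpha>2 / real R" using R by (simp add: field_simps)
    have "of_int n / real R \<noteq> 0" "of_int m / real R \<noteq> 0" using p R by auto
    then show "p \<in> shifted_lattice R (\<alpha>1, \<alpha>2)"
      unfolding shifted_lattice_def p(1) using 1 2 by auto
  next
    fix p assume "p \<in> shifted_lattice R (\<alpha>1, \<alpha>2)"
    then obtain m1 m2 :: int where p: "p = (of_int m1 + of_int \<alpha>1 / real R, of_int m2 + of_int \<alpha>2 / real R)"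
      "of_int m1 + of_int \<alpha>1 / real R \<noteq> 0" "of_int m2 + of_int \<alpha>2 / real R \<noteq> 0"
      unfolding shifted_lattice_def by auto
    define n where "n = int R * m1 + \<alpha>1"
    define m where "m = int R * m2 + \<alpha>2"
    have e: "of_int m1 + of_int \<alpha>1 / real R = of_int n / real R" "of_int m2 + of_int \<alpha>2 / real R = of_int m / real R"
      using R by (simp_all add: n_def m_def field_simps)
    then have "p = (\<lambda>(m, n). (of_int n / real R, of_int m / real R)) (m, n)" "m \<noteq> 0" "n \<noteq> 0"
      using p by auto
    then show "p \<in> (\<lambda>(m, n). (of_int n / real R, of_int m / real R)) `
     {(m, n). m \<noteq> 0 \<and> n \<noteq> 0 \<and> int R dvd m - \<alpha>2 \<and> int R dvd n - \<alpha>1}"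
      by (intro image_eqI[of _ _ "(m, n)"]) (auto simp: n_def m_def)
  qed
qed

section \<open>The dual series\<close>

lemma infsum_finite_sum:
  fixes f :: "'j \<Rightarrow> 'i \<Rightarrow> complex"
  assumes "finite J" "\<And>j. j \<in> J \<Longrightarrow> f j summable_on A"
  shows "(\<Sum>j\<in>J. infsum (f j) A) = (\<Sum>\<^sub>\<infinity>i\<in>A. \<Sum>j\<in>J. f j i)"
  by (rule infsumI[symmetric], rule has_sum_finite_sum) (use assms in auto)

text \<open>By \<open>pv_integral_eq_fourier\<close> with p = n, v = m / R and w = 1 / z, this is
  one summand of f plus the corresponding summand of I, stripped of the root of unity contributed by
  h' / k.\<close>

definition dual_term :: "nat \<Rightarrow> complex \<Rightarrow> int \<times> int \<Rightarrow> complex" where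
  "dual_term R z = (\<lambda>(m, n). - 1 / (4 * pi\<^sup>2 * of_int n) *
     fourier_inverse_square (of_int n) (- \<i> * of_real (of_int m / real R) * (1 / z)))"

lemma Re_inverse_pos: "Re z > 0 \<Longrightarrow> Re (1 / z) > 0"
  by (auto simp: Re_divide intro!: divide_pos_pos add_pos_nonneg)

text \<open>Up to the factor 2 pi i these are the terms of \<open>reciprocal_series_limit\<close>
  for k = 1, a = 0 and Z = R z, whose absolute summability was obtained there along with the
  limit.\<close>

lemma dual_term_summable:
  assumes R: "R > 0" and z: "Re z > 0"
  shows "(\<lambda>p. norm (dual_term R z p)) summable_on (nonzero_ints \<times> nonzero_ints)"
proof -
  define Z where "Z = of_nat R * z"
  have Z: "Re Z > 0" using R z by (simp add: Z_def)
  \<comment> \<open>With modulus \<open>1\<close> the residue class of \<open>0\<close> consists of all integers.\<close>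
  have A: "{m. m \<noteq> 0 \<and> int 1 dvd m - 0} = nonzero_ints" by auto
  define t where "t = (\<lambda>(m, n). cis (- 2 * pi * of_int n * 0) / of_real ((2 * pi * of_int n)\<^sup>2) *
            (- 2 * pi * \<i> * of_int n * fourier_inverse_square (of_int n) (- \<i> * of_real (of_int m / of_nat 1) * (1 / Z))))"
  have "(\<lambda>p. norm (t p)) summable_on (nonzero_ints \<times> nonzero_ints)"
    unfolding t_def
  proof (rule reciprocal_series_limit(1)[where U = "\<lambda>x. if x = 0 then 0 else 2 * pi * Z * (1 / (exp (2 * pi * of_real x * Z) - 1) - 1 / (2 * pi * of_real x * Z) + 1/2)"])
    fix x :: real assume "x \<ge> 0"
    from partial_fractions_zero_class[OF Z _ _ this, of 1 0]
    show "((\<lambda>m. 1 / (of_real x + - \<i> * of_real (of_int m / of_nat 1) * (1 / Z)) - 1 / (- \<i> * of_real (of_int m / of_nat 1) * (1 / Z))) has_sum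
       (if x = 0 then 0 else 2 * pi * Z * (1 / (exp (2 * pi * of_real x * Z) - 1) - 1 / (2 * pi * of_real x * Z) + 1/2))) nonzero_ints"
      unfolding A by simp
  qed (use Re_inverse_pos[OF Z] in auto)
  then have "(\<lambda>p. 1 / (2 * pi) * norm (t p)) summable_on (nonzero_ints \<times> nonzero_ints)"
    by (rule summable_on_cmult_right)
  then show ?thesis
  proof (rule summable_on_comparison_test)
    fix p assume "p \<in> nonzero_ints \<times> nonzero_ints"
    then obtain m n where p: "p = (m, n)" "n \<noteq> 0" by auto
    have s: "- \<i> * of_real (of_int m / of_nat 1) * (1 / Z) = - \<i> * of_real (of_int m / real R) * (1 / z)"
      by (simp add: Z_def field_simps)
    have "t p = 2 * pi * \<i> * dual_term R z p"
      unfolding t_def dual_term_def p prod.case s using p(2) by (simp add: field_simps power2_eq_square)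
    then show "norm (dual_term R z p) \<le> 1 / (2 * pi) * norm (t p)"
      by (simp add: norm_mult)
  qed simp
qed

lemma exp_minus_le_inverse_square:
  fixes x :: real
  assumes "x > 0"
  shows "exp (- x) \<le> 2 / x\<^sup>2"
proof -
  have "x\<^sup>2 / 2 \<le> exp x" using exp_lower_Taylor_quadratic[of x] assms by simp
  then have "inverse (exp x) \<le> inverse (x\<^sup>2 / 2)" using assms by (intro le_imp_inverse_le) auto
  then show ?thesis by (simp add: exp_minus)
qed

text \<open>The summands of f alone. The signs cancel unless m n > 0, and there the exponential is
  at most a multiple of 1/(m n)^2. As \<open>dual_term\<close> controls only f plus I, this is what
  makes the series of I summable, as a difference.\<close>

lemma elliptic_term_summable:
  fixes w :: complex and R :: nat
  assumes R: "R > 0" and w: "Re w > 0"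
  shows "(\<lambda>(m, n). norm (of_real ((sgn (of_int n) + sgn (of_int m / real R)) / 4) * exp (- (2 * pi * w) * of_real (of_int n * (of_int m / real R)))))
      summable_on (nonzero_ints \<times> nonzero_ints)"
proof (rule summable_on_comparison_test)
  define c where "c = 2 * pi * Re w / real R"
  have c: "c > 0" using R w by (simp add: c_def)
  show "(\<lambda>(m, n). 1 / c\<^sup>2 * (1 / (real_of_int m)\<^sup>2 * (1 / (real_of_int n)\<^sup>2))) summable_on (nonzero_ints \<times> nonzero_ints)"
    by (rule summable_on_product_inverse_squares) auto
  fix p :: "int \<times> int" assume "p \<in> nonzero_ints \<times> nonzero_ints"
  then obtain m n where p: "p = (m, n)" "m \<noteq> 0" "n \<noteq> 0" by auto
  define \<sigma> where "\<sigma> = (sgn (real_of_int n) + sgn (of_int m / real R)) / 4"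
  have nrm: "norm (of_real \<sigma> * exp (- (2 * pi * w) * of_real (of_int n * (of_int m / real R)))) = \<bar>\<sigma>\<bar> * exp (- (c * (of_int m * of_int n)))"
    by (simp add: norm_mult c_def mult_ac)
  have "\<bar>\<sigma>\<bar> * exp (- (c * (of_int m * of_int n))) \<le> 1 / c\<^sup>2 * (1 / (real_of_int m)\<^sup>2 * (1 / (real_of_int n)\<^sup>2))"
  proof (cases "m * n > 0")
    case True
    then have mn: "real_of_int m * of_int n > 0" by (metis of_int_0_less_iff of_int_mult)
    have "\<bar>\<sigma>\<bar> \<le> 1 / 2" by (auto simp: \<sigma>_def sgn_if)
    then have "\<bar>\<sigma>\<bar> * exp (- (c * (of_int m * of_int n))) \<le> 1 / 2 * exp (- (c * (of_int m * of_int n)))"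
      by (intro mult_right_mono) auto
    also have "\<dots> \<le> 1 / 2 * (2 / (c * (of_int m * of_int n))\<^sup>2)"
      using c mn by (intro mult_left_mono exp_minus_le_inverse_square) auto
    finally show ?thesis by (simp add: power_mult_distrib)
  next
    case False
    then have "m * n < 0" using p by (simp add: not_less le_less)
    then have "\<sigma> = 0"
      using R by (auto simp: \<sigma>_def sgn_if mult_less_0_iff divide_less_0_iff zero_less_divide_iff)
    then show ?thesis by simp
  qed
  then show "(case p of (m, n) \<Rightarrow> norm (of_real ((sgn (of_int n) + sgn (of_int m / real R)) / 4) * exp (- (2 * pi * w) * of_real (of_int n * (of_int m / real R)))))
     \<le> (case p of (m, n) \<Rightarrow> 1 / c\<^sup>2 * (1 / (real_of_int m)\<^sup>2 * (1 / (real_of_int n)\<^sup>2)))"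
    unfolding p prod.case \<sigma>_def[symmetric] nrm .
qed auto

text \<open>Since \<tau> - h' / k = i / z, the rational part of \<tau> contributes the same root of
  unity to the summands of both series, and the rest is \<open>dual_term\<close>. Each series has to
  be summable on its own before they are added, as \<open>infsum\<close> is 0 on a divergent
  one.\<close>

lemma f_plus_I_series:
  fixes R k :: nat and h' \<alpha>1 \<alpha>2 :: int and z :: complex
  assumes R: "R > 0" and k: "k > 0" and z: "Re z > 0"
  defines "\<tau> \<equiv> of_int h' / of_nat k + \<i> / z"
  shows "f_series R (\<alpha>1, \<alpha>2) \<tau> + I_series R (\<alpha>1, \<alpha>2) (of_int h' / of_nat k) \<tau> =
     (\<Sum>\<^sub>\<infinity>(m, n)\<in>{(m, n). m \<noteq> 0 \<and> n \<noteq> 0 \<and> int R dvd m - \<alpha>2 \<and> int R dvd n - \<alpha>1}.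
        cis (2 * pi * (of_int (h' * n * m) / real (R * k))) * dual_term R z (m, n))"
proof -
  define L where "L = {(m, n). m \<noteq> 0 \<and> n \<noteq> 0 \<and> int R dvd m - \<alpha>2 \<and> int R dvd n - \<alpha>1}"
  have sub: "L \<subseteq> nonzero_ints \<times> nonzero_ints" by (auto simp: L_def)
  note bij = shifted_lattice_bij[OF R, of \<alpha>2 \<alpha>1, folded L_def]
  define w where "w = 1 / z"
  have w: "Re w > 0" unfolding w_def by (rule Re_inverse_pos[OF z])
  define ph where "ph = (\<lambda>(m, n). cis (2 * pi * (of_int (h' * n * m) / real (R * k))))"
  define F1 where "F1 = (\<lambda>(m, n). of_real ((sgn (of_int n) + sgn (of_int m / real R)) / 4) * exp (- (2 * pi * w) * of_real (of_int n * (of_int m / real R))))"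
  define F2 where "F2 = (\<lambda>(m, n). 1 / (2 * pi * \<i> * of_real (of_int n * (of_int m / real R))) *
        pv_integral {0..} (of_int n * (of_int m / real R)) (\<lambda>x. of_real x * exp (- (2 * pi * w) * of_real x) / of_real (x - of_int n * (of_int m / real R))))"
  have sum12: "F1 p + F2 p = dual_term R z p" if "p \<in> L" for p
  proof -
    obtain m n where p: "p = (m, n)" "m \<noteq> 0" "n \<noteq> 0" using \<open>p \<in> L\<close> by (auto simp: L_def)
    show ?thesis
      unfolding F1_def F2_def dual_term_def p(1) prod.case w_def[symmetric]
      using pv_integral_eq_fourier[of "of_int n" "of_int m / real R" w] p R w by simp
  qed
  have n1: "norm (ph p) = 1" for p by (simp add: ph_def case_prod_unfold)
  have dsum: "(\<lambda>p. ph p * dual_term R z p) summable_on L"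
    by (rule abs_summable_summable, rule summable_on_comparison_test[OF summable_on_subset[OF dual_term_summable[OF R z] sub]])
       (simp_all add: norm_mult n1)
  have "(\<lambda>p. norm (F1 p)) summable_on (nonzero_ints \<times> nonzero_ints)"
    using elliptic_term_summable[OF R w] by (simp add: F1_def case_prod_unfold)
  then have "(\<lambda>p. norm (ph p * F1 p)) summable_on L"
    using summable_on_subset[OF _ sub] by (simp add: norm_mult n1)
  then have f1: "(\<lambda>p. ph p * F1 p) summable_on L"
    by (rule abs_summable_summable)
  have f2: "(\<lambda>p. ph p * F2 p) summable_on L"
  proof -
    have "(\<lambda>p. ph p * dual_term R z p + - (ph p * F1 p)) summable_on L"
      by (intro summable_on_add dsum) (use f1 in \<open>simp add: summable_on_uminus\<close>)
    then show ?thesis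
      by (rule summable_on_cong[THEN iffD1, rotated]) (simp add: sum12[symmetric] ring_distribs)
  qed
  have Rn: "real R \<noteq> 0" "complex_of_nat R \<noteq> 0" using R by auto
  have kn: "real k \<noteq> 0" "complex_of_nat k \<noteq> 0" using k by auto
  have z0: "z \<noteq> 0" using z by auto
  have sgnR: "sgn (x / real R) = sgn x" for x
    using R by (simp add: sgn_if divide_less_0_iff zero_less_divide_iff)
  have prodR: "real R * (of_int n / real R) * (of_int m / real R) = of_int n * (of_int m / real R)" for m n :: int
    using Rn by simp
  have phase: "exp (2 * pi * \<i> * of_nat R * (of_int h' / of_nat k) * of_real (of_int n / real R * (of_int m / real R))) = ph (m, n)" for m n
    unfolding ph_def prod.case cis_conv_exp using Rn kn by (simp add: field_simps)
  have ex: "exp (2 * pi * \<i> * \<tau> * of_real (real R * (of_int n / real R) * (of_int m / real R))) =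
      ph (m, n) * exp (- (2 * pi * w) * of_real (of_int n * (of_int m / real R)))" for m n
  proof -
    have "2 * pi * \<i> * \<tau> * of_real (real R * (of_int n / real R) * (of_int m / real R)) =
       2 * pi * \<i> * of_nat R * (of_int h' / of_nat k) * of_real (of_int n / real R * (of_int m / real R)) +
       - (2 * pi * w) * of_real (of_int n * (of_int m / real R))"
      unfolding prodR using Rn kn z0 by (simp add: \<tau>_def w_def field_simps)
    then show ?thesis by (simp only: exp_add phase)
  qed
  have "f_series R (\<alpha>1, \<alpha>2) \<tau> = (\<Sum>\<^sub>\<infinity>p\<in>L. ph p * F1 p)"
  proof -
    have "f_series R (\<alpha>1, \<alpha>2) \<tau> = (\<Sum>\<^sub>\<infinity>q\<in>shifted_lattice R (\<alpha>1, \<alpha>2).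
       1 / 4 * (case q of (n1, n2) \<Rightarrow> of_real (sgn n1 + sgn n2) * exp (2 * pi * \<i> * \<tau> * of_real (of_nat R * n1 * n2))))"
      unfolding f_series_def by (rule infsum_cmult_right'[symmetric])
    also have "\<dots> = (\<Sum>\<^sub>\<infinity>p\<in>L. 1 / 4 * (case (case p of (m, n) \<Rightarrow> (of_int n / real R, of_int m / real R)) of (n1, n2) \<Rightarrow>
         of_real (sgn n1 + sgn n2) * exp (2 * pi * \<i> * \<tau> * of_real (of_nat R * n1 * n2))))"
      by (rule infsum_reindex_bij_betw[OF bij, symmetric])
    also have "\<dots> = (\<Sum>\<^sub>\<infinity>p\<in>L. ph p * F1 p)"
    proof (rule infsum_cong)
      fix p :: "int \<times> int"
      obtain m n where p: "p = (m, n)" by (cases p)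
      show "1 / 4 * (case (case p of (m, n) \<Rightarrow> (of_int n / real R, of_int m / real R)) of (n1, n2) \<Rightarrow>
         of_real (sgn n1 + sgn n2) * exp (2 * pi * \<i> * \<tau> * of_real (of_nat R * n1 * n2))) = ph p * F1 p"
        unfolding p prod.case ex F1_def using R by (simp add: sgnR)
    qed
    finally show ?thesis .
  qed
  moreover have "I_series R (\<alpha>1, \<alpha>2) (of_int h' / of_nat k) \<tau> = (\<Sum>\<^sub>\<infinity>p\<in>L. ph p * F2 p)"
  proof -
    have rat: "of_rat (of_int h' / of_nat k) = (of_int h' / of_nat k :: complex)"
      by (simp add: of_rat_divide)
    have tr: "2 * pi * \<i> * (\<tau> - of_int h' / of_nat k) * of_real x = - (2 * pi * w) * of_real x" for x
      by (simp add: \<tau>_def w_def mult.assoc)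
    define G where "G = (\<lambda>(n1, n2). exp (2 * pi * \<i> * of_nat R * of_rat (of_int h' / of_nat k) * of_real (n1 * n2)) / of_real (of_nat R * n1 * n2)
        * pv_integral {0..} (of_nat R * n1 * n2)
            (\<lambda>x. of_real x * exp (2 * pi * \<i> * (\<tau> - of_rat (of_int h' / of_nat k)) * of_real x)
                  / of_real (x - of_nat R * n1 * n2)))"
    have "I_series R (\<alpha>1, \<alpha>2) (of_int h' / of_nat k) \<tau> = (\<Sum>\<^sub>\<infinity>q\<in>shifted_lattice R (\<alpha>1, \<alpha>2). 1 / (2 * pi * \<i>) * G q)"
      unfolding I_series_def G_def by (rule infsum_cmult_right'[symmetric])
    also have "\<dots> = (\<Sum>\<^sub>\<infinity>p\<in>L. 1 / (2 * pi * \<i>) * G (case p of (m, n) \<Rightarrow> (of_int n / real R, of_int m / real R)))"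
      by (rule infsum_reindex_bij_betw[OF bij, symmetric])
    also have "\<dots> = (\<Sum>\<^sub>\<infinity>p\<in>L. ph p * F2 p)"
    proof (rule infsum_cong)
      fix p :: "int \<times> int"
      obtain m n where p: "p = (m, n)" by (cases p)
      show "1 / (2 * pi * \<i>) * G (case p of (m, n) \<Rightarrow> (of_int n / real R, of_int m / real R)) = ph p * F2 p"
        unfolding p prod.case G_def F2_def rat tr prodR phase by simp
    qed
    finally show ?thesis .
  qed
  moreover have "(\<Sum>\<^sub>\<infinity>p\<in>L. ph p * F1 p) + (\<Sum>\<^sub>\<infinity>p\<in>L. ph p * F2 p) = (\<Sum>\<^sub>\<infinity>p\<in>L. ph p * dual_term R z p)"
    unfolding infsum_add[OF f1 f2, symmetric]
    by (rule infsum_cong) (simp add: sum12[symmetric] ring_distribs)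
  moreover have "(\<Sum>\<^sub>\<infinity>p\<in>L. ph p * dual_term R z p) = (\<Sum>\<^sub>\<infinity>(m, n)\<in>L. cis (2 * pi * (of_int (h' * n * m) / real (R * k))) * dual_term R z (m, n))"
    by (rule infsum_cong) (auto simp: ph_def)
  ultimately show ?thesis unfolding L_def by simp
qed

section \<open>The transformation formula\<close>

text \<open>Every pair (m, n) belongs to exactly one \<alpha> with entries in [0, R), so the series
  for all \<alpha> together form one series over nonzero pairs; \<open>weil_multiplier_phase\<close>
  rewrites its coefficients as sums over l.\<close>

lemma sum_weil_multiplier_series:
  fixes R r h k :: nat and h' :: int and z :: complex
  assumes R: "R > 0" and k: "k > 0" and z: "Re z > 0" and h': "[int h * h' = - 1] (mod int k)"
  shows "(\<Sum>\<alpha>1 = 0..int R - 1. \<Sum>\<alpha>2 = 0..int R - 1.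
           weil_multiplier R r h h' k (\<alpha>1, \<alpha>2) *
           (f_series R (\<alpha>1, \<alpha>2) (of_int h' / of_nat k + \<i> / z)
            + I_series R (\<alpha>1, \<alpha>2) (of_int h' / of_nat k) (of_int h' / of_nat k + \<i> / z))) =
     1 / of_nat R * (\<Sum>l = 0..k - 1. \<Sum>\<^sub>\<infinity>(m, n)\<in>{m. m \<noteq> 0 \<and> int k dvd m - int (h * (R * l + r))} \<times> nonzero_ints.
        cis (- 2 * pi * of_int n * (real (R * l + r) / real (R * k))) * dual_term R z (m, n))"
proof -
  define ph where "ph = (\<lambda>(m, n). cis (2 * pi * (of_int (h' * n * m) / real (R * k))))"
  define d where "d = dual_term R z"
  define \<psi> where "\<psi> = weil_multiplier R r h h' k"
  define NZ where "NZ = nonzero_ints \<times> nonzero_ints"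
  define L where "L = (\<lambda>(\<alpha>1, \<alpha>2). {(m, n). m \<noteq> 0 \<and> n \<noteq> 0 \<and> int R dvd m - \<alpha>2 \<and> int R dvd n - \<alpha>1})"
  define A where "A = {0..int R - 1} \<times> {0..int R - 1}"
  have n1: "norm (ph p) = 1" for p by (simp add: ph_def case_prod_unfold)
  have ds: "(\<lambda>p. norm (d p)) summable_on NZ"
    unfolding d_def NZ_def by (rule dual_term_summable[OF R z])
  have summ: "(\<lambda>p. c p * d p) summable_on NZ" if "\<And>p. norm (c p) \<le> B" for c :: "int \<times> int \<Rightarrow> complex" and B
  proof (rule abs_summable_summable, rule summable_on_comparison_test)
    show "(\<lambda>p. B * norm (d p)) summable_on NZ" by (rule summable_on_cmult_right[OF ds])
    show "norm (c p * d p) \<le> B * norm (d p)" for p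
      unfolding norm_mult by (rule mult_right_mono[OF that]) simp
  qed simp
  have fI: "\<psi> \<alpha> * (f_series R \<alpha> (of_int h' / of_nat k + \<i> / z)
            + I_series R \<alpha> (of_int h' / of_nat k) (of_int h' / of_nat k + \<i> / z)) =
      (\<Sum>\<^sub>\<infinity>p\<in>NZ. (if p \<in> L \<alpha> then \<psi> \<alpha> * ph p else 0) * d p)" for \<alpha>
  proof -
    obtain \<alpha>1 \<alpha>2 where \<alpha>: "\<alpha> = (\<alpha>1, \<alpha>2)" by (cases \<alpha>)
    have "f_series R \<alpha> (of_int h' / of_nat k + \<i> / z) + I_series R \<alpha> (of_int h' / of_nat k) (of_int h' / of_nat k + \<i> / z) =
      (\<Sum>\<^sub>\<infinity>p\<in>L \<alpha>. ph p * d p)"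
      unfolding \<alpha> f_plus_I_series[OF R k z] unfolding L_def prod.case
      by (rule infsum_cong) (auto simp: ph_def d_def)
    then have "\<psi> \<alpha> * (f_series R \<alpha> (of_int h' / of_nat k + \<i> / z)
            + I_series R \<alpha> (of_int h' / of_nat k) (of_int h' / of_nat k + \<i> / z)) = (\<Sum>\<^sub>\<infinity>p\<in>L \<alpha>. \<psi> \<alpha> * (ph p * d p))"
      by (simp only: infsum_cmult_right')
    \<comment> \<open>Extension by 0 gives all the series a common index set, so that finite and
      infinite sums can be interchanged.\<close>
    also have "\<dots> = (\<Sum>\<^sub>\<infinity>p\<in>NZ. (if p \<in> L \<alpha> then \<psi> \<alpha> * ph p else 0) * d p)"
      by (rule infsum_cong_neutral) (auto simp: NZ_def L_def \<alpha>)
    finally show ?thesis .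
  qed
  have "(\<Sum>\<alpha>1 = 0..int R - 1. \<Sum>\<alpha>2 = 0..int R - 1.
           weil_multiplier R r h h' k (\<alpha>1, \<alpha>2) *
           (f_series R (\<alpha>1, \<alpha>2) (of_int h' / of_nat k + \<i> / z)
            + I_series R (\<alpha>1, \<alpha>2) (of_int h' / of_nat k) (of_int h' / of_nat k + \<i> / z))) =
      (\<Sum>\<alpha>\<in>A. \<Sum>\<^sub>\<infinity>p\<in>NZ. (if p \<in> L \<alpha> then \<psi> \<alpha> * ph p else 0) * d p)"
    unfolding A_def sum.cartesian_product fI[symmetric] by (simp add: case_prod_unfold \<psi>_def)
  also have "\<dots> = (\<Sum>\<^sub>\<infinity>p\<in>NZ. \<Sum>\<alpha>\<in>A. (if p \<in> L \<alpha> then \<psi> \<alpha> * ph p else 0) * d p)"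
  proof (rule infsum_finite_sum)
    show "(\<lambda>p. (if p \<in> L \<alpha> then \<psi> \<alpha> * ph p else 0) * d p) summable_on NZ" for \<alpha>
      by (rule summ[of _ "norm (\<psi> \<alpha>)"]) (simp add: norm_mult n1)
  qed (simp add: A_def)
  also have "\<dots> = (\<Sum>\<^sub>\<infinity>p\<in>NZ. \<Sum>l = 0..k - 1. 1 / of_nat R * ((if int k dvd fst p - int (h * (R * l + r))
        then cis (- 2 * pi * of_int (snd p) * (real (R * l + r) / real (R * k))) else 0) * d p))"
  proof (rule infsum_cong)
    fix p assume "p \<in> NZ"
    then obtain m n where p: "p = (m, n)" "m \<noteq> 0" "n \<noteq> 0" by (auto simp: NZ_def)
    define \<alpha>0 where "\<alpha>0 = (n mod int R, m mod int R)"
    have mem: "p \<in> L \<alpha> \<longleftrightarrow> \<alpha> = \<alpha>0" if "\<alpha> \<in> A" for \<alpha>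
    proof -
      obtain \<alpha>1 \<alpha>2 where \<alpha>0: "\<alpha> = (\<alpha>1, \<alpha>2)" by (cases \<alpha>)
      then have \<alpha>: "\<alpha> = (\<alpha>1, \<alpha>2)" "0 \<le> \<alpha>1" "\<alpha>1 < int R" "0 \<le> \<alpha>2" "\<alpha>2 < int R"
        using that by (auto simp: A_def)
      have "int R dvd n - \<alpha>1 \<longleftrightarrow> \<alpha>1 = n mod int R" "int R dvd m - \<alpha>2 \<longleftrightarrow> \<alpha>2 = m mod int R"
        using \<alpha> by (auto simp: mod_eq_dvd_iff[symmetric])
      then show ?thesis using p by (auto simp: L_def \<alpha>(1) \<alpha>0_def)
    qed
    have \<alpha>0: "\<alpha>0 \<in> A" using R by (auto simp: \<alpha>0_def A_def)
    have "(\<Sum>\<alpha>\<in>A. (if p \<in> L \<alpha> then \<psi> \<alpha> * ph p else 0) * d p) = (\<Sum>\<alpha>\<in>A. if \<alpha> = \<alpha>0 then \<psi> \<alpha>0 * ph p * d p else 0)"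
      by (rule sum.cong[OF refl]) (simp add: mem)
    also have "\<dots> = \<psi> \<alpha>0 * ph p * d p"
      using \<alpha>0 by (simp add: sum.delta A_def)
    also have "\<psi> \<alpha>0 * ph p = 1 / of_nat R * (\<Sum>l = 0..k - 1. if int k dvd m - int h * (int R * int l + int r)
        then cis (2 * pi * (of_int (- n * (int R * int l + int r)) / real (R * k))) else 0)"
      unfolding \<psi>_def \<alpha>0_def ph_def p(1) prod.case
      by (rule weil_multiplier_phase[OF R k h']) (simp_all add: mod_eq_dvd_iff[symmetric])
    also have "\<dots> * d p = (\<Sum>l = 0..k - 1. 1 / of_nat R * ((if int k dvd fst p - int (h * (R * l + r))
        then cis (- 2 * pi * of_int (snd p) * (real (R * l + r) / real (R * k))) else 0) * d p))"
      unfolding sum_distrib_left sum_distrib_right p(1) fst_conv snd_conv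
      by (rule sum.cong[OF refl]) (simp add: mult_ac)
    finally show "(\<Sum>\<alpha>\<in>A. (if p \<in> L \<alpha> then \<psi> \<alpha> * ph p else 0) * d p) = \<dots>" .
  qed
  also have "\<dots> = (\<Sum>l = 0..k - 1. \<Sum>\<^sub>\<infinity>p\<in>NZ. 1 / of_nat R * ((if int k dvd fst p - int (h * (R * l + r))
        then cis (- 2 * pi * of_int (snd p) * (real (R * l + r) / real (R * k))) else 0) * d p))"
  proof (rule infsum_finite_sum[symmetric])
    show "(\<lambda>p. 1 / of_nat R * ((if int k dvd fst p - int (h * (R * l + r))
        then cis (- 2 * pi * of_int (snd p) * (real (R * l + r) / real (R * k))) else 0) * d p)) summable_on NZ" for l
      by (rule summable_on_cmult_right, rule summ[of _ 1]) simp
  qed simp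
  also have "\<dots> = 1 / of_nat R * (\<Sum>l = 0..k - 1. \<Sum>\<^sub>\<infinity>p\<in>NZ. (if int k dvd fst p - int (h * (R * l + r))
        then cis (- 2 * pi * of_int (snd p) * (real (R * l + r) / real (R * k))) else 0) * d p)"
    unfolding sum_distrib_left by (simp only: infsum_cmult_right')
  also have "(\<Sum>l = 0..k - 1. \<Sum>\<^sub>\<infinity>p\<in>NZ. (if int k dvd fst p - int (h * (R * l + r))
        then cis (- 2 * pi * of_int (snd p) * (real (R * l + r) / real (R * k))) else 0) * d p) =
      (\<Sum>l = 0..k - 1. \<Sum>\<^sub>\<infinity>(m, n)\<in>{m. m \<noteq> 0 \<and> int k dvd m - int (h * (R * l + r))} \<times> nonzero_ints.
        cis (- 2 * pi * of_int n * (real (R * l + r) / real (R * k))) * dual_term R z (m, n))"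
    by (rule sum.cong[OF refl], rule infsum_cong_neutral) (auto simp: NZ_def d_def)
  finally show ?thesis .
qed

text \<open>The formula for Ln(1 - e^{2 pi i x}) requires 0 < x < 1 and is applied to the fractional
  part of b / k, which minus 1/2 is the sawtooth. Returning to b / k may change the sign of the
  sine, which the square in \<open>A_coeff\<close> absorbs. The second claim is the boundary value g
  0, the source of the cotangent in \<open>B_coeff\<close>.\<close>

lemma Ln_one_minus_exp_rational:
  fixes b k :: nat
  assumes k: "k > 0" and b: "\<not> k dvd b"
  shows "Ln (1 - exp (2 * pi * \<i> * of_int (int b) / of_nat k)) =
      pi * \<i> * of_real (sawtooth (real b / real k)) + of_real (ln (4 * (sin (pi * real b / real k))\<^sup>2)) / 2"
    and "1 / (exp (- (2 * pi * \<i> * of_int (int b) / of_nat k)) - 1) = - 1 / 2 * (1 - \<i> * of_real (cot (pi * real b / real k)))"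
proof -
  define x where "x = real b / real k"
  have notint: "x \<notin> \<int>"
  proof
    assume "x \<in> \<int>"
    then obtain c :: int where "x = of_int c" by (rule Ints_cases)
    then have "real b = of_int c * real k" using k by (simp add: x_def field_simps)
    then have "int b = c * int k" by (metis of_int_eq_iff of_int_mult of_int_of_nat_eq)
    then have "int k dvd int b" by simp
    with b show False by simp
  qed
  define f where "f = x - of_int \<lfloor>x\<rfloor>"
  have f: "0 < f" "f < 1"
  proof -
    have "0 \<le> f" "f < 1" unfolding f_def by linarith+
    moreover have "f \<noteq> 0"
    proof
      assume "f = 0"
      then have "x = of_int \<lfloor>x\<rfloor>" by (simp add: f_def)
      then have "x \<in> \<int>" by (metis Ints_of_int)
      with notint show False by contradiction
    qed
    ultimately show "0 < f" "f < 1" by auto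
  qed
  have x: "x = f + of_int \<lfloor>x\<rfloor>" by (simp add: f_def)
  have cx: "cis (2 * pi * x) = cis (2 * pi * f)"
    by (subst x) (rule cis_add_integer)
  have e: "exp (2 * pi * \<i> * of_int (int b) / of_nat k) = cis (2 * pi * x)"
    by (simp add: cis_conv_exp x_def mult_ac)
  have sf: "sin (pi * f) > 0" using f by (intro sin_gt_zero) auto
  have sq: "(sin (pi * x))\<^sup>2 = (sin (pi * f))\<^sup>2"
  proof -
    have "cos (2 * (pi * x)) = cos (2 * (pi * f))"
      using arg_cong[OF cx, of Re] by (simp add: mult.assoc)
    then show ?thesis unfolding cos_double_sin by simp
  qed
  have "ln (4 * (sin (pi * x))\<^sup>2) = ln ((2 * sin (pi * f))\<^sup>2)"
    unfolding sq by (simp add: power_mult_distrib)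
  also have "\<dots> = 2 * ln (2 * sin (pi * f))"
    using sf by (subst ln_realpow) auto
  finally have l: "ln (4 * (sin (pi * x))\<^sup>2) = 2 * ln (2 * sin (pi * f))" .
  have saw: "sawtooth x = f - 1/2" using notint by (simp add: sawtooth_def f_def)
  have "Ln (1 - exp (2 * pi * \<i> * of_int (int b) / of_nat k)) = pi * \<i> * of_real (sawtooth x) + of_real (ln (4 * (sin (pi * x))\<^sup>2)) / 2"
    unfolding e cx Ln_one_minus_cis(2)[OF f] l saw by simp
  then show "Ln (1 - exp (2 * pi * \<i> * of_int (int b) / of_nat k)) =
      pi * \<i> * of_real (sawtooth (real b / real k)) + of_real (ln (4 * (sin (pi * real b / real k))\<^sup>2)) / 2"
    by (simp add: x_def)
  define S where "S = sin (pi * x)"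
  define C where "C = cos (pi * x)"
  have S0: "S \<noteq> 0" using sq sf by (auto simp: S_def)
  have e2: "exp (- (2 * pi * \<i> * of_int (int b) / of_nat k)) = cis (- (pi * x)) * cis (- (pi * x))"
    unfolding cis_mult by (simp add: cis_conv_exp x_def mult_ac)
  have "1 = cis (- (pi * x)) * cis (pi * x)" by (simp add: cis_mult)
  then have "exp (- (2 * pi * \<i> * of_int (int b) / of_nat k)) - 1 = cis (- (pi * x)) * (cis (- (pi * x)) - cis (pi * x))"
    unfolding e2 by (simp add: right_diff_distrib)
  also have "cis (- (pi * x)) - cis (pi * x) = - 2 * \<i> * of_real S"
    by (simp add: complex_eq_iff S_def)
  finally have den: "exp (- (2 * pi * \<i> * of_int (int b) / of_nat k)) - 1 = cis (- (pi * x)) * (- 2 * \<i> * of_real S)" .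
  have cisx: "cis (pi * x) = of_real C + \<i> * of_real S" by (simp add: complex_eq_iff S_def C_def)
  have "1 / (exp (- (2 * pi * \<i> * of_int (int b) / of_nat k)) - 1) = cis (pi * x) / (- 2 * \<i> * of_real S)"
  proof -
    have "1 / (u * D) = v / D" if "v * u = 1" for u v D :: complex
    proof -
      have "u \<noteq> 0" using that by auto
      have "1 / (u * D) = (v * u) / (u * D)" by (simp only: that)
      also have "\<dots> = v / D" using \<open>u \<noteq> 0\<close> by simp
      finally show ?thesis .
    qed
    moreover have "cis (pi * x) * cis (- (pi * x)) = 1" by (simp add: cis_mult)
    ultimately show ?thesis unfolding den by blast
  qed
  also have "\<dots> = - 1 / 2 * (1 - \<i> * of_real (C / S))"
    unfolding cisx using S0 by (simp add: field_simps)
  also have "C / S = cot (pi * x)" by (simp add: cot_def C_def S_def)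
  finally show "1 / (exp (- (2 * pi * \<i> * of_int (int b) / of_nat k)) - 1) = - 1 / 2 * (1 - \<i> * of_real (cot (pi * real b / real k)))"
    by (simp add: x_def)
qed

theorem theorem1p1:
  fixes R r h k :: nat and h' :: int and z :: complex
  assumes "R \<ge> 1" and "r \<in> {1..R}"
    and "h < k" and "gcd h k = 1"
    and "0 \<le> h'" and "h' < int k" and "[int h * h' = - 1] (mod int k)"
    and "Re z > 0"
  shows "F_series R r (of_nat h / of_nat k + \<i> * z / (of_nat k)\<^sup>2) =
      - of_real (C_coeff R r k) * Ln z / z
      + A_coeff R r h k / z + B_coeff R r h k
      + \<i> * of_nat k / z *
        (\<Sum>\<alpha>1 = 0..int R - 1. \<Sum>\<alpha>2 = 0..int R - 1.
           weil_multiplier R r h h' k (\<alpha>1, \<alpha>2) *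
           (f_series R (\<alpha>1, \<alpha>2) (of_int h' / of_nat k + \<i> / z)
            + I_series R (\<alpha>1, \<alpha>2) (of_int h' / of_nat k) (of_int h' / of_nat k + \<i> / z)))"
proof -
  have R: "R > 0" and k: "k > 0" using assms by auto
  have z0: "z \<noteq> 0" using assms(8) by auto
  have Rn: "complex_of_nat R \<noteq> 0" "real R > 0" using R by auto
  have kn: "complex_of_nat k \<noteq> 0" "real k > 0" using k by auto
  define Z where "Z = of_nat R * z / of_nat k"
  have Zr: "Z = of_real (real R / real k) * z" by (simp add: Z_def)
  have Z: "Re Z > 0" unfolding Zr using R k assms(8) by simp
  have Z0: "Z \<noteq> 0" using Z by auto
  define M where "M = (\<lambda>l. R * l + r)"
  define a where "a = (\<lambda>l. real (M l) / real (R * k))"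
  have a: "0 < a l" "a l \<le> 1" if "l \<in> {0..k - 1}" for l
  proof -
    have "Suc l \<le> k" using that k by auto
    then have "R * Suc l \<le> R * k" by (rule mult_le_mono2)
    then have "M l \<le> R * k" using assms(2) by (simp add: M_def)
    then show "a l \<le> 1" using R k unfolding a_def by (subst divide_le_eq_1_pos) (simp_all flip: of_nat_mult)
    have "M l > 0" using assms(2) by (simp add: M_def)
    then show "0 < a l" using R k by (simp add: a_def)
  qed
  define D where "D = (\<lambda>l. \<Sum>\<^sub>\<infinity>(m, n)\<in>{m. m \<noteq> 0 \<and> int k dvd m - int (h * M l)} \<times> nonzero_ints.
        cis (- 2 * pi * of_int n * a l) * dual_term R z (m, n))"
  \<comment> \<open>The elementary part of class l: its share of \<open>A_coeff\<close> / z and of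
    \<open>B_coeff\<close>, and, if k divides M l, a multiple of Ln z / z that the count below turns
    into \<open>C_coeff\<close>.\<close>
  define X where "X = (\<lambda>l. - (of_nat k / (2 * pi * of_nat R)) * (pi * \<i> * of_real (sawtooth (real (h * M l) / real k))
        + of_bool (\<not> k dvd M l) / 2 * of_real (ln (4 * (sin (pi * real (h * M l) / real k))\<^sup>2))
        + of_bool (k dvd M l) * of_real (ln (2 * pi * real R / real k) + Digamma (real (M l) / real (R * k)))) / z
      + 1 / 2 * (of_real (real (M l) / real (R * k) - 1 / 2)
          * (1 - \<i> * of_bool (\<not> k dvd M l) * of_real (cot (pi * real (h * M l) / real k))))
      - (of_bool (k dvd M l) :: complex) * (of_nat k / (2 * pi * of_nat R)) * (Ln z / z))"
  \<comment> \<open>Coprimality of h and k: the summand has a pole at 0 exactly when k divides M,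
    the case distinction of \<open>A_coeff\<close> and \<open>B_coeff\<close>.\<close>
  have dvd_iff: "int k dvd int (h * M l) \<longleftrightarrow> k dvd M l" for l
    using assms(4) by (simp only: int_dvd_int_iff) (simp add: coprime_dvd_mult_right_iff coprime_iff_gcd_eq_1 gcd.commute)
  have c2Z: "1 / (2 * pi * Z) = of_nat k / (2 * pi * of_nat R) / z"
    using kn Rn z0 by (simp add: Z_def)
  have limit: "(\<lambda>N. \<Sum>j<N. nome (of_nat h / of_nat k + \<i> * z / (of_nat k)\<^sup>2) ^ (R * l + r + R * k * j) /
        (1 - nome (of_nat h / of_nat k + \<i> * z / (of_nat k)\<^sup>2) ^ (R * l + r + R * k * j))) \<longlonglongrightarrow> \<i> * of_nat k / z * (1 / of_nat R * D l) + X l"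
    if l: "l \<in> {0..k - 1}" for l
  proof -
    define g where "g = (\<lambda>x::real. 1 / (exp (2 * pi * of_real x * Z - 2 * pi * \<i> * of_int (int (h * M l)) / of_nat k) - 1))"
    define t where "t = (\<lambda>(m, n). cis (- 2 * pi * of_int n * a l) / of_real ((2 * pi * of_int n)\<^sup>2) *
            (- 2 * pi * \<i> * of_int n * fourier_inverse_square (of_int n) (- \<i> * of_real (of_int m / of_nat k) * (1 / Z))))"
    have summand: "nome (of_nat h / of_nat k + \<i> * z / (of_nat k)\<^sup>2) ^ (R * l + r + R * k * j) /
        (1 - nome (of_nat h / of_nat k + \<i> * z / (of_nat k)\<^sup>2) ^ (R * l + r + R * k * j)) = g (a l + real j)" for j
      using nome_power_quotient[OF k R, of h z "M l" j] unfolding g_def a_def M_def Z_def .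
    have t: "(\<Sum>\<^sub>\<infinity>p\<in>{m. m \<noteq> 0 \<and> int k dvd m - int (h * M l)} \<times> nonzero_ints. t p) / (2 * pi * Z) = \<i> * of_nat k / z * (1 / of_nat R * D l)"
    proof -
      have "(\<Sum>\<^sub>\<infinity>p\<in>{m. m \<noteq> 0 \<and> int k dvd m - int (h * M l)} \<times> nonzero_ints. t p) = 2 * pi * \<i> * D l"
        unfolding D_def infsum_cmult_right'[symmetric]
      proof (rule infsum_cong)
        fix p assume "p \<in> {m. m \<noteq> 0 \<and> int k dvd m - int (h * M l)} \<times> nonzero_ints"
        then obtain m n where p: "p = (m, n)" "n \<noteq> 0" by auto
        \<comment> \<open>k cancels: the poles lie at i m / (R z), and only the residue class of m
          still depends on k.\<close>
        have s: "- \<i> * of_real (of_int m / of_nat k) * (1 / Z) = - \<i> * of_real (of_int m / real R) * (1 / z)"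
          using kn Rn z0 by (simp add: Z_def field_simps)
        show "t p = 2 * pi * \<i> * (case p of (m, n) \<Rightarrow> cis (- 2 * pi * of_int n * a l) * dual_term R z (m, n))"
          unfolding t_def dual_term_def p(1) prod.case s using p(2) by (simp add: field_simps power2_eq_square)
      qed
      then show ?thesis using kn Rn z0 by (simp add: Z_def field_simps)
    qed
    show ?thesis
    proof (cases "k dvd M l")
      case False
      then have b2: "\<not> int k dvd int (h * M l)" using dvd_iff by blast
      then have b: "\<not> k dvd h * M l" by (simp only: int_dvd_int_iff not_False_eq_True)
      have lim: "(\<lambda>N. \<Sum>j<N. g (a l + real j)) \<longlonglongrightarrow>
        (\<Sum>\<^sub>\<infinity>p\<in>{m. m \<noteq> 0 \<and> int k dvd m - int (h * M l)} \<times> nonzero_ints. t p) / (2 * pi * Z)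
      - Ln (1 - exp (2 * pi * \<i> * of_int (int (h * M l)) / of_nat k)) / (2 * pi * Z) - of_real (a l - 1/2) * g 0"
        unfolding g_def t_def by (rule lambert_class_limit[OF Z k b2]) (use a[OF l] in auto)
      have g0: "g 0 = - 1 / 2 * (1 - \<i> * of_real (cot (pi * real (h * M l) / real k)))"
        using Ln_one_minus_exp_rational(2)[OF k b] by (simp add: g_def)
      have X: "- (Ln (1 - exp (2 * pi * \<i> * of_int (int (h * M l)) / of_nat k)) / (2 * pi * Z)) - of_real (a l - 1/2) * (- 1 / 2 * (1 - \<i> * of_real (cot (pi * real (h * M l) / real k)))) = X l"
      proof -
        have "Ln (1 - exp (2 * pi * \<i> * of_int (int (h * M l)) / of_nat k)) / (2 * pi * Z) =
           1 / (2 * pi * Z) * (pi * \<i> * of_real (sawtooth (real (h * M l) / real k)) + of_real (ln (4 * (sin (pi * real (h * M l) / real k))\<^sup>2)) / 2)"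
          unfolding Ln_one_minus_exp_rational(1)[OF k b] by simp
        also have "1 / (2 * pi * Z) = of_nat k / (2 * pi * of_nat R) / z" by (rule c2Z)
        finally show ?thesis using False by (simp add: X_def a_def)
      qed
      have "A - B - C = A + (- B - C)" for A B C :: complex by simp
      from lim[unfolded t g0 this X] show ?thesis unfolding summand .
    next
      case True
      then have b: "int k dvd int (h * M l)" using dvd_iff by simp
      obtain c where c: "int (h * M l) = int k * c" using b by (rule dvdE)
      have g: "g x = 1 / (exp (2 * pi * of_real x * Z) - 1)" for x
      proof -
        have "2 * pi * \<i> * of_int (int (h * M l)) / of_nat k = 2 * complex_of_int c * complex_of_real pi * \<i>"
          unfolding c using kn by (simp add: field_simps)
        then have "exp (2 * pi * of_real x * Z - 2 * pi * \<i> * of_int (int (h * M l)) / of_nat k) = exp (2 * pi * of_real x * Z)"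
          using exp_2pi_1_int[of c] by (simp only: exp_diff mult_ac) (simp add: mult_ac)
        then show ?thesis by (simp only: g_def)
      qed
      have lim: "(\<lambda>N. \<Sum>j<N. g (a l + real j)) \<longlonglongrightarrow>
        (\<Sum>\<^sub>\<infinity>p\<in>{m. m \<noteq> 0 \<and> int k dvd m - int (h * M l)} \<times> nonzero_ints. t p) / (2 * pi * Z)
         - (Ln (2 * pi * Z) + of_real (Digamma (a l))) / (2 * pi * Z) + of_real (a l - 1/2) / 2"
        unfolding g t_def by (rule lambert_zero_class_limit[OF Z k b a[OF l]])
      have X: "- ((Ln (2 * pi * Z) + of_real (Digamma (a l))) / (2 * pi * Z)) + of_real (a l - 1/2) / 2 = X l"
      proof -
        \<comment> \<open>At an integer \<open>sawtooth\<close> has the value 0, so this part of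
          \<open>A_coeff\<close> vanishes for the present l.\<close>
        have "real (h * M l) / real k = of_int c"
          using c kn by (metis nonzero_mult_div_cancel_left of_int_mult of_int_of_nat_eq less_irrefl)
        then have saw: "sawtooth (real (h * M l) / real k) = 0" by (simp add: sawtooth_def)
        \<comment> \<open>The factor 2 pi R / k is a positive real, so Ln splits without a branch
          correction: its logarithm goes into \<open>A_coeff\<close>, and Ln z into the term with
          \<open>C_coeff\<close>.\<close>
        have "2 * pi * Z = of_real (2 * pi * real R / real k) * z" by (simp add: Zr)
        then have Ln: "Ln (2 * pi * Z) = of_real (ln (2 * pi * real R / real k)) + Ln z"
        proof -
          have pos: "2 * pi * real R / real k > 0" using Rn kn by simp
          from Ln_times_of_real[OF pos z0, unfolded Ln_of_real[OF pos]] show ?thesis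
            unfolding \<open>2 * pi * Z = of_real (2 * pi * real R / real k) * z\<close> .
        qed
        have "(Ln (2 * pi * Z) + of_real (Digamma (a l))) / (2 * pi * Z) =
          1 / (2 * pi * Z) * (of_real (ln (2 * pi * real R / real k)) + Ln z + of_real (Digamma (a l)))"
          unfolding Ln by simp
        also have "1 / (2 * pi * Z) = of_nat k / (2 * pi * of_nat R) / z" by (rule c2Z)
        finally have e: "(Ln (2 * pi * Z) + of_real (Digamma (a l))) / (2 * pi * Z) =
          of_nat k / (2 * pi * of_nat R) / z * (of_real (ln (2 * pi * real R / real k)) + Ln z + of_real (Digamma (a l)))" .
        have al: "real (M l) / real (R * k) = a l" by (simp add: a_def)
        have alg: "- (c / z * (u + Ln z + v)) + w / 2 = - c * (u + v) / z + 1 / 2 * w - c * (Ln z / z)" for c u v w :: complex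
          by (simp add: add_divide_distrib diff_divide_distrib ring_distribs)
        have "X l = - (of_nat k / (2 * pi * of_nat R)) * (complex_of_real (ln (2 * pi * real R / real k)) + complex_of_real (Digamma (a l))) / z
            + 1 / 2 * complex_of_real (a l - 1/2) - of_nat k / (2 * pi * of_nat R) * (Ln z / z)"
          unfolding X_def al saw using True by simp
        then show ?thesis unfolding e by (simp only: alg of_real_minus)
      qed
      have "A - B + C = A + (- B + C)" for A B C :: complex by simp
      from lim[unfolded t this X] show ?thesis unfolding summand .
    qed
  qed
  have Im: "Im (of_nat h / of_nat k + \<i> * z / (of_nat k)\<^sup>2) > 0"
  proof -
    have "of_nat h / of_nat k + \<i> * z / (of_nat k)\<^sup>2 = of_real (real h / real k) + of_real (1 / (real k)\<^sup>2) * (\<i> * z)"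
      by simp
    then have "Im (of_nat h / of_nat k + \<i> * z / (of_nat k)\<^sup>2) = 1 / (real k)\<^sup>2 * Re z" by simp
    then show ?thesis using kn assms(8) by simp
  qed
  have "F_series R r (of_nat h / of_nat k + \<i> * z / (of_nat k)\<^sup>2) = (\<Sum>l = 0..k - 1. \<i> * of_nat k / z * (1 / of_nat R * D l) + X l)"
    by (rule F_series_eq_sum[OF assms(1,2) k Im limit])
  also have "\<dots> = \<i> * of_nat k / z * (1 / of_nat R * (\<Sum>l = 0..k - 1. D l)) + (\<Sum>l = 0..k - 1. X l)"
    by (simp only: sum.distrib sum_distrib_left)
  also have "1 / of_nat R * (\<Sum>l = 0..k - 1. D l) = (\<Sum>\<alpha>1 = 0..int R - 1. \<Sum>\<alpha>2 = 0..int R - 1.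
           weil_multiplier R r h h' k (\<alpha>1, \<alpha>2) *
           (f_series R (\<alpha>1, \<alpha>2) (of_int h' / of_nat k + \<i> / z)
            + I_series R (\<alpha>1, \<alpha>2) (of_int h' / of_nat k) (of_int h' / of_nat k + \<i> / z)))"
    unfolding D_def M_def a_def by (rule sum_weil_multiplier_series[OF R k assms(8,7), symmetric])
  also have "(\<Sum>l = 0..k - 1. X l) = A_coeff R r h k / z + B_coeff R r h k - of_real (C_coeff R r k) * Ln z / z"
  proof -
    have "(\<Sum>l = 0..k - 1. (of_bool (k dvd M l) :: complex)) = complex_of_nat (card {l \<in> {0..k - 1}. k dvd R * l + r})"
      by (simp add: M_def sum.If_cases of_bool_def Int_def)
    also have "\<dots> = of_nat (gcd R k) * of_bool (gcd R k dvd r)"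
      unfolding card_linear_congruence[OF k R] by simp
    finally have count: "(\<Sum>l = 0..k - 1. (of_bool (k dvd M l) :: complex)) = of_nat (gcd R k) * (of_bool (gcd R k dvd r) :: complex)" .
    have cnt: "(\<Sum>l = 0..k - 1. (of_bool (k dvd M l) :: complex)) * (of_nat k / (2 * pi * of_nat R)) = complex_of_real (C_coeff R r k)"
    proof -
      \<comment> \<open>The count gives gcd times k / (2 pi R); this identity brings it to the form
        with lcm in \<open>C_coeff\<close>.\<close>
      have "real (gcd R k) * real (lcm R k) = real R * real k"
        using prod_gcd_lcm_nat[of R k] by (metis of_nat_mult)
      moreover have "real (lcm R k) > 0" using R k by (simp add: lcm_pos_nat)
      ultimately have "real (gcd R k) = real R * real k / real (lcm R k)"
        by (subst eq_divide_eq) auto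
      then have "real (gcd R k) * (real k / (2 * pi * real R)) = (real k)\<^sup>2 / (2 * pi * real (lcm R k))"
        using Rn by (simp add: power2_eq_square)
      then have "real (gcd R k) * of_bool (gcd R k dvd r) * (real k / (2 * pi * real R)) = C_coeff R r k"
        by (simp add: C_coeff_def)
      then have "complex_of_real (real (gcd R k) * of_bool (gcd R k dvd r) * (real k / (2 * pi * real R))) = of_real (C_coeff R r k)"
        by (simp only:)
      then show ?thesis unfolding count by (cases "gcd R k dvd r") auto
    qed
    have split: "(\<Sum>l = 0..k - 1. c * T l / z + 1 / 2 * Y l - b l * d * u) =
        c * (\<Sum>l = 0..k - 1. T l) / z + 1 / 2 * (\<Sum>l = 0..k - 1. Y l) - (\<Sum>l = 0..k - 1. b l) * d * u"
      for c d u :: complex and T Y b :: "nat \<Rightarrow> complex"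
      by (simp only: sum.distrib sum_subtractf sum_distrib_left sum_distrib_right sum_divide_distrib)
    have "(\<Sum>l = 0..k - 1. X l) = A_coeff R r h k / z + B_coeff R r h k
       - (\<Sum>l = 0..k - 1. (of_bool (k dvd M l) :: complex)) * (of_nat k / (2 * pi * of_nat R)) * (Ln z / z)"
      unfolding X_def split A_coeff_def B_coeff_def M_def by (simp only: minus_divide_left)
    then show ?thesis unfolding cnt by simp
  qed
  finally show ?thesis by (simp add: algebra_simps)
qed

end
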